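(* Let $X$ and $Y$ be scaling elements (each in some $C^*$-algebra). There exists a $*$-isomorphism $\varphi\colon C^*(X)\to C^*(Y)$ with $\varphi(X)=Y$ if and only if $\mathrm{sp}(|X^*|)=\mathrm{sp}(|Y^*|)$ and $X,Y$ are either both proper or both non-proper.
   Context: An element $X$ of a $C^*$-algebra is a scaling element if $(X^*X)X=X$ and $X^*X\neq XX^*$. $C^*(X)$ denotes the (not necessarily unital) $C^*$-algebra generated by $X$. Here $|X|=(X^*X)^{1/2}$, $|X^*|=(XX^* )^{1/2}$, $\mathrm{sp}$ denotes the spectrum (taken in the unitization if the algebra is non-unital), and $1_C$ is the characteristic function of a set $C$. For every scaling element $X$ one has $0,1\in\mathrm{sp}(|X^*|)\subset[0,\infty)$, and $\mathrm{sp}(|X|)\cup\{0\}=\mathrm{sp}(|X^*|)$. A scaling element $X$ is called non-proper if $\mathrm{sp}(|X^*|)\setminus\{0,1\}$ is compact and $1_{\{1\}}(|X|)=1_{\mathrm{sp}(|X^*|)\setminus\{0\}}(|X^*|)$ (functional calculus; when $\mathrm{sp}(|X^*|)\setminus\{0,1\}$ is compact these functions are continuous on the relevant spectra). Otherwise $X$ is called proper. *)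

theory Defs
  imports "HOL-Analysis.Analysis"
begin

text \<open>C*-algebras, not necessarily unital.\<close>

class cstar_algebra = real_normed_algebra + banach +
  fixes scaleC :: "complex \<Rightarrow> 'a \<Rightarrow> 'a"  (infixr \<open>*\<^sub>C\<close> 75)
    and adj :: "'a \<Rightarrow> 'a"
  assumes scaleC_add_right: "c *\<^sub>C (x + y) = c *\<^sub>C x + c *\<^sub>C y"
    and scaleC_add_left: "(c + d) *\<^sub>C x = c *\<^sub>C x + d *\<^sub>C x"
    and scaleC_scaleC: "c *\<^sub>C d *\<^sub>C x = (c * d) *\<^sub>C x"
    and scaleR_scaleC: "r *\<^sub>R x = complex_of_real r *\<^sub>C x"
    and mult_scaleC_left: "(c *\<^sub>C x) * y = c *\<^sub>C (x * y)"
    and mult_scaleC_right: "x * (c *\<^sub>C y) = c *\<^sub>C (x * y)"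
    and norm_scaleC: "norm (c *\<^sub>C x) = cmod c * norm x"
    and adj_adj: "adj (adj x) = x"
    and adj_add: "adj (x + y) = adj x + adj y"
    and adj_scaleC: "adj (c *\<^sub>C x) = cnj c *\<^sub>C adj x"
    and adj_mult: "adj (x * y) = adj y * adj x"
    and cstar_identity: "norm (adj x * x) = (norm x)\<^sup>2"

definition star_subalgebra :: "'a::cstar_algebra set \<Rightarrow> bool" where
  "star_subalgebra S \<longleftrightarrow> 0 \<in> S
    \<and> (\<forall>x\<in>S. \<forall>y\<in>S. x + y \<in> S \<and> x * y \<in> S)
    \<and> (\<forall>c. \<forall>x\<in>S. c *\<^sub>C x \<in> S)
    \<and> (\<forall>x\<in>S. adj x \<in> S)"

definition cstar_generated :: "'a::cstar_algebra \<Rightarrow> 'a set" where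
  "cstar_generated X = (\<lambda>S. star_subalgebra S \<and> closed S) hull {X}"

definition star_isomorphism ::
  "'a::cstar_algebra set \<Rightarrow> 'b::cstar_algebra set \<Rightarrow> ('a \<Rightarrow> 'b) \<Rightarrow> bool" where
  "star_isomorphism S T \<phi> \<longleftrightarrow> bij_betw \<phi> S T
    \<and> (\<forall>x\<in>S. \<forall>y\<in>S. \<phi> (x + y) = \<phi> x + \<phi> y \<and> \<phi> (x * y) = \<phi> x * \<phi> y)
    \<and> (\<forall>c. \<forall>x\<in>S. \<phi> (c *\<^sub>C x) = c *\<^sub>C \<phi> x)
    \<and> (\<forall>x\<in>S. \<phi> (adj x) = adj (\<phi> x))"

definition is_unit_of_algebra :: "'a::cstar_algebra \<Rightarrow> bool" where
  "is_unit_of_algebra e \<longleftrightarrow> (\<forall>x. e * x = x \<and> x * e = x)"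

definition invertible_wrt :: "('c \<Rightarrow> 'c \<Rightarrow> 'c) \<Rightarrow> 'c \<Rightarrow> 'c \<Rightarrow> bool" where
  "invertible_wrt mul e x \<longleftrightarrow> (\<exists>y. mul x y = e \<and> mul y x = e)"

text \<open>
  The unitization consists of the pairs \<open>(a, z)\<close>, thought of as \<open>a + z 1\<close>.
  Invertibility does not involve its norm, so only the product is needed.
\<close>

definition unitization_mult ::
  "'a::cstar_algebra \<times> complex \<Rightarrow> 'a \<times> complex \<Rightarrow> 'a \<times> complex" where
  "unitization_mult p q =
    (fst p * fst q + snd p *\<^sub>C fst q + snd q *\<^sub>C fst p, snd p * snd q)"

definition spectrum :: "'a::cstar_algebra \<Rightarrow> complex set" where
  "spectrum a =
    (if \<exists>e::'a. is_unit_of_algebra e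
     then let e = (THE e. is_unit_of_algebra e)
          in {z. \<not> invertible_wrt (*) e (z *\<^sub>C e - a)}
     else {z. \<not> invertible_wrt unitization_mult (0, 1) (- a, z)})"

text \<open>
  Continuous functional calculus, restricted to functions vanishing at \<open>0\<close>: for these
  \<open>f(a)\<close> lies in the algebra itself, whether or not it is unital.
  If \<open>0\<close> is not in the spectrum of \<open>a\<close>, the value of \<open>f\<close> at \<open>0\<close> is irrelevant because of
  the clause identifying functions that agree on the spectrum.
  For normal \<open>a\<close> there is a \<open>\<Phi>\<close> as in \<open>functional_calculus\<close>, and its values on
  \<open>calculus_functions a\<close> are uniquely determined.
\<close>

definition calculus_functions :: "'a::cstar_algebra \<Rightarrow> (complex \<Rightarrow> complex) set" where
  "calculus_functions a = {f. continuous_on (spectrum a) f \<and> f 0 = 0}"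

definition functional_calculus ::
  "'a::cstar_algebra \<Rightarrow> ((complex \<Rightarrow> complex) \<Rightarrow> 'a) \<Rightarrow> bool" where
  "functional_calculus a \<Phi> \<longleftrightarrow>
    (\<forall>f\<in>calculus_functions a. \<forall>g\<in>calculus_functions a.
        ((\<forall>z\<in>spectrum a. f z = g z) \<longrightarrow> \<Phi> f = \<Phi> g)
      \<and> \<Phi> (\<lambda>z. f z + g z) = \<Phi> f + \<Phi> g
      \<and> \<Phi> (\<lambda>z. f z * g z) = \<Phi> f * \<Phi> g)
    \<and> (\<forall>c. \<forall>f\<in>calculus_functions a. \<Phi> (\<lambda>z. c * f z) = c *\<^sub>C \<Phi> f)
    \<and> (\<forall>f\<in>calculus_functions a. \<Phi> (\<lambda>z. cnj (f z)) = adj (\<Phi> f))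
    \<and> \<Phi> (\<lambda>z. z) = a"

definition apply_calculus :: "(complex \<Rightarrow> complex) \<Rightarrow> 'a::cstar_algebra \<Rightarrow> 'a" where
  "apply_calculus f a = (THE y. \<exists>\<Phi>. functional_calculus a \<Phi> \<and> \<Phi> f = y)"

text \<open>On \<open>[0,\<infinity>)\<close>, which contains the spectrum of \<open>adj x * x\<close>, \<open>csqrt\<close> is the usual root.\<close>

definition absolute_value :: "'a::cstar_algebra \<Rightarrow> 'a" where
  "absolute_value x = apply_calculus csqrt (adj x * x)"

definition scaling_element :: "'a::cstar_algebra \<Rightarrow> bool" where
  "scaling_element X \<longleftrightarrow> (adj X * X) * X = X \<and> adj X * X \<noteq> X * adj X"

definition nonproper :: "'a::cstar_algebra \<Rightarrow> bool" where
  "nonproper X \<longleftrightarrow> scaling_element X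
    \<and> compact (spectrum (absolute_value (adj X)) - {0, 1})
    \<and> apply_calculus (indicator {1}) (absolute_value X)
      = apply_calculus (indicator (spectrum (absolute_value (adj X)) - {0}))
          (absolute_value (adj X))"

definition proper :: "'a::cstar_algebra \<Rightarrow> bool" where
  "proper X \<longleftrightarrow> scaling_element X \<and> \<not> nonproper X"

end

theory Submission
  imports Defs "HOL-Computational_Algebra.Fundamental_Theorem_Algebra"
begin

text \<open>
  Put \<open>h = X\<^sup>* X\<close>, so that \<open>h X = X\<close>. Every *-polynomial in \<open>X\<close> is then a finite sum of monomials
  \<open>X\<^sup>n f(h) X\<^sup>*\<^sup>m\<close>. Multiplying it by \<open>X\<^sup>*\<^sup>i\<close> and \<open>X\<^sup>l\<close> and cutting down by functions of \<open>h\<close>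
  vanishing at \<open>1\<close>, which annihilate \<open>X\<close>, isolates its matrix entries in the weighted shifts with
  weights \<open>(t, 1, 1, \<dots>)\<close>, for \<open>t\<close> in the spectrum of \<open>|X\<^sup>*|\<close> other than \<open>0\<close> and \<open>1\<close>. The entries for
  \<open>t = 1\<close> come from a limit \<open>t \<rightarrow> 1\<close> or \<open>t \<rightarrow> 0\<close> or, if there is none, from the difference of the
  spectral projection of \<open>h\<close> at \<open>1\<close> and the range projection of \<open>X\<close>, which vanishes exactly for
  non-proper \<open>X\<close>. In this way the norms of the same *-polynomial in \<open>X\<close> and in \<open>Y\<close> agree up to a
  factor that is quadratic in the degree, and the C*-identity removes this factor. So \<open>X \<mapsto> Y\<close>
  extends to an isometry. Conversely, a *-isomorphism is isometric, and the norms of the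
  *-polynomials determine the spectrum and the type.
\<close>

section \<open>Unital C*-algebras and the unitization\<close>

text \<open>No representation of either algebra is built. Two estimates face each other:
  compressions bound matrix entries by the norm of a normal form, and the triangle inequality over
  its \<open>(N + 1)^2\<close> monomials bounds the norm by suprema of weighted coefficients. This
  count is the origin of the quadratic factor. The obstacle is the point 1. Functions of
  \<open>h\<close> that annihilate \<open>X\<close> vanish there, so a coefficient's value at 1
  shows up only inside sums along a diagonal. In the shift-free case the individual values are not
  even determined by the element, since a multiple of the spectral projection at 1 can be traded for
  a monomial one step further down the diagonal; the coefficients must then be normalized before
  they can be estimated. The functional calculus takes place in the unitization, where 0 always
  belongs to the spectrum of an embedded element. This handles unital and non-unital algebras
  together, and \<open>f 0 = 0\<close> becomes the condition for staying in the original
  algebra.\<close>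

lemma scaleC_1 [simp]: "1 *\<^sub>C x = (x :: 'a::cstar_algebra)"
  using scaleR_scaleC[of 1 x] by simp

lemma scaleC_0_left [simp]: "0 *\<^sub>C x = (0 :: 'a::cstar_algebra)"
  using scaleR_scaleC[of 0 x] by simp

lemma scaleC_0_right [simp]: "c *\<^sub>C 0 = (0 :: 'a::cstar_algebra)"
  using scaleC_add_right[of c 0 "0::'a"] by simp

lemma scaleC_minus_right [simp]: "c *\<^sub>C (- x) = - (c *\<^sub>C (x :: 'a::cstar_algebra))"
  using scaleC_add_right[of c x "- x"] by (simp add: eq_neg_iff_add_eq_0 add.commute)

lemma scaleC_minus_left [simp]: "(- c) *\<^sub>C x = - (c *\<^sub>C (x :: 'a::cstar_algebra))"
  using scaleC_add_left[of c "- c" x] by (simp add: eq_neg_iff_add_eq_0 add.commute)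

lemma scaleC_diff_right: "c *\<^sub>C (x - y) = c *\<^sub>C x - c *\<^sub>C (y :: 'a::cstar_algebra)"
  using scaleC_add_right[of c x "- y"] by simp

lemma scaleC_diff_left: "(c - d) *\<^sub>C x = c *\<^sub>C x - d *\<^sub>C (x :: 'a::cstar_algebra)"
  using scaleC_add_left[of c "- d" x] by simp

lemma scaleC_eq_0_iff [simp]: "c *\<^sub>C x = 0 \<longleftrightarrow> c = 0 \<or> x = (0 :: 'a::cstar_algebra)"
  by (metis norm_eq_zero norm_scaleC mult_eq_0_iff)

lemma scaleC_sum_right: "c *\<^sub>C sum f S = (\<Sum>i\<in>S. c *\<^sub>C (f i :: 'a::cstar_algebra))"
  by (induction S rule: infinite_finite_induct) (auto simp: scaleC_add_right)

lemma scaleC_sum_left: "sum f S *\<^sub>C x = (\<Sum>i\<in>S. f i *\<^sub>C (x :: 'a::cstar_algebra))"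
  by (induction S rule: infinite_finite_induct) (auto simp: scaleC_add_left)

lemmas mult_scaleC = mult_scaleC_left mult_scaleC_right

lemma adj_0 [simp]: "adj 0 = (0 :: 'a::cstar_algebra)"
  using adj_add[of 0 "0::'a"] by simp

lemma adj_minus [simp]: "adj (- x) = - adj (x :: 'a::cstar_algebra)"
  using adj_add[of x "- x"] by (simp add: eq_neg_iff_add_eq_0 add.commute)

lemma adj_diff: "adj (x - y) = adj x - adj (y :: 'a::cstar_algebra)"
  using adj_add[of x "- y"] by simp

lemma adj_sum: "adj (sum f S) = (\<Sum>i\<in>S. adj (f i :: 'a::cstar_algebra))"
  by (induction S rule: infinite_finite_induct) (auto simp: adj_add)

lemma norm_adj [simp]: "norm (adj x) = norm (x :: 'a::cstar_algebra)"
proof -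
  have le: "norm z \<le> norm (adj z)" for z :: 'a
  proof (cases "z = 0")
    case False
    have "norm z * norm z \<le> norm (adj z) * norm z"
      using norm_mult_ineq[of "adj z" z] by (simp add: cstar_identity power2_eq_square)
    then show ?thesis using False by simp
  qed simp
  from le[of x] le[of "adj x"] show ?thesis by (simp add: adj_adj)
qed

lemma cstar_identity': "norm (x * adj x) = (norm (x :: 'a::cstar_algebra))\<^sup>2"
  using cstar_identity[of "adj x"] by (simp add: adj_adj)

lemma bounded_linear_adj: "bounded_linear (adj :: 'a::cstar_algebra \<Rightarrow> 'a)"
  by (rule bounded_linear_intro[of _ 1]) (auto simp: adj_add scaleR_scaleC adj_scaleC)

lemmas tendsto_adj [tendsto_intros] = bounded_linear.tendsto[OF bounded_linear_adj]

lemma bounded_linear_scaleC: "bounded_linear (\<lambda>x :: 'a::cstar_algebra. c *\<^sub>C x)"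
  by (rule bounded_linear_intro[of _ "cmod c"])
     (auto simp: scaleC_add_right scaleR_scaleC scaleC_scaleC mult.commute norm_scaleC)

lemma tendsto_scaleC [tendsto_intros]:
  fixes x :: "'b \<Rightarrow> 'a::cstar_algebra"
  assumes "(c \<longlongrightarrow> c') F" "(x \<longlongrightarrow> x') F"
  shows "((\<lambda>n. c n *\<^sub>C x n) \<longlongrightarrow> c' *\<^sub>C x') F"
proof -
  have "bounded_bilinear (\<lambda>c (x::'a). c *\<^sub>C x)"
    by standard (auto simp: scaleC_add_left scaleC_add_right scaleR_scaleC scaleC_scaleC
        norm_scaleC mult.commute scaleR_conv_of_real intro!: exI[of _ 1])
  from bounded_bilinear.tendsto[OF this assms] show ?thesis .
qed

class cstar_algebra_1 = cstar_algebra + real_normed_algebra_1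

lemma adj_1 [simp]: "adj 1 = (1 :: 'a::cstar_algebra_1)"
  by (metis adj_adj adj_mult mult_1_left mult_1_right)

lemma adj_power: "adj (x ^ n) = adj (x :: 'a::cstar_algebra_1) ^ n"
  by (induction n) (auto simp: adj_mult power_commutes)

section \<open>The unitization with its C*-norm\<close>

datatype 'a unitization = Unitize (vec: 'a) (scal: complex)

text \<open>The algebra is an ideal of its unitization, which acts on it by left multiplication; the
  operator norm of this action enters the norm.\<close>

definition unitization_act :: "'a::cstar_algebra unitization \<Rightarrow> 'a \<Rightarrow> 'a" where
  "unitization_act p x = vec p * x + scal p *\<^sub>C x"

lemma bounded_linear_unitization_act: "bounded_linear (unitization_act p)"
  unfolding unitization_act_def
  by (intro bounded_linear_add bounded_linear_mult_right bounded_linear_scaleC)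

instantiation unitization :: (cstar_algebra) real_algebra_1
begin

definition "0 = Unitize 0 0"
definition "1 = Unitize 0 1"
definition "p + q = Unitize (vec p + vec q) (scal p + scal q)"
definition "p - q = Unitize (vec p - vec q) (scal p - scal q)"
definition "- p = Unitize (- vec p) (- scal p)"
definition "p * q = Unitize (vec p * vec q + scal p *\<^sub>C vec q + scal q *\<^sub>C vec p) (scal p * scal q)"
definition "r *\<^sub>R p = Unitize (r *\<^sub>R vec p) (of_real r * scal p)"

lemmas unitization_ops = zero_unitization_def one_unitization_def plus_unitization_def
  minus_unitization_def uminus_unitization_def times_unitization_def scaleR_unitization_def

lemma vec_scal_simps [simp]:
  "vec 0 = (0 :: 'a)" "scal (0 :: 'a unitization) = 0"
  "vec 1 = (0 :: 'a)" "scal (1 :: 'a unitization) = 1"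
  "vec (p + q) = vec p + (vec q :: 'a)" "scal (p + q) = scal p + scal (q :: 'a unitization)"
  "vec (p - q) = vec p - (vec q :: 'a)" "scal (p - q) = scal p - scal (q :: 'a unitization)"
  "vec (- q) = - (vec q :: 'a)" "scal (- q) = - scal (q :: 'a unitization)"
  "vec (p * q) = vec p * vec q + scal p *\<^sub>C vec q + scal q *\<^sub>C (vec p :: 'a)"
  "scal (p * q) = scal p * scal (q :: 'a unitization)"
  "vec (r *\<^sub>R q) = r *\<^sub>R (vec q :: 'a)" "scal (r *\<^sub>R q) = of_real r * scal (q :: 'a unitization)"
  by (simp_all add: unitization_ops)

instance
  by standard
    (auto intro!: unitization.expand dest: arg_cong[of _ _ scal] simp: algebra_simps scaleC_add_left scaleC_add_right
      scaleC_scaleC mult_scaleC scaleR_scaleC)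

end

lemma unitization_act_add: "unitization_act (p + q)
  = (\<lambda>x. unitization_act p x + unitization_act q x)"
  by (simp add: unitization_act_def fun_eq_iff algebra_simps scaleC_add_left)

lemma unitization_act_mult: "unitization_act (p * q) = unitization_act p \<circ> unitization_act q"
  by (simp add: unitization_act_def fun_eq_iff algebra_simps scaleC_add_right scaleC_scaleC
      mult_scaleC)

lemma unitization_act_scaleR: "unitization_act (r *\<^sub>R p) = (\<lambda>x. r *\<^sub>R unitization_act p x)"
  by (simp add: unitization_act_def fun_eq_iff scaleR_scaleC scaleC_add_right scaleC_scaleC
      mult_scaleC_left)

text \<open>Testing the operator on \<open>adj a\<close> gives the lower bound, by the C*-identity.
  Hence the norm of the unitization extends the given one.\<close>

lemma onorm_act_vec: "onorm (unitization_act (Unitize a 0)) = norm a"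
proof (rule antisym)
  show "onorm (unitization_act (Unitize a 0)) \<le> norm a"
    by (rule onorm_bound) (auto simp: unitization_act_def norm_mult_ineq)
  have "norm a * norm a \<le> onorm (unitization_act (Unitize a 0)) * norm a"
    using onorm[OF bounded_linear_unitization_act, of "Unitize a 0" "adj a"]
    by (simp add: unitization_act_def cstar_identity' power2_eq_square)
  then show "norm a \<le> onorm (unitization_act (Unitize a 0))"
    by (cases "a = 0") (auto simp: onorm_pos_le[OF bounded_linear_unitization_act])
qed

instantiation unitization :: (cstar_algebra) real_normed_algebra_1
begin

text \<open>The maximum makes this a norm also when \<^typ>\<open>'a\<close> is unital, where
  \<^const>\<open>unitization_act\<close> is not injective.\<close>

definition norm_unitization :: "'a unitization \<Rightarrow> real" where
  "norm_unitization p = max (cmod (scal p)) (onorm (unitization_act p))"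
definition dist_unitization :: "'a unitization \<Rightarrow> 'a unitization \<Rightarrow> real" where
  "dist_unitization p q = norm (p - q)"
definition sgn_unitization :: "'a unitization \<Rightarrow> 'a unitization" where
  "sgn_unitization p = inverse (norm p) *\<^sub>R p"
definition uniformity_unitization :: "('a unitization \<times> 'a unitization) filter" where
  [code del]: "uniformity_unitization = (INF e\<in>{0<..}. principal {(x, y). dist x y < e})"
definition open_unitization :: "'a unitization set \<Rightarrow> bool" where
  [code del]: "open_unitization U \<longleftrightarrow> (\<forall>x\<in>U. \<forall>\<^sub>F (x', y) in uniformity. x' = x \<longrightarrow> y \<in> U)"

instance
proof
  fix p q :: "'a unitization" and r :: real
  show "norm p = 0 \<longleftrightarrow> p = 0"
  proof
    assume "norm p = 0"
    with onorm_pos_le[OF bounded_linear_unitization_act, of p]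
    have z: "scal p = 0" and o: "onorm (unitization_act p) = 0"
      using norm_ge_zero[of "scal p"] by (auto simp: norm_unitization_def max_def split: if_splits)
    have "norm (vec p) = 0"
      using o z onorm_act_vec[of "vec p"] by (metis unitization.collapse)
    with z show "p = 0" by (cases p) (simp add: zero_unitization_def)
  next
    assume "p = 0"
    then show "norm p = 0"
      using onorm_act_vec[of "0::'a"] by (simp add: norm_unitization_def zero_unitization_def)
  qed
  show "norm (p + q) \<le> norm p + norm q"
    using norm_triangle_ineq[of "scal p" "scal q"]
      onorm_triangle[OF bounded_linear_unitization_act bounded_linear_unitization_act, of p q]
    unfolding norm_unitization_def unitization_act_add vec_scal_simps by linarith
  show "norm (r *\<^sub>R p) = \<bar>r\<bar> * norm p"
    unfolding norm_unitization_def unitization_act_scaleR vec_scal_simps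
    by (simp add: onorm_scaleR[OF bounded_linear_unitization_act] norm_mult max_mult_distrib_left)
  show "norm (p * q) \<le> norm p * norm q"
  proof -
    have "onorm (unitization_act (p * q)) \<le> onorm (unitization_act p) * onorm (unitization_act q)"
      unfolding unitization_act_mult
      by (intro onorm_compose bounded_linear_unitization_act)
    also have "\<dots> \<le> norm p * norm q"
      unfolding norm_unitization_def
      by (intro mult_mono) (auto simp: onorm_pos_le[OF bounded_linear_unitization_act] le_max_iff_disj)
    finally have 1: "onorm (unitization_act (p * q)) \<le> norm p * norm q" .
    have "cmod (scal (p * q)) \<le> norm p * norm q"
      unfolding norm_unitization_def vec_scal_simps norm_mult
      by (intro mult_mono) (auto simp: le_max_iff_disj)
    with 1 show ?thesis by (simp add: norm_unitization_def[of "p * q"])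
  qed
  have "unitization_act (1 :: 'a unitization) = (\<lambda>x. x)"
    by (simp add: unitization_act_def fun_eq_iff)
  then show "norm (1 :: 'a unitization) = 1"
    using onorm_id_le[where 'a = 'a] by (simp add: norm_unitization_def max_def)
qed (simp_all add: dist_unitization_def sgn_unitization_def uniformity_unitization_def
    open_unitization_def)

end

lemma norm_Unitize_0 [simp]: "norm (Unitize a 0) = norm a"
  by (simp add: norm_unitization_def onorm_act_vec)

lemma norm_scal_le: "cmod (scal p) \<le> norm p"
  by (simp add: norm_unitization_def)

lemma norm_Unitize_scal [simp]: "norm (Unitize (0 :: 'a::cstar_algebra) z) = cmod z"
proof (rule antisym)
  have "onorm (unitization_act (Unitize (0 :: 'a) z)) \<le> cmod z"
    by (rule onorm_bound) (auto simp: unitization_act_def norm_scaleC)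
  then show "norm (Unitize (0 :: 'a) z) \<le> cmod z" by (simp add: norm_unitization_def)
qed (use norm_scal_le[of "Unitize 0 z"] in simp)

lemma norm_vec_le: "norm (vec p) \<le> 2 * norm (p :: 'a::cstar_algebra unitization)"
proof -
  have "Unitize (vec p) 0 = p - Unitize 0 (scal p)"
    by (simp add: minus_unitization_def)
  from arg_cong[OF this, of norm] have "norm (vec p) \<le> norm p + norm (Unitize (0::'a) (scal p))"
    using norm_triangle_ineq4[of p "Unitize 0 (scal p)"] by simp
  then show ?thesis using norm_scal_le[of p] by simp
qed

lemma norm_unitization_le: "norm p \<le> norm (vec p) + cmod (scal p)"
proof -
  have "Unitize (vec p) 0 + Unitize 0 (scal p) = p" by (simp add: plus_unitization_def)
  then show ?thesis using norm_triangle_ineq[of "Unitize (vec p) 0" "Unitize 0 (scal p)"] by simp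
qed

instance unitization :: (cstar_algebra) banach
proof
  fix P :: "nat \<Rightarrow> 'a unitization"
  assume P: "Cauchy P"
  have "Cauchy (\<lambda>n. vec (P n))"
  proof (rule CauchyI)
    fix e :: real assume "0 < e"
    then obtain M where M: "\<And>m n. m \<ge> M \<Longrightarrow> n \<ge> M \<Longrightarrow> norm (P m - P n) < e / 2"
      using CauchyD[OF P, of "e / 2"] by auto
    have "norm (vec (P m) - vec (P n)) < e" if "m \<ge> M" "n \<ge> M" for m n
      using norm_vec_le[of "P m - P n"] M[OF that] by simp
    then show "\<exists>M. \<forall>m\<ge>M. \<forall>n\<ge>M. norm (vec (P m) - vec (P n)) < e" by blast
  qed
  then obtain a where a: "(\<lambda>n. vec (P n)) \<longlonglongrightarrow> a" by (auto simp: Cauchy_convergent_iff convergent_def)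
  have "Cauchy (\<lambda>n. scal (P n))"
  proof (rule CauchyI)
    fix e :: real assume "0 < e"
    then obtain M where M: "\<And>m n. m \<ge> M \<Longrightarrow> n \<ge> M \<Longrightarrow> norm (P m - P n) < e"
      using CauchyD[OF P, of e] by auto
    have "norm (scal (P m) - scal (P n)) < e" if "m \<ge> M" "n \<ge> M" for m n
      using norm_scal_le[of "P m - P n"] M[OF that] by simp
    then show "\<exists>M. \<forall>m\<ge>M. \<forall>n\<ge>M. norm (scal (P m) - scal (P n)) < e" by blast
  qed
  then obtain z where z: "(\<lambda>n. scal (P n)) \<longlonglongrightarrow> z" by (auto simp: Cauchy_convergent_iff convergent_def)
  have lim: "(\<lambda>n. norm (vec (P n) - a) + cmod (scal (P n) - z)) \<longlonglongrightarrow> norm (a - a) + cmod (z - z)"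
    using a z by (intro tendsto_add tendsto_norm tendsto_diff tendsto_const)
  have "(\<lambda>n. P n - Unitize a z) \<longlonglongrightarrow> 0"
  proof (rule Lim_null_comparison[rotated])
    show "\<forall>\<^sub>F n in sequentially. norm (P n - Unitize a z)
      \<le> norm (vec (P n) - a) + cmod (scal (P n) - z)"
    proof (rule always_eventually, rule allI)
      fix n
      show "norm (P n - Unitize a z) \<le> norm (vec (P n) - a) + cmod (scal (P n) - z)"
        using norm_unitization_le[of "P n - Unitize a z"] by simp
    qed
  qed (use lim in simp)
  then have "P \<longlonglongrightarrow> Unitize a z" by (rule LIM_zero_cancel)
  then show "convergent P" by (auto simp: convergent_def)
qed

instantiation unitization :: (cstar_algebra) cstar_algebra_1
begin

definition scaleC_unitization :: "complex \<Rightarrow> 'a unitization \<Rightarrow> 'a unitization" where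
  "c *\<^sub>C p = Unitize (c *\<^sub>C vec p) (c * scal p)"
definition adj_unitization :: "'a unitization \<Rightarrow> 'a unitization" where
  "adj p = Unitize (adj (vec p)) (cnj (scal p))"

lemma vec_scal_star [simp]:
  "vec (c *\<^sub>C p) = c *\<^sub>C vec p" "scal (c *\<^sub>C p) = c * scal p"
  "vec (adj p) = adj (vec p)" "scal (adj p) = cnj (scal (p :: 'a unitization))"
  by (simp_all add: scaleC_unitization_def adj_unitization_def)

instance
proof
  fix p q :: "'a unitization" and c d :: complex and r :: real
  show "c *\<^sub>C (p + q) = c *\<^sub>C p + c *\<^sub>C q"
    by (rule unitization.expand) (simp add: scaleC_add_right ring_distribs)
  show "(c + d) *\<^sub>C p = c *\<^sub>C p + d *\<^sub>C p"
    by (rule unitization.expand) (simp add: scaleC_add_left ring_distribs)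
  show "c *\<^sub>C d *\<^sub>C p = (c * d) *\<^sub>C p"
    by (rule unitization.expand) (simp add: scaleC_scaleC)
  show "r *\<^sub>R p = complex_of_real r *\<^sub>C p"
    by (rule unitization.expand) (simp add: scaleR_scaleC)
  show "(c *\<^sub>C p) * q = c *\<^sub>C (p * q)" "p * (c *\<^sub>C q) = c *\<^sub>C (p * q)"
    by (rule unitization.expand; simp add: scaleC_add_right scaleC_scaleC mult_scaleC mult.commute mult.left_commute)+
  show aa: "adj (adj p) = p"
    by (rule unitization.expand) (simp add: adj_adj)
  show "adj (p + q) = adj p + adj q"
    by (rule unitization.expand) (simp add: adj_add)
  show "adj (c *\<^sub>C p) = cnj c *\<^sub>C adj p"
    by (rule unitization.expand) (simp add: adj_scaleC)
  show "adj (p * q) = adj q * adj p"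
    by (rule unitization.expand) (simp add: adj_add adj_mult adj_scaleC mult.commute add_ac)
  have le: "norm (c *\<^sub>C p) \<le> cmod c * norm p" for c and p :: "'a unitization"
  proof -
    have "Unitize 0 c * p = c *\<^sub>C p" by (intro unitization.expand) simp
    then show ?thesis using norm_mult_ineq[of "Unitize 0 c" p] by simp
  qed
  show "norm (c *\<^sub>C p) = cmod c * norm p"
  proof (cases "c = 0")
    case False
    have "inverse c *\<^sub>C c *\<^sub>C p = p"
      using False by (intro unitization.expand) (simp add: scaleC_scaleC)
    then have "norm p \<le> inverse (cmod c) * norm (c *\<^sub>C p)"
      using le[of "inverse c" "c *\<^sub>C p"] by (simp add: norm_inverse)
    then show ?thesis using le[of c p] False by (simp add: field_simps)
  next
    case True
    then have "c *\<^sub>C p = 0" by (intro unitization.expand) simp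
    then show ?thesis using True by simp
  qed
  \<comment> \<open>The C*-identity in the original algebra turns the square of
    \<open>norm (q x)\<close> into the norm of \<open>adj x * (adj q * q) x\<close>, which is at
    most the operator norm of \<open>adj q * q\<close> times the square of
    \<open>norm x\<close>.\<close>
  have sq: "(onorm (unitization_act q))\<^sup>2 \<le> onorm (unitization_act (adj q * q))"
    for q :: "'a unitization"
  proof -
    have "onorm (unitization_act q) \<le> sqrt (onorm (unitization_act (adj q * q)))"
    proof (rule onorm_bound)
      fix x
      have "adj (unitization_act q x) * unitization_act q x = adj x * unitization_act (adj q * q) x"
        by (simp add: unitization_act_def adj_add adj_mult adj_scaleC ring_distribs scaleC_add_right
            scaleC_scaleC scaleC_add_left mult_scaleC mult.assoc add_ac)
          (rule arg_cong[where f = "\<lambda>c. c *\<^sub>C _"], rule mult.commute)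
      then have "(norm (unitization_act q x))\<^sup>2 \<le> norm x * norm (unitization_act (adj q * q) x)"
        using norm_mult_ineq[of "adj x" "unitization_act (adj q * q) x"]
        by (simp add: cstar_identity[symmetric])
      also have "\<dots> \<le> norm x * (onorm (unitization_act (adj q * q)) * norm x)"
        by (intro mult_left_mono onorm bounded_linear_unitization_act) auto
      finally have "norm (unitization_act q x)
        \<le> sqrt (norm x * (onorm (unitization_act (adj q * q)) * norm x))"
        by (rule real_le_rsqrt)
      also have "\<dots> = sqrt (onorm (unitization_act (adj q * q))) * norm x"
        by (simp add: real_sqrt_mult)
      finally show "norm (unitization_act q x)
        \<le> sqrt (onorm (unitization_act (adj q * q))) * norm x" .
    qed (simp add: onorm_pos_le[OF bounded_linear_unitization_act])
    from power_mono[OF this onorm_pos_le[OF bounded_linear_unitization_act], of 2] show ?thesis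
      using onorm_pos_le[OF bounded_linear_unitization_act, of "adj q * q"] by simp
  qed
  have mu: "onorm (unitization_act (adj q * q))
    \<le> onorm (unitization_act (adj q)) * onorm (unitization_act q)"
    for q :: "'a unitization"
    unfolding unitization_act_mult by (intro onorm_compose bounded_linear_unitization_act)
  have "onorm (unitization_act q) \<le> onorm (unitization_act (adj q))" for q :: "'a unitization"
    using order_trans[OF sq[of q] mu[of q]] onorm_pos_le[OF bounded_linear_unitization_act, of q]
      onorm_pos_le[OF bounded_linear_unitization_act, of "adj q"]
    by (cases "onorm (unitization_act q) = 0") (auto simp: power2_eq_square)
  from this[of p] this[of "adj p"] have ad: "onorm (unitization_act (adj p))
    = onorm (unitization_act p)"
    unfolding aa by (rule antisym[rotated])
  have "onorm (unitization_act (adj p * p)) = (onorm (unitization_act p))\<^sup>2"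
    using sq[of p] mu[of p] unfolding ad power2_eq_square by (rule antisym[rotated])
  moreover have "max (x\<^sup>2) (y\<^sup>2) = (max x y)\<^sup>2" if "0 \<le> x" "0 \<le> y" for x y :: real
    using that power_mono[of x y 2] power_mono[of y x 2] by (auto simp: max_def intro: antisym)
  ultimately show "norm (adj p * p) = (norm p)\<^sup>2"
    using onorm_pos_le[OF bounded_linear_unitization_act, of p] norm_ge_zero[of "scal p"]
    by (simp add: norm_unitization_def norm_mult power2_eq_square)
qed

end

lemma Unitize_simps:
  "Unitize (0::'a::cstar_algebra) 0 = 0"
  "Unitize (a + b) 0 = Unitize a 0 + Unitize (b::'a) 0"
  "Unitize (a - b) 0 = Unitize a 0 - Unitize (b::'a) 0"
  "Unitize (- a) 0 = - Unitize (a::'a) 0"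
  "Unitize (a * b) 0 = Unitize a 0 * Unitize (b::'a) 0"
  "Unitize (c *\<^sub>C a) 0 = c *\<^sub>C Unitize (a::'a) 0"
  "Unitize (adj a) 0 = adj (Unitize (a::'a) 0)"
  by (auto intro!: unitization.expand)

section \<open>The spectrum in a unital C*-algebra\<close>

abbreviation invertible_elt :: "'a::cstar_algebra_1 \<Rightarrow> bool" where
  "invertible_elt \<equiv> invertible_wrt (*) 1"

lemma spectrum_unital: "spectrum (a :: 'a::cstar_algebra_1) = {z. \<not> invertible_elt (z *\<^sub>C 1 - a)}"
proof -
  have 1: "is_unit_of_algebra (1 :: 'a)" by (simp add: is_unit_of_algebra_def)
  have "e = 1" if "is_unit_of_algebra e" for e :: 'a
    using that unfolding is_unit_of_algebra_def by (metis mult_1_right)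
  with 1 have "(THE e :: 'a. is_unit_of_algebra e) = 1" by blast
  with 1 show ?thesis unfolding spectrum_def Let_def by auto
qed

lemma invertible_eltI:
  assumes "l * x = 1" "x * r = (1 :: 'a::cstar_algebra_1)"
  shows "invertible_elt x"
proof -
  have "l = r" using assms by (metis mult.assoc mult_1_left mult_1_right)
  with assms show ?thesis unfolding invertible_wrt_def by auto
qed

lemma invertible_elt_mult:
  assumes "invertible_elt x" "invertible_elt y" shows "invertible_elt (x * y)"
proof -
  obtain v w where "x * v = 1" "v * x = 1" "y * w = 1" "w * y = 1"
    using assms unfolding invertible_wrt_def by auto
  then show ?thesis
    by (intro invertible_eltI[of "w * v" _ "w * v"]) (metis mult.assoc mult_1_left)+
qed

lemma invertible_elt_commuting_factor:
  assumes "invertible_elt (x * y)" "x * y = y * x" shows "invertible_elt x"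
proof -
  obtain w where "x * y * w = 1" "w * (x * y) = 1"
    using assms(1) unfolding invertible_wrt_def by auto
  then have "w * y * x = 1" "x * (y * w) = 1" by (simp_all add: mult.assoc assms(2)[symmetric])
  then show ?thesis by (rule invertible_eltI)
qed

lemma invertible_elt_scaleC:
  assumes "invertible_elt x" "c \<noteq> 0" shows "invertible_elt (c *\<^sub>C x)"
proof -
  obtain w where "x * w = 1" "w * x = 1" using assms(1) unfolding invertible_wrt_def by auto
  with assms(2) show ?thesis
    by (intro invertible_eltI[of "inverse c *\<^sub>C w" _ "inverse c *\<^sub>C w"])
       (simp_all add: mult_scaleC scaleC_scaleC)
qed

section \<open>Neumann series and elementary properties of the spectrum\<close>

lemma neumann_inverse:
  fixes x :: "'a::cstar_algebra_1"
  assumes "norm x < 1"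
  shows "(1 - x) * (\<Sum>n. x ^ n) = 1" "(\<Sum>n. x ^ n) * (1 - x) = 1"
proof -
  have s: "summable (\<lambda>n. x ^ n)" using assms by (rule complete_algebra_summable_geometric)
  have "(\<Sum>n. x ^ n) - 1 = (\<Sum>n. x ^ Suc n)" using suminf_split_head[OF s] by simp
  moreover have "(\<Sum>n. x ^ Suc n) = x * (\<Sum>n. x ^ n)" using suminf_mult[OF s, of x] by simp
  moreover have "(\<Sum>n. x ^ Suc n) = (\<Sum>n. x ^ n) * x"
    using suminf_mult2[OF s, of x] by (simp add: power_commutes)
  ultimately show "(1 - x) * (\<Sum>n. x ^ n) = 1" "(\<Sum>n. x ^ n) * (1 - x) = 1"
    by (auto simp: algebra_simps)
qed

lemma invertible_elt_one_minus: "norm x < 1 \<Longrightarrow> invertible_elt (1 - x)"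
  using neumann_inverse by (rule invertible_eltI[rotated])

lemma spectrum_norm_le:
  fixes a :: "'a::cstar_algebra_1"
  assumes "z \<in> spectrum a" shows "cmod z \<le> norm a"
proof (rule ccontr)
  assume *: "\<not> cmod z \<le> norm a"
  then have z: "z \<noteq> 0" using norm_ge_zero[of a] by auto
  have "norm (inverse z *\<^sub>C a) < 1"
    using * z by (simp add: norm_scaleC norm_inverse flip: divide_inverse_commute)
  then have "invertible_elt (z *\<^sub>C (1 - inverse z *\<^sub>C a))"
    using z by (intro invertible_elt_scaleC invertible_elt_one_minus)
  then show False using assms z by (simp add: spectrum_unital scaleC_diff_right scaleC_scaleC)
qed

lemma invertible_elt_perturb:
  fixes x :: "'a::cstar_algebra_1"
  assumes "x * w = 1" "w * x = 1" "norm d * norm w < 1"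
  shows "invertible_elt (x + d)"
proof -
  have "norm (- (w * d)) < 1"
    using norm_mult_ineq[of w d] assms(3) by (simp add: mult.commute)
  then have "invertible_elt (x * (1 - - (w * d)))"
    using assms by (intro invertible_elt_mult invertible_elt_one_minus invertible_eltI[of w x w])
  then show ?thesis using assms(1) by (simp add: distrib_left flip: mult.assoc)
qed

lemma compact_spectrum: "compact (spectrum (a :: 'a::cstar_algebra_1))"
proof -
  have "open (- spectrum a)"
  proof (rule openI)
    fix z assume "z \<in> - spectrum a"
    then obtain w where w: "(z *\<^sub>C 1 - a) * w = 1" "w * (z *\<^sub>C 1 - a) = 1"
      by (auto simp: spectrum_unital invertible_wrt_def)
    have "y \<in> - spectrum a" if "y \<in> ball z (1 / (norm w + 1))" for y
    proof -
      have "cmod (y - z) < 1 / (norm w + 1)" using that by (simp add: dist_norm norm_minus_commute)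
      then have "cmod (y - z) * (norm w + 1) < 1"
        by (simp add: pos_less_divide_eq add_nonneg_pos)
      then have "norm ((y - z) *\<^sub>C (1::'a)) * norm w < 1"
        by (simp add: norm_scaleC distrib_left) (smt (verit) norm_ge_zero)
      from invertible_elt_perturb[OF w this] show ?thesis
        by (simp add: spectrum_unital scaleC_diff_left)
    qed
    then show "\<exists>e>0. ball z e \<subseteq> - spectrum a"
      by (intro exI[of _ "1 / (norm w + 1)"]) (auto simp: add_nonneg_pos)
  qed
  then have "closed (spectrum a)" by (simp add: closed_open)
  moreover have "bounded (spectrum a)"
    by (rule boundedI[of _ "norm a"]) (rule spectrum_norm_le)
  ultimately show ?thesis by (simp add: compact_eq_bounded_closed)
qed

text \<open>Resolvent identity \<open>w' - w = w' (x - x') w\<close>. The smallness assumption first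
  yields \<open>norm w' \<le> 2 * norm w\<close>, so that the bound involves \<open>w\<close>
  only.\<close>

lemma inverse_lipschitz:
  fixes x :: "'a::cstar_algebra_1"
  assumes "w * x = 1" "x' * w' = 1" "w' * x' = 1" "x * w = 1" "norm (x' - x) * norm w \<le> 1 / 2"
  shows "norm (w' - w) \<le> 2 * (norm w)\<^sup>2 * norm (x' - x)"
proof -
  have e: "w' - w = w' * (x - x') * w"
    using assms by (simp add: algebra_simps)
  have "norm (w' * (x - x') * w) \<le> norm w' * norm (x - x') * norm w"
    by (intro norm_mult_ineq[THEN order_trans] mult_right_mono norm_mult_ineq) auto
  then have 1: "norm (w' - w) \<le> norm w' * (norm (x' - x) * norm w)"
    by (simp add: e norm_minus_commute mult.assoc)
  have "norm w' * (norm (x' - x) * norm w) \<le> norm w' * (1 / 2)"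
    by (intro mult_left_mono assms) auto
  with 1 have "norm w' \<le> 2 * norm w" using norm_triangle_ineq2[of w' w] by simp
  then have "norm w' * (norm (x' - x) * norm w) \<le> 2 * norm w * (norm (x' - x) * norm w)"
    by (intro mult_right_mono) auto
  with 1 show ?thesis by (simp add: power2_eq_square ac_simps)
qed

text \<open>Partial fractions: 1 / (1 - u^2) is the mean of 1 / (1 - u) and 1 / (1 + u).\<close>

lemma half_sum_inverse:
  fixes u :: "'a::cstar_algebra_1"
  assumes "(1 - u) * a = 1" "a * (1 - u) = 1" "(1 + u) * b = 1" "b * (1 + u) = 1"
  shows "(1 - u * u) * ((1 / 2) *\<^sub>R (a + b)) = 1" "((1 / 2) *\<^sub>R (a + b)) * (1 - u * u) = 1"
proof -
  have f: "1 - u * u = (1 + u) * (1 - u)" "1 - u * u = (1 - u) * (1 + u)"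
    by (simp_all add: algebra_simps)
  have "(1 - u * u) * a = 1 + u" "a * (1 - u * u) = 1 + u"
    by (simp add: f(1) mult.assoc assms, simp add: f(2) assms flip: mult.assoc)
  moreover have "(1 - u * u) * b = 1 - u" "b * (1 - u * u) = 1 - u"
    by (simp add: f(2) mult.assoc assms, simp add: f(1) assms flip: mult.assoc)
  ultimately have "(1 - u * u) * (a + b) = 2" "(a + b) * (1 - u * u) = 2"
    by (simp_all add: distrib_left distrib_right)
  moreover have "(1 / 2) *\<^sub>R (2 :: 'a) = 1"
    using scaleR_2[of "1 :: 'a"] by (metis one_add_one scaleR_half_double)
  ultimately show "(1 - u * u) * ((1 / 2) *\<^sub>R (a + b)) = 1" "((1 / 2) *\<^sub>R (a + b)) * (1 - u * u)
    = 1"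
    by simp_all
qed

section \<open>Spectral radius and reality of the spectrum of self-adjoint elements\<close>

lemma norm_self_adjoint_power:
  fixes x :: "'a::cstar_algebra_1"
  assumes "adj x = x" shows "norm (x ^ (2 ^ m)) = norm x ^ (2 ^ m)"
proof (induction m)
  case (Suc m)
  have "norm (x ^ (2 ^ Suc m)) = norm (adj (x ^ (2 ^ m)) * x ^ (2 ^ m))"
    by (simp add: adj_power assms power_add mult_2 flip: power_add)
  also have "\<dots> = (norm (x ^ (2 ^ m)))\<^sup>2" by (rule cstar_identity)
  finally show ?case by (simp add: Suc mult.commute flip: power_mult)
qed simp

text \<open>Averaging the resolvents at \<open>\<kappa>\<close> and \<open>- \<kappa>\<close> turns the resolvent of \<open>y\<close> into that of
  \<open>y\<^sup>2\<close>. If the resolvent extended continuously over the circle of radius \<open>norm b\<close>, iterating this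
  would show that the powers \<open>(b / norm b) ^ 2 ^ m\<close> tend to \<open>0\<close>, although they have norm 1.\<close>

lemma spectral_radius_attained:
  fixes b :: "'a::cstar_algebra_1"
  assumes sa: "adj b = b" and "b \<noteq> 0"
  shows "\<exists>\<mu>\<in>spectrum b. cmod \<mu> = norm b"
proof (rule ccontr)
  assume none: "\<not> (\<exists>\<mu>\<in>spectrum b. cmod \<mu> = norm b)"
  define x where "x = inverse (norm b) *\<^sub>R b"
  have nb: "norm b > 0" using assms by simp
  have nx: "norm x = 1" using nb by (simp add: x_def)
  have sx: "adj x = x" using sa by (simp add: x_def scaleR_scaleC adj_scaleC)
  have inv: "invertible_elt (1 - \<zeta> *\<^sub>C x)" if "cmod \<zeta> \<le> 1" for \<zeta>
  proof (cases "cmod \<zeta> = 1")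
    case True
    then have l0: "\<zeta> \<noteq> 0" by auto
    define \<mu> where "\<mu> = of_real (norm b) / \<zeta>"
    have "cmod \<mu> = norm b" using True by (simp add: \<mu>_def norm_divide)
    with none have "invertible_elt (\<mu> *\<^sub>C 1 - b)" by (auto simp: spectrum_unital)
    then have "invertible_elt (inverse \<mu> *\<^sub>C (\<mu> *\<^sub>C 1 - b))"
      using l0 nb by (intro invertible_elt_scaleC) (auto simp: \<mu>_def)
    moreover have "inverse \<mu> *\<^sub>C (\<mu> *\<^sub>C 1 - b) = 1 - \<zeta> *\<^sub>C x"
      using l0 nb by (simp add: \<mu>_def x_def scaleC_diff_right scaleC_scaleC scaleR_scaleC field_simps)
    ultimately show ?thesis by simp
  next
    case False
    then show ?thesis using that nx by (intro invertible_elt_one_minus) (simp add: norm_scaleC)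
  qed
  define g where "g \<zeta> = (SOME w. (1 - \<zeta> *\<^sub>C x) * w = 1 \<and> w * (1 - \<zeta> *\<^sub>C x) = 1)" for \<zeta>
  have g: "(1 - \<zeta> *\<^sub>C x) * g \<zeta> = 1 \<and> g \<zeta> * (1 - \<zeta> *\<^sub>C x) = 1" if "cmod \<zeta> \<le> 1" for \<zeta>
    using inv[OF that] unfolding g_def invertible_wrt_def by (rule someI_ex)
  have "continuous_on (cball 0 1) g"
    unfolding continuous_on_iff
  proof (intro ballI allI impI)
    fix \<zeta> :: complex and e :: real assume l: "\<zeta> \<in> cball 0 1" and e: "0 < e"
    define N where "N = norm (g \<zeta>)"
    define d where "d = min (1 / (2 * N + 1)) (e / (2 * N\<^sup>2 + 1))"
    have N0: "N \<ge> 0" by (simp add: N_def)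
    have d: "d > 0" using e N0 by (auto simp: d_def intro!: divide_pos_pos add_nonneg_pos)
    have "dist (g \<kappa>) (g \<zeta>) < e" if k: "\<kappa> \<in> cball 0 1" "dist \<kappa> \<zeta> < d" for \<kappa>
    proof -
      have df: "norm ((1 - \<kappa> *\<^sub>C x) - (1 - \<zeta> *\<^sub>C x)) = cmod (\<kappa> - \<zeta>)"
      proof -
        have "(1 - \<kappa> *\<^sub>C x) - (1 - \<zeta> *\<^sub>C x) = - ((\<kappa> - \<zeta>) *\<^sub>C x)" by (simp add: scaleC_diff_left)
        then show ?thesis by (simp only: norm_minus_cancel norm_scaleC nx mult_1_right)
      qed
      have c1: "cmod (\<kappa> - \<zeta>) < 1 / (2 * N + 1)" "cmod (\<kappa> - \<zeta>) < e / (2 * N\<^sup>2 + 1)"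
        using k by (auto simp: d_def dist_norm)
      from c1(1) have "cmod (\<kappa> - \<zeta>) * (2 * N + 1) < 1"
        using N0 by (subst (asm) pos_less_divide_eq) auto
      then have "cmod (\<kappa> - \<zeta>) * N \<le> 1 / 2"
        using norm_ge_zero[of "\<kappa> - \<zeta>"] by argo
      then have "norm (g \<kappa> - g \<zeta>) \<le> 2 * N\<^sup>2 * cmod (\<kappa> - \<zeta>)"
        using inverse_lipschitz[of "g \<zeta>" "1 - \<zeta> *\<^sub>C x" "1 - \<kappa> *\<^sub>C x" "g \<kappa>"] g[of \<zeta>] g[of \<kappa>] l k
        unfolding df by (simp add: N_def)
      also have "\<dots> \<le> cmod (\<kappa> - \<zeta>) * (2 * N\<^sup>2 + 1)" by (simp add: algebra_simps)
      also have "\<dots> < e" using c1(2) by (subst (asm) pos_less_divide_eq) (auto intro: add_nonneg_pos)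
      finally show ?thesis by (simp add: dist_norm)
    qed
    with d show "\<exists>d>0. \<forall>\<kappa>\<in>cball 0 1. dist \<kappa> \<zeta> < d \<longrightarrow> dist (g \<kappa>) (g \<zeta>) < e" by blast
  qed
  then have "uniformly_continuous_on (cball 0 1) g"
    by (intro compact_uniformly_continuous compact_cball)
  then obtain \<delta> where \<delta>: "\<delta> > 0"
    "\<And>\<kappa> \<zeta>. \<kappa> \<in> cball 0 1 \<Longrightarrow> \<zeta> \<in> cball 0 1 \<Longrightarrow> dist \<kappa> \<zeta> < \<delta> \<Longrightarrow> dist (g \<kappa>) (g \<zeta>) < 1 / 8"
    unfolding uniformly_continuous_on_def
      by (metis (no_types, lifting) zero_less_divide_1_iff zero_less_numeral)
  \<comment> \<open>A radius inside the unit circle but within \<delta> of it: the resolvents at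
    \<zeta> and \<open>s * \<zeta>\<close> then differ by less than 1/8 for every \<zeta> on the
    circle.\<close>
  define s where "s = max (1 / 2) (1 - \<delta> / 2)"
  have s: "0 < s" "s < 1" "1 - s < \<delta>" using \<delta>(1) by (auto simp: s_def)
  define R where "R y w \<longleftrightarrow> (1 - y) * w = 1 \<and> w * (1 - y) = 1" for y w :: 'a
  have half: "R (\<kappa>\<^sup>2 *\<^sub>C (y * y)) ((1 / 2) *\<^sub>R (a + b))"
    if "R (\<kappa> *\<^sub>C y) a" "R ((- \<kappa>) *\<^sub>C y) b" for \<kappa> y a b
    using half_sum_inverse[of "\<kappa> *\<^sub>C y" a b] that
    by (simp add: R_def mult_scaleC scaleC_scaleC power2_eq_square)
  \<comment> \<open>The resolvent of the squared element at \<zeta> is the mean of those at the two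
    square roots of \<zeta>, and taking means does not enlarge the distance. So 1/8 survives for
    every \<open>m\<close>.\<close>
  have close: "\<exists>c d. R (\<zeta> *\<^sub>C x ^ (2 ^ m)) c \<and> R (\<zeta> *\<^sub>C (s *\<^sub>R x) ^ (2 ^ m)) d \<and> norm (c - d)
    \<le> 1 / 8"
    if "cmod \<zeta> = 1" for \<zeta> m
    using that
  proof (induction m arbitrary: \<zeta>)
    case 0
    have "dist \<zeta> (of_real s * \<zeta>) = cmod ((1 - of_real s) * \<zeta>)"
      by (simp add: dist_norm algebra_simps)
    also have "\<dots> = 1 - s"
      using 0 s by (simp add: norm_mult) (metis norm_of_real of_real_1 of_real_diff abs_of_pos diff_gt_0_iff_gt)
    finally have "dist (g \<zeta>) (g (of_real s * \<zeta>)) < 1 / 8"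
      using 0 s by (intro \<delta>) (auto simp: norm_mult)
    moreover have "R (\<zeta> *\<^sub>C x) (g \<zeta>)" "R ((of_real s * \<zeta>) *\<^sub>C x) (g (of_real s * \<zeta>))"
      using g[of \<zeta>] g[of "of_real s * \<zeta>"] 0 s by (auto simp: R_def norm_mult)
    ultimately show ?case
      by (intro exI[of _ "g \<zeta>"] exI[of _ "g (of_real s * \<zeta>)"])
         (simp add: dist_norm scaleR_scaleC scaleC_scaleC mult.commute)
  next
    case (Suc m)
    define \<kappa> where "\<kappa> = csqrt \<zeta>"
    have k: "\<kappa>\<^sup>2 = \<zeta>" by (simp add: \<kappa>_def)
    then have k1: "cmod \<kappa> = 1"
      using Suc.prems by (metis norm_ge_zero norm_power power2_eq_1_iff abs_of_nonneg abs_minus_cancel abs_one)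
    obtain c d where 1: "R (\<kappa> *\<^sub>C x ^ (2 ^ m)) c" "R (\<kappa> *\<^sub>C (s *\<^sub>R x) ^ (2 ^ m)) d" "norm (c - d)
      \<le> 1 / 8"
      using Suc.IH[OF k1] by blast
    obtain c' d' where 2: "R ((-\<kappa>) *\<^sub>C x ^ (2 ^ m)) c'" "R ((-\<kappa>) *\<^sub>C (s *\<^sub>R x) ^ (2 ^ m)) d'" "norm (c' - d') \<le> 1 / 8"
      using Suc.IH[of "-\<kappa>"] k1 by auto
    have "(1 / 2) *\<^sub>R (c + c') - (1 / 2) *\<^sub>R (d + d') = (1 / 2) *\<^sub>R ((c - d) + (c' - d'))"
      by (simp add: algebra_simps)
    then have "norm ((1 / 2) *\<^sub>R (c + c') - (1 / 2) *\<^sub>R (d + d')) \<le> 1 / 8"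
      using 1(3) 2(3) norm_triangle_ineq[of "c - d" "c' - d'"] by simp
    moreover have "z ^ (2 ^ m) * z ^ (2 ^ m) = z ^ (2 ^ Suc m)" for z :: 'a
      by (simp add: mult_2 flip: power_add)
    ultimately show ?case
      using half[OF 1(1) 2(1), unfolded k] half[OF 1(2) 2(2), unfolded k] by metis
  qed
  \<comment> \<open>For such \<open>m\<close> the resolvent \<open>d\<close> of the small element is
    within 1/15 of 1, so \<open>c\<close> is within 1/15 + 1/8 \<le> 1/4 of 1. This forces
    \<open>norm y \<le> 1 / 2\<close>, whereas \<open>norm y = 1\<close>.\<close>
  obtain m where m: "s ^ m < 1 / 16" using real_arch_pow_inv[of "1/16" s] s by auto
  have "s ^ (2 ^ m) \<le> s ^ m" using s by (intro power_decreasing) auto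
  with m have sm: "s ^ (2 ^ m) < 1 / 16" by simp
  define y v where "y = x ^ (2 ^ m)" and "v = (s *\<^sub>R x) ^ (2 ^ m)"
  have ny: "norm y = 1" by (simp add: y_def norm_self_adjoint_power[OF sx] nx)
  have "norm v \<le> norm (s *\<^sub>R x) ^ (2 ^ m)" unfolding v_def by (rule norm_power_ineq)
  then have nv: "norm v \<le> 1 / 16" using sm s nx by simp
  from close[of 1 m] obtain c d where "R y c" "R v d" and cd: "norm (c - d) \<le> 1 / 8"
    by (auto simp: y_def v_def)
  then have "d = 1 + v * d" "c = 1 + y * c" by (auto simp: R_def algebra_simps)
  then have ee: "d - 1 = v * d" "c - 1 = y * c" by (metis add_diff_cancel_left')+
  have "norm (v * d) \<le> 1 / 16 * norm d"
    using norm_mult_ineq[of v d] nv by (smt (verit) mult_right_mono norm_ge_zero)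
  then have "norm (d - 1) \<le> 1 / 16 * norm d" by (simp add: ee)
  moreover have "norm d \<le> norm (d - 1) + 1" using norm_triangle_ineq[of "d - 1" 1] by simp
  ultimately have "norm (d - 1) \<le> 1 / 15" by linarith
  moreover have "c - 1 = (c - d) + (d - 1)" by simp
  ultimately have c1: "norm (c - 1) \<le> 1 / 4" using cd norm_triangle_ineq[of "c - d" "d - 1"] by simp
  have "y = (c - 1) - y * (c - 1)" by (simp add: ee(2)[symmetric] right_diff_distrib)
  then have "norm y \<le> norm (c - 1) + norm (y * (c - 1))" by (metis norm_triangle_ineq4)
  also have "\<dots> \<le> norm (c - 1) + 1 * norm (c - 1)" using norm_mult_ineq[of y "c - 1"] ny by simp
  finally show False using c1 ny by simp
qed

text \<open>Shift by an imaginary multiple of the unit: the square of \<open>norm T\<close> grows at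
  most like t^2, whereas the square of the modulus of z + i t contains the linear term 2 t Im z. The
  chosen \<open>t\<close> makes this term equal to the square of \<open>norm a\<close> plus
  1.\<close>

lemma spectrum_self_adjoint_real:
  fixes a :: "'a::cstar_algebra_1"
  assumes "adj a = a" "z \<in> spectrum a" shows "Im z = 0"
proof (rule ccontr)
  assume z: "Im z \<noteq> 0"
  define t where "t = ((norm a)\<^sup>2 + 1) / (2 * Im z)"
  define T where "T = a + (\<i> * of_real t) *\<^sub>C 1"
  have "adj T * T = a * a + of_real (t\<^sup>2) *\<^sub>C 1"
    by (simp add: T_def adj_add adj_scaleC assms ring_distribs mult_scaleC
        scaleC_scaleC power2_eq_square scaleC_diff_right) (simp add: algebra_simps)?
  then have "(norm T)\<^sup>2 \<le> norm (a * a) + norm (of_real (t\<^sup>2) *\<^sub>C (1::'a))"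
    by (metis cstar_identity norm_triangle_ineq)
  also have "\<dots> = (norm a)\<^sup>2 + t\<^sup>2" using cstar_identity[of a]
    by (simp add: assms norm_scaleC norm_power)
  finally have 1: "(norm T)\<^sup>2 \<le> (norm a)\<^sup>2 + t\<^sup>2" .
  have "z + \<i> * of_real t \<in> spectrum T"
    using assms(2) by (simp add: spectrum_unital T_def scaleC_add_left)
  then have "(cmod (z + \<i> * of_real t))\<^sup>2 \<le> (norm T)\<^sup>2" by (intro power_mono spectrum_norm_le) auto
  with 1 have "(Re z)\<^sup>2 + (Im z + t)\<^sup>2 \<le> (norm a)\<^sup>2 + t\<^sup>2" by (simp add: cmod_power2)
  then have "2 * Im z * t \<le> (norm a)\<^sup>2" by (simp add: power2_sum) (smt (verit) zero_le_power2)
  then show False using z by (simp add: t_def)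
qed

lemma spectrum_nonempty:
  fixes a :: "'a::cstar_algebra_1"
  assumes "adj a = a" shows "spectrum a \<noteq> {}"
proof (cases "a = 0")
  case True
  then have "0 \<in> spectrum a" by (simp add: spectrum_unital invertible_wrt_def)
  then show ?thesis by auto
qed (use spectral_radius_attained[OF assms] in auto)

section \<open>Polynomials and continuous functions of a self-adjoint element\<close>

text \<open>Horner's scheme with complex coefficients acting through \<open>scaleC\<close>, since
  \<open>poly\<close> evaluates only at elements of the coefficient ring.\<close>

definition peval :: "complex poly \<Rightarrow> 'a::cstar_algebra_1 \<Rightarrow> 'a" where
  "peval p a = fold_coeffs (\<lambda>c x. c *\<^sub>C 1 + a * x) p 0"

lemma peval_0 [simp]: "peval 0 a = 0" by (simp add: peval_def)

lemma peval_pCons [simp]: "peval (pCons c p) a = c *\<^sub>C 1 + a * peval p a"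
  by (cases "p = 0 \<and> c = 0") (auto simp: peval_def)

lemma peval_add: "peval (p + q) a = peval p a + peval q a"
  by (induction p arbitrary: q rule: pCons_induct; case_tac q)
     (auto simp: scaleC_add_left algebra_simps)

lemma peval_smult: "peval (smult c p) a = c *\<^sub>C peval p a"
  by (induction p) (auto simp: scaleC_add_right scaleC_scaleC mult_scaleC_right)

lemma peval_minus: "peval (- p) a = - peval p a"
  using peval_smult[of "-1" p a] by simp

lemma peval_diff: "peval (p - q) a = peval p a - peval q a"
  using peval_add[of p "- q" a] by (simp add: peval_minus)

lemma peval_commute: "a * peval p a = peval p a * a"
proof (induction p)
  case (pCons c p)
  show ?case
    by (simp add: distrib_left distrib_right mult_scaleC mult.assoc
        flip: pCons.IH)
qed simp

lemma peval_mult: "peval (p * q) a = peval p a * peval q a"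
  by (induction p)
     (auto simp: peval_add peval_smult distrib_right mult_scaleC_left mult.assoc)

lemma adj_peval:
  assumes "adj a = a" shows "adj (peval p a) = peval (map_poly cnj p) a"
  by (induction p)
     (auto simp: adj_add adj_scaleC adj_mult assms map_poly_pCons peval_commute)

text \<open>The linear factor at \<open>z\<close> divides \<open>p - [:poly p z:]\<close>, and a
  factor commuting with its cofactor is invertible whenever the product is.\<close>

lemma poly_spectrum:
  assumes "z \<in> spectrum a" shows "poly p z \<in> spectrum (peval p a)"
proof -
  have "poly (p - [:poly p z:]) z = 0" by simp
  then obtain q where q: "p - [:poly p z:] = [:-z, 1:] * q" by (metis dvdE poly_eq_0_iff_dvd)
  have e: "peval p a - poly p z *\<^sub>C 1 = (a - z *\<^sub>C 1) * peval q a"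
    using arg_cong[OF q, of "\<lambda>p. peval p a"] unfolding peval_diff peval_mult by simp
  have e: "poly p z *\<^sub>C 1 - peval p a = (z *\<^sub>C 1 - a) * peval q a"
    using arg_cong[OF e, of uminus] by (simp add: left_diff_distrib)
  have "(z *\<^sub>C 1 - a) * peval q a = peval q a * (z *\<^sub>C 1 - a)"
    by (simp add: left_diff_distrib right_diff_distrib mult_scaleC peval_commute)
  then show ?thesis
    using assms invertible_elt_commuting_factor
      unfolding spectrum_unital e[symmetric] mem_Collect_eq
    by (metis e)
qed

text \<open>Split \<open>q\<close> into linear factors over the complex numbers: if no root is a
  spectral value, every factor is invertible.\<close>

lemma peval_not_invertible:
  assumes "q \<noteq> 0" "\<not> invertible_elt (peval q a)"
  shows "\<exists>z\<in>spectrum a. poly q z = 0"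
  using assms
proof (induction "degree q" arbitrary: q)
  case 0
  then obtain c where c: "q = [:c:]" using degree_eq_zeroE by metis
  have "invertible_elt (1 :: 'a)" by (rule invertible_eltI[of 1 _ 1]) auto
  then have "invertible_elt (peval q a)"
    using 0 c invertible_elt_scaleC[of "1::'a" c] by simp
  with 0 show ?case by simp
next
  case (Suc n)
  then have "\<not> constant (poly q)" by (simp add: constant_degree)
  then obtain z where z: "poly q z = 0" using fundamental_theorem_of_algebra by blast
  then obtain r where r: "q = [:-z, 1:] * r" by (metis dvdE poly_eq_0_iff_dvd)
  show ?case
  proof (cases "z \<in> spectrum a")
    case False
    then have "invertible_elt (- 1 *\<^sub>C (z *\<^sub>C 1 - a))"
      by (intro invertible_elt_scaleC) (auto simp: spectrum_unital)
    then have "invertible_elt (a - z *\<^sub>C 1)" by simp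
    moreover have "peval q a = (a - z *\<^sub>C 1) * peval r a" unfolding r peval_mult by simp
    ultimately have "\<not> invertible_elt (peval r a)"
      using Suc.prems invertible_elt_mult by auto
    moreover have "r \<noteq> 0" using r Suc.prems by auto
    moreover have "n = degree r"
      using Suc.hyps(2) \<open>r \<noteq> 0\<close> unfolding r by (subst (asm) degree_mult_eq) auto
    ultimately obtain w where "w \<in> spectrum a" "poly r w = 0" using Suc.hyps(1) by blast
    then show ?thesis unfolding r by auto
  qed (use z in auto)
qed

text \<open>The C*-identity replaces \<open>p\<close> by the self-adjoint value of \<open>q\<close>,
  whose norm is attained by a spectral value; \<open>peval_not_invertible\<close> pulls that value
  back to a point of the spectrum of \<open>a\<close>.\<close>

lemma norm_peval_le:
  assumes "adj a = a" and M: "\<And>z. z \<in> spectrum a \<Longrightarrow> cmod (poly p z) \<le> M"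
  shows "norm (peval p a) \<le> M"
proof (cases "peval p a = 0")
  case True
  obtain z0 where "z0 \<in> spectrum a" using spectrum_nonempty[OF assms(1)] by auto
  from M[OF this] show ?thesis using True order_trans[OF norm_ge_zero] by auto
next
  case False
  obtain z0 where z0: "z0 \<in> spectrum a" using spectrum_nonempty[OF assms(1)] by auto
  define q where "q = map_poly cnj p * p"
  have q: "peval q a = adj (peval p a) * peval p a" by (simp add: q_def peval_mult adj_peval assms)
  have pq: "poly q z = of_real ((cmod (poly p z))\<^sup>2)" if "z \<in> spectrum a" for z
  proof -
    have "cnj z = z" using spectrum_self_adjoint_real[OF assms(1) that]
      by (simp add: complex_eq_iff)
    then have "poly (map_poly cnj p) z = cnj (poly p z)" by (metis poly_cnj)
    then show ?thesis by (simp add: q_def complex_norm_square mult.commute del: of_real_power)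
  qed
  have n: "norm (peval q a) = (norm (peval p a))\<^sup>2" by (simp add: q cstar_identity)
  have "peval q a \<noteq> 0" using n False by auto
  moreover have "adj (peval q a) = peval q a" by (simp add: q adj_mult adj_adj)
  ultimately obtain \<mu> where \<mu>: "\<mu> \<in> spectrum (peval q a)" "cmod \<mu> = norm (peval q a)"
    using spectral_radius_attained by blast
  obtain z where z: "z \<in> spectrum a" "poly q z = \<mu>"
  proof (cases "[:\<mu>:] - q = 0")
    \<comment> \<open>If \<open>q\<close> is the constant \<mu>, every spectral point of
      \<open>a\<close> serves, and there is one.\<close>
    case True
    then have "poly q z0 = \<mu>" by (metis eq_iff_diff_eq_0 mult_zero_right poly_0 poly_pCons add.right_neutral)
    then show ?thesis using that z0 by blast
  next
    case False
    have "\<not> invertible_elt (peval ([:\<mu>:] - q) a)" using \<mu>(1)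
      by (simp add: spectrum_unital peval_diff)
    from peval_not_invertible[OF False this] that show ?thesis by auto
  qed
  have "(norm (peval p a))\<^sup>2 = (cmod (poly p z))\<^sup>2"
    using \<mu>(2) n pq[OF z(1)] unfolding z(2) by (simp add: norm_power)
  then have "norm (peval p a) = cmod (poly p z)" by simp
  then show ?thesis using M z by simp
qed

lemma norm_peval_ge:
  assumes "z \<in> spectrum a" shows "cmod (poly p z) \<le> norm (peval p a)"
  using spectrum_norm_le[OF poly_spectrum[OF assms]] .

section \<open>Continuous functional calculus by polynomial approximation\<close>

abbreviation poly_limit ::
  "complex set \<Rightarrow> (nat \<Rightarrow> complex poly) \<Rightarrow> (complex \<Rightarrow> complex) \<Rightarrow> bool" where
  "poly_limit S p f \<equiv> uniform_limit S (\<lambda>n. poly (p n)) f sequentially"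

text \<open>Because \<open>K\<close> lies on the real axis, the real Weierstrass theorem suffices;
  it is applied to the real and the imaginary part of \<open>f\<close> separately.\<close>

lemma polynomial_approximation:
  fixes f :: "complex \<Rightarrow> complex"
  assumes K: "compact K" "\<And>z. z \<in> K \<Longrightarrow> Im z = 0" and f: "continuous_on K f"
  shows "\<exists>p. poly_limit K p f"
proof -
  have approx: "\<exists>p :: complex poly. \<forall>z\<in>K. cmod (of_real (g z) - poly p z) < e"
    if g: "continuous_on K g" and e: "e > 0" for g :: "complex \<Rightarrow> real" and e
  proof -
    have inj: "of_real (Re z) = z" if "z \<in> K" for z using K(2)[OF that]
      by (simp add: complex_eq_iff)
    have "continuous_on (Re ` K) (\<lambda>x. g (of_real x))"
      by (intro continuous_on_compose2[OF g] continuous_intros) (auto simp: inj)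
    moreover have "compact (Re ` K)" by (intro compact_continuous_image K continuous_intros)
    ultimately obtain q where q: "real_polynomial_function q"
      "\<And>x. x \<in> Re ` K \<Longrightarrow> \<bar>g (of_real x) - q x\<bar> < e"
      using Stone_Weierstrass_real_polynomial_function e by blast
    then obtain c n where c: "q = (\<lambda>x. \<Sum>i\<le>n. c i * x ^ i)"
      using real_polynomial_function_iff_sum by blast
    define p where "p = (\<Sum>i\<le>n. monom (of_real (c i) :: complex) i)"
    have "cmod (of_real (g z) - poly p z) < e" if "z \<in> K" for z
    proof -
      have "poly p z = of_real (q (Re z))"
        using inj[OF that] by (simp add: p_def poly_sum poly_monom c)
      then have "cmod (of_real (g z) - poly p z) = \<bar>g z - q (Re z)\<bar>"
        by (metis norm_of_real of_real_diff)
      then show ?thesis using q(2)[of "Re z"] that inj[OF that] by auto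
    qed
    then show ?thesis by blast
  qed
  have "\<exists>p. \<forall>z\<in>K. cmod (f z - poly p z) < 1 / real (Suc n)" for n
  proof -
    have e: "1 / real (Suc n) / 2 > 0" by simp
    obtain p where p: "\<And>z. z \<in> K \<Longrightarrow> cmod (of_real (Re (f z)) - poly p z) < 1 / real (Suc n) / 2"
      using approx[OF continuous_on_Re[OF f] e] by blast
    obtain q where q: "\<And>z. z \<in> K \<Longrightarrow> cmod (of_real (Im (f z)) - poly q z) < 1 / real (Suc n) / 2"
      using approx[OF continuous_on_Im[OF f] e] by blast
    have "cmod (f z - poly (p + smult \<i> q) z) < 1 / real (Suc n)" if "z \<in> K" for z
    proof -
      have "f z - poly (p + smult \<i> q) z
          = (of_real (Re (f z)) - poly p z) + \<i> * (of_real (Im (f z)) - poly q z)"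
        using complex_eq[of "f z"] by (simp add: algebra_simps)
      then have "cmod (f z - poly (p + smult \<i> q) z)
          \<le> cmod (of_real (Re (f z)) - poly p z) + cmod (of_real (Im (f z)) - poly q z)"
        by (metis norm_triangle_ineq norm_mult norm_ii mult_1_left)
      also have "\<dots> < 1 / real (Suc n) / 2 + 1 / real (Suc n) / 2"
        using p[OF that] q[OF that] by (rule add_strict_mono)
      finally show ?thesis by (simp only: field_sum_of_halves)
    qed
    then show ?thesis by blast
  qed
  then obtain p where p: "\<And>n z. z \<in> K \<Longrightarrow> cmod (f z - poly (p n) z) < 1 / real (Suc n)" by metis
  have "poly_limit K p f"
  proof (rule uniform_limitI)
    fix e :: real assume "e > 0"
    then have "\<forall>\<^sub>F n in sequentially. 1 / real (Suc n) < e"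
      using order_tendstoD(2)[OF LIMSEQ_inverse_real_of_nat] by (simp add: inverse_eq_divide)
    then show "\<forall>\<^sub>F n in sequentially. \<forall>z\<in>K. dist (poly (p n) z) (f z) < e"
      by eventually_elim (metis p dist_norm norm_minus_commute order_less_trans)
  qed
  then show ?thesis by blast
qed

text \<open>The choice is harmless for self-adjoint \<open>a\<close> and continuous
  \<open>f\<close>: by \<open>cfc_limit\<close> all approximating sequences have the same
  limit.\<close>

definition cfc :: "(complex \<Rightarrow> complex) \<Rightarrow> 'a::cstar_algebra_1 \<Rightarrow> 'a" where
  "cfc f a = (SOME y. \<exists>p. poly_limit (spectrum a) p f
    \<and> (\<lambda>n. peval (p n) a) \<longlonglongrightarrow> y)"

lemma cfc_cong:
  assumes "\<And>z. z \<in> spectrum a \<Longrightarrow> f z = g z" shows "cfc f a = cfc g a"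
proof -
  have "uniform_limit (spectrum a) F f sequentially
    \<longleftrightarrow> uniform_limit (spectrum a) F g sequentially" for F
    by (rule uniform_limit_cong) (use assms in auto)
  then show ?thesis by (simp add: cfc_def)
qed

context
  fixes a :: "'a::cstar_algebra_1"
  assumes sa: "adj a = a"
begin

lemma cfc_approximation:
  assumes "continuous_on (spectrum a) f"
  obtains p where "poly_limit (spectrum a) p f"
  using polynomial_approximation[OF compact_spectrum spectrum_self_adjoint_real[OF sa] assms]
    by blast

text \<open>\<open>norm_peval_le\<close> turns uniform closeness on the spectrum into closeness in
  norm. So any two approximating sequences are jointly Cauchy, which gives convergence and
  independence of the sequence at once.\<close>

lemma cfc_limit:
  assumes p: "poly_limit (spectrum a) p f"
  shows "(\<lambda>n. peval (p n) a) \<longlonglongrightarrow> cfc f a"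
proof -
  have near: "\<exists>N. \<forall>m\<ge>N. \<forall>n\<ge>N. norm (peval (p m) a - peval (q n) a) \<le> e"
    if p: "poly_limit (spectrum a) p f"
      and q: "poly_limit (spectrum a) q f" and e: "e > 0"
    for p q :: "nat \<Rightarrow> complex poly" and e
  proof -
    have "\<forall>\<^sub>F n in sequentially. (\<forall>z\<in>spectrum a. dist (poly (p n) z) (f z) < e / 2) \<and>
        (\<forall>z\<in>spectrum a. dist (poly (q n) z) (f z) < e / 2)"
      using uniform_limitD[OF p, of "e/2"] uniform_limitD[OF q, of "e/2"] e
      by (auto intro: eventually_conj)
    then obtain N where N: "\<And>n z. n \<ge> N \<Longrightarrow> z \<in> spectrum a \<Longrightarrow> dist (poly (p n) z) (f z) < e / 2"
      "\<And>n z. n \<ge> N \<Longrightarrow> z \<in> spectrum a \<Longrightarrow> dist (poly (q n) z) (f z) < e / 2"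
      by (auto simp: eventually_sequentially)
    have "norm (peval (p m) a - peval (q n) a) \<le> e" if "m \<ge> N" "n \<ge> N" for m n
    proof -
      have "cmod (poly (p m - q n) z) \<le> e" if z: "z \<in> spectrum a" for z
        using dist_triangle_half_l[OF N(1)[OF \<open>m \<ge> N\<close> z] N(2)[OF \<open>n \<ge> N\<close> z]]
        by (simp add: dist_norm)
      then show ?thesis using norm_peval_le[OF sa, of "p m - q n" e] by (simp add: peval_diff)
    qed
    then show ?thesis by blast
  qed
  have "Cauchy (\<lambda>n. peval (p n) a)"
  proof (rule CauchyI)
    fix e :: real assume "e > 0"
    then show "\<exists>N. \<forall>m\<ge>N. \<forall>n\<ge>N. norm (peval (p m) a - peval (p n) a) < e"
      using near[OF p p, of "e / 2"] by (metis field_sum_of_halves half_gt_zero le_less_trans less_add_same_cancel1)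
  qed
  then obtain y where y: "(\<lambda>n. peval (p n) a) \<longlonglongrightarrow> y"
    by (auto simp: Cauchy_convergent_iff convergent_def)
  with p have "\<exists>y p. poly_limit (spectrum a) p f \<and> (\<lambda>n. peval (p n) a) \<longlonglongrightarrow> y"
    by blast
  then have "\<exists>p. poly_limit (spectrum a) p f \<and> (\<lambda>n. peval (p n) a) \<longlonglongrightarrow> cfc f a"
    unfolding cfc_def by (rule someI_ex)
  then obtain q where q: "poly_limit (spectrum a) q f"
    "(\<lambda>n. peval (q n) a) \<longlonglongrightarrow> cfc f a" by blast
  have "(\<lambda>n. peval (p n) a - peval (q n) a) \<longlonglongrightarrow> 0"
  proof (rule LIMSEQ_I)
    fix e :: real assume "e > 0"
    then obtain N where "\<forall>m\<ge>N. \<forall>n\<ge>N. norm (peval (p m) a - peval (q n) a) \<le> e / 2"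
      using near[OF p q(1), of "e / 2"] by auto
    with \<open>e > 0\<close> show "\<exists>N. \<forall>n\<ge>N. norm (peval (p n) a - peval (q n) a - 0) < e"
      by (intro exI[of _ N]) force
  qed
  moreover have "(\<lambda>n. peval (p n) a - peval (q n) a) \<longlonglongrightarrow> y - cfc f a"
    by (intro tendsto_diff y q)
  ultimately have "y = cfc f a" using LIMSEQ_unique by fastforce
  with y show ?thesis by simp
qed

lemma cfc_unique:
  assumes "poly_limit (spectrum a) p f" "(\<lambda>n. peval (p n) a) \<longlonglongrightarrow> y" shows "cfc f a = y"
  using cfc_limit[OF assms(1)] assms(2) by (rule LIMSEQ_unique)

lemma cfc_poly: "cfc (poly p) a = peval p a"
  using cfc_unique[of "\<lambda>_. p", OF uniform_limit_const] by simp

lemma cfc_const: "cfc (\<lambda>z. c) a = c *\<^sub>C 1"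
  using cfc_poly[of "[:c:]"] by (simp add: poly_pCons[abs_def])

lemma cfc_id: "cfc (\<lambda>z. z) a = a"
  using cfc_poly[of "[:0, 1:]"] by (simp add: poly_pCons[abs_def])

lemma bounded_image_spectrum: "continuous_on (spectrum a) f \<Longrightarrow> bounded (f ` spectrum a)"
  by (intro compact_imp_bounded compact_continuous_image compact_spectrum)

lemma cfc_add:
  assumes "continuous_on (spectrum a) f" "continuous_on (spectrum a) g"
  shows "cfc (\<lambda>z. f z + g z) a = cfc f a + cfc g a"
proof -
  obtain p q where pq: "poly_limit (spectrum a) p f"
    "poly_limit (spectrum a) q g"
    using cfc_approximation assms by meson
  show ?thesis
  proof (rule cfc_unique)
    show "poly_limit (spectrum a) (\<lambda>n. p n + q n) (\<lambda>z. f z + g z)"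
      using uniform_limit_add[OF pq] by (simp add: poly_add[abs_def])
  qed (unfold peval_add, intro tendsto_add cfc_limit pq)
qed

lemma cfc_mult:
  assumes "continuous_on (spectrum a) f" "continuous_on (spectrum a) g"
  shows "cfc (\<lambda>z. f z * g z) a = cfc f a * cfc g a"
proof -
  obtain p q where pq: "poly_limit (spectrum a) p f"
    "poly_limit (spectrum a) q g"
    using cfc_approximation assms by meson
  show ?thesis
  proof (rule cfc_unique)
    show "poly_limit (spectrum a) (\<lambda>n. p n * q n) (\<lambda>z. f z * g z)"
      using uniform_lim_mult[OF pq bounded_image_spectrum bounded_image_spectrum] assms
      by (simp add: poly_mult[abs_def])
  qed (unfold peval_mult, intro tendsto_mult cfc_limit pq)
qed

lemma cfc_scale:
  assumes "continuous_on (spectrum a) f"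
  shows "cfc (\<lambda>z. c * f z) a = c *\<^sub>C cfc f a"
  using cfc_mult[of "\<lambda>z. c" f] assms by (simp add: cfc_const mult_scaleC_left)

lemma cfc_diff:
  assumes "continuous_on (spectrum a) f" "continuous_on (spectrum a) g"
  shows "cfc (\<lambda>z. f z - g z) a = cfc f a - cfc g a"
  using cfc_add[of f "\<lambda>z. - 1 * g z"] cfc_scale[of g "- 1"] assms
  by (simp add: continuous_on_minus)

lemma cnj_spectrum: "z \<in> spectrum a \<Longrightarrow> cnj z = z"
  using spectrum_self_adjoint_real[OF sa] by (simp add: complex_eq_iff)

lemma cfc_cnj:
  assumes "continuous_on (spectrum a) f"
  shows "cfc (\<lambda>z. cnj (f z)) a = adj (cfc f a)"
proof -
  obtain p where p: "poly_limit (spectrum a) p f"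
    using cfc_approximation assms by meson
  have "uniform_limit (spectrum a) (\<lambda>n. poly (map_poly cnj (p n))) (\<lambda>z. cnj (f z)) sequentially"
  proof (rule uniform_limitI)
    fix e :: real assume "e > 0"
    from uniform_limitD[OF p this]
    show "\<forall>\<^sub>F n in sequentially. \<forall>z\<in>spectrum a. dist (poly (map_poly cnj (p n)) z) (cnj (f z)) < e"
    proof eventually_elim
      case (elim n)
      show ?case
      proof
        fix z assume z: "z \<in> spectrum a"
        have "poly (map_poly cnj (p n)) z = cnj (poly (p n) z)"
          using cnj_spectrum[OF z] by (metis poly_cnj)
        then show "dist (poly (map_poly cnj (p n)) z) (cnj (f z)) < e"
          using elim z by (simp add: dist_norm flip: complex_cnj_diff)
      qed
    qed
  qed
  then have "(\<lambda>n. peval (map_poly cnj (p n)) a) \<longlonglongrightarrow> cfc (\<lambda>z. cnj (f z)) a" by (rule cfc_limit)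
  moreover have "(\<lambda>n. peval (map_poly cnj (p n)) a) \<longlonglongrightarrow> adj (cfc f a)"
    unfolding adj_peval[OF sa, symmetric] by (intro tendsto_adj cfc_limit p)
  ultimately show ?thesis by (rule LIMSEQ_unique)
qed

lemma cfc_real_self_adjoint:
  assumes "continuous_on (spectrum a) f" "\<And>z. z \<in> spectrum a \<Longrightarrow> cnj (f z) = f z"
  shows "adj (cfc f a) = cfc f a"
  using cfc_cnj[OF assms(1)] cfc_cong[of a "\<lambda>z. cnj (f z)" f] assms(2) by simp

lemma norm_cfc_ge:
  assumes "continuous_on (spectrum a) f" "z \<in> spectrum a"
  shows "cmod (f z) \<le> norm (cfc f a)"
proof -
  obtain p where p: "poly_limit (spectrum a) p f"
    using cfc_approximation assms by meson
  have "(\<lambda>n. cmod (poly (p n) z)) \<longlonglongrightarrow> cmod (f z)"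
    by (intro tendsto_norm tendsto_uniform_limitI[OF p] assms)
  moreover have "(\<lambda>n. norm (peval (p n) a)) \<longlonglongrightarrow> norm (cfc f a)"
    by (intro tendsto_norm cfc_limit p)
  ultimately show ?thesis by (rule LIMSEQ_le) (use norm_peval_ge[OF assms(2)] in auto)
qed

lemma norm_cfc_le:
  assumes "continuous_on (spectrum a) f" and M: "\<And>z. z \<in> spectrum a \<Longrightarrow> cmod (f z) \<le> M"
  shows "norm (cfc f a) \<le> M"
proof (rule field_le_epsilon)
  fix e :: real assume e: "e > 0"
  obtain p where p: "poly_limit (spectrum a) p f"
    using cfc_approximation assms by meson
  have "\<forall>\<^sub>F n in sequentially. norm (peval (p n) a) \<le> M + e"
    using uniform_limitD[OF p e]
  proof eventually_elim
    case (elim n)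
    show ?case
    proof (rule norm_peval_le[OF sa])
      fix z assume z: "z \<in> spectrum a"
      have "cmod (poly (p n) z) \<le> cmod (f z) + dist (poly (p n) z) (f z)"
        by (simp add: dist_norm norm_triangle_sub)
      then show "cmod (poly (p n) z) \<le> M + e" using elim M[OF z] z by fastforce
    qed
  qed
  then show "norm (cfc f a) \<le> M + e"
    by (intro tendsto_upperbound[OF tendsto_norm[OF cfc_limit[OF p]]]) auto
qed

text \<open>Invertibility is an open condition: it would pass from \<open>f\<close> to a close
  polynomial, against \<open>poly_spectrum\<close>.\<close>

lemma cfc_in_spectrum:
  assumes f: "continuous_on (spectrum a) f" and z: "z \<in> spectrum a"
  shows "f z \<in> spectrum (cfc f a)"
proof (rule ccontr)
  assume "f z \<notin> spectrum (cfc f a)"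
  then obtain w where w: "(f z *\<^sub>C 1 - cfc f a) * w = 1" "w * (f z *\<^sub>C 1 - cfc f a) = 1"
    by (auto simp: spectrum_unital invertible_wrt_def)
  obtain p where p: "poly_limit (spectrum a) p f"
    using cfc_approximation f by meson
  define d where "d n = (poly (p n) z *\<^sub>C 1 - peval (p n) a) - (f z *\<^sub>C 1 - cfc f a)" for n
  have "d \<longlonglongrightarrow> (f z *\<^sub>C 1 - cfc f a) - (f z *\<^sub>C 1 - cfc f a)"
    unfolding d_def by (intro tendsto_intros tendsto_uniform_limitI[OF p] z cfc_limit p)
  then have "(\<lambda>n. norm (d n) * norm w) \<longlonglongrightarrow> 0"
    using tendsto_mult_right[OF tendsto_norm, of d "0" sequentially "norm w"] by simp
  then have "\<forall>\<^sub>F n in sequentially. norm (d n) * norm w < 1"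
    by (rule order_tendstoD) simp
  then obtain n where n: "norm (d n) * norm w < 1" by (auto simp: eventually_sequentially)
  from invertible_elt_perturb[OF w n] have "invertible_elt (poly (p n) z *\<^sub>C 1 - peval (p n) a)"
    by (simp add: d_def)
  with poly_spectrum[OF z, of "p n"] show False by (simp add: spectrum_unital)
qed

lemma spectrum_cfc:
  assumes f: "continuous_on (spectrum a) f"
  shows "spectrum (cfc f a) = f ` spectrum a"
proof (intro equalityI subsetI)
  fix w assume w: "w \<in> spectrum (cfc f a)"
  show "w \<in> f ` spectrum a"
  proof (rule ccontr)
    assume "w \<notin> f ` spectrum a"
    then have g: "continuous_on (spectrum a) (\<lambda>z. 1 / (w - f z))" and nz: "\<And>z. z \<in> spectrum a
      \<Longrightarrow> w - f z \<noteq> 0"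
      using f by (auto intro!: continuous_intros)
    have h: "continuous_on (spectrum a) (\<lambda>z. w - f z)" using f by (intro continuous_intros)
    have e: "cfc (\<lambda>z. w - f z) a = w *\<^sub>C 1 - cfc f a"
      using cfc_diff[of "\<lambda>z. w" f] f by (simp add: cfc_const)
    have "cfc (\<lambda>z. 1 / (w - f z) * (w - f z)) a = 1" "cfc (\<lambda>z. (w - f z) * (1 / (w - f z))) a = 1"
      using cfc_cong[of a _ "\<lambda>z. 1"] nz by (auto simp: cfc_const)
    then have "invertible_elt (w *\<^sub>C 1 - cfc f a)"
      unfolding cfc_mult[OF g h] cfc_mult[OF h g] e by (rule invertible_eltI)
    with w show False by (simp add: spectrum_unital)
  qed
qed (use cfc_in_spectrum[OF f] in auto)

end

context
  fixes a :: "'a::cstar_algebra_1"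
  assumes sa: "adj a = a"
begin

lemma peval_cfc:
  assumes f: "continuous_on (spectrum a) f"
  shows "peval p (cfc f a) = cfc (\<lambda>z. poly p (f z)) a"
proof (induction p)
  case 0
  show ?case using cfc_const[OF sa, of 0] by simp
next
  case (pCons c p)
  have "continuous_on (spectrum a) (\<lambda>z. poly p (f z))" using f by (intro continuous_intros)
  with f show ?case
    by (simp add: pCons.IH cfc_add[OF sa] cfc_const[OF sa] cfc_mult[OF sa] continuous_on_mult)
qed

lemma cfc_compose:
  assumes f: "continuous_on (spectrum a) f" and r: "\<And>z. z \<in> spectrum a \<Longrightarrow> cnj (f z) = f z"
    and g: "continuous_on (f ` spectrum a) g"
  shows "cfc g (cfc f a) = cfc (\<lambda>z. g (f z)) a"
proof -
  have fa: "adj (cfc f a) = cfc f a" by (rule cfc_real_self_adjoint[OF sa f r])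
  have "compact (f ` spectrum a)" by (intro compact_continuous_image f compact_spectrum)
  moreover have "Im z = 0" if "z \<in> f ` spectrum a" for z
    using that r by (auto simp: complex_eq_iff)
  ultimately obtain p where p: "poly_limit (f ` spectrum a) p g"
    using polynomial_approximation[OF _ _ g] by blast
  have gf: "continuous_on (spectrum a) (\<lambda>z. g (f z))"
    using continuous_on_compose2[OF g f] by simp
  have "(\<lambda>n. cfc (\<lambda>z. poly (p n) (f z)) a - cfc (\<lambda>z. g (f z)) a) \<longlonglongrightarrow> 0"
  proof (rule tendstoI)
    fix e :: real assume e: "e > 0"
    then have "e / 2 > 0" by simp
    from uniform_limitD[OF p this]
    show "\<forall>\<^sub>F n in sequentially. dist (cfc (\<lambda>z. poly (p n) (f z)) a - cfc (\<lambda>z. g (f z)) a) 0 < e"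
    proof eventually_elim
      case (elim n)
      have pf: "continuous_on (spectrum a) (\<lambda>z. poly (p n) (f z))" using f
        by (intro continuous_intros)
      have "norm (cfc (\<lambda>z. poly (p n) (f z) - g (f z)) a) \<le> e / 2"
        using elim by (intro norm_cfc_le[OF sa] continuous_intros pf gf)
          (auto simp: dist_norm less_imp_le)
      with e show ?case by (simp add: cfc_diff[OF sa pf gf] dist_norm)
    qed
  qed
  then have "(\<lambda>n. cfc (\<lambda>z. poly (p n) (f z)) a) \<longlonglongrightarrow> cfc (\<lambda>z. g (f z)) a" by (rule LIM_zero_cancel)
  moreover have "(\<lambda>n. cfc (\<lambda>z. poly (p n) (f z)) a) \<longlonglongrightarrow> cfc g (cfc f a)"
    using p unfolding spectrum_cfc[OF sa f, symmetric] peval_cfc[OF f, symmetric]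
    by (rule cfc_limit[OF fa]) 
  ultimately show ?thesis by (intro LIMSEQ_unique) 
qed

text \<open>The eigenvalue equation passes to polynomials and then to their limits. With
  \<open>x = X\<close> and \<open>c = 1\<close> it lets a function of \<open>h\<close> next to
  \<open>X\<close> collapse to its value at 1.\<close>

lemma cfc_eigen:
  assumes f: "continuous_on (spectrum a) f" and x: "a * x = c *\<^sub>C x" "x \<noteq> 0"
  shows "c \<in> spectrum a" "cfc f a * x = f c *\<^sub>C x"
proof -
  show c: "c \<in> spectrum a"
  proof (rule ccontr)
    assume "c \<notin> spectrum a"
    then obtain w where "w * (c *\<^sub>C 1 - a) = 1" by (auto simp: spectrum_unital invertible_wrt_def)
    then have "x = w * ((c *\<^sub>C 1 - a) * x)" by (simp flip: mult.assoc)
    then show False using x by (simp add: left_diff_distrib mult_scaleC_left)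
  qed
  obtain p where p: "poly_limit (spectrum a) p f"
    using cfc_approximation[OF sa] f by meson
  have "peval q a * x = poly q c *\<^sub>C x" for q
  proof (induction q)
    case (pCons d q)
    then show ?case
      by (simp add: distrib_right mult_scaleC mult.assoc x scaleC_scaleC
          scaleC_add_left mult.commute)
  qed simp
  then have "(\<lambda>n. poly (p n) c *\<^sub>C x) \<longlonglongrightarrow> cfc f a * x"
    using tendsto_mult[OF cfc_limit[OF sa p] tendsto_const, of x] by simp
  moreover have "(\<lambda>n. poly (p n) c *\<^sub>C x) \<longlonglongrightarrow> f c *\<^sub>C x"
    by (intro tendsto_intros tendsto_uniform_limitI[OF p] c)
  ultimately show "cfc f a * x = f c *\<^sub>C x" by (rule LIMSEQ_unique)
qed

end

section \<open>Spectrum and functional calculus in a possibly non-unital algebra\<close>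

abbreviation emb :: "'a::cstar_algebra \<Rightarrow> 'a unitization" where
  "emb a \<equiv> Unitize a 0"

lemma scal_peval: "scal (peval p w) = poly p (scal w)"
  by (induction p) auto

lemma tendsto_scal [tendsto_intros]: "(f \<longlongrightarrow> w) F \<Longrightarrow> ((\<lambda>n. scal (f n)) \<longlongrightarrow> scal w) F"
  by (rule bounded_linear.tendsto[of scal])
     (auto intro!: bounded_linear_intro[of _ 1] simp: norm_scal_le complex_eq_iff)

text \<open>Embedded elements lie in the kernel of the character \<open>scal\<close>, a proper
  ideal.\<close>

lemma zero_in_spectrum_emb: "0 \<in> spectrum (emb a)"
proof -
  have "scal (- emb a * w) \<noteq> scal 1" for w by simp
  then have "- emb a * w \<noteq> 1" for w by metis
  then show ?thesis by (auto simp: spectrum_unital invertible_wrt_def)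
qed

lemma invertible_unitization_iff:
  "invertible_wrt unitization_mult (0, 1) (- a, z) \<longleftrightarrow> invertible_elt (z *\<^sub>C 1 - emb a)"
proof -
  have e: "Unitize (- a) z = z *\<^sub>C 1 - emb a" by (intro unitization.expand) simp
  have m: "unitization_mult (vec p, scal p) (vec q, scal q) = (vec (p * q), scal (p * q))"
    for p q :: "'a unitization" by (simp add: unitization_mult_def)
  have u: "(vec p, scal p) = (0, 1) \<longleftrightarrow> p = 1" for p :: "'a unitization"
    by (cases p) (simp add: one_unitization_def)
  have i: "unitization_mult (- a, z) (vec w, scal w) = (0, 1) \<longleftrightarrow> Unitize (- a) z * w = 1"
    "unitization_mult (vec w, scal w) (- a, z) = (0, 1) \<longleftrightarrow> w * Unitize (- a) z = 1" for w
    using m[of "Unitize (- a) z" w] m[of w "Unitize (- a) z"] u[of "Unitize (- a) z * w"]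
      u[of "w * Unitize (- a) z"] by (simp_all only: unitization.sel)
  have "invertible_wrt unitization_mult (0, 1) (- a, z) \<longleftrightarrow>
      (\<exists>w. unitization_mult (- a, z) (vec w, scal w) = (0, 1)
        \<and> unitization_mult (vec w, scal w) (- a, z) = (0, 1))"
    unfolding invertible_wrt_def by (metis prod.collapse unitization.sel)
  also have "\<dots> \<longleftrightarrow> invertible_elt (Unitize (- a) z)"
    unfolding invertible_wrt_def i ..
  finally show ?thesis by (simp only: e)
qed

lemma spectrum_nonunital:
  "\<nexists>e :: 'a::cstar_algebra. is_unit_of_algebra e \<Longrightarrow> spectrum (a :: 'a) = spectrum (emb a)"
  by (simp add: spectrum_def[of a] invertible_unitization_iff spectrum_unital)

lemma spectrum_with_unit:
  assumes "is_unit_of_algebra e"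
  shows "spectrum a = {z. \<not> invertible_wrt (*) e (z *\<^sub>C e - a)}"
proof -
  have "e' = e" if "is_unit_of_algebra e'" for e'
    using that assms unfolding is_unit_of_algebra_def by metis
  with assms have "(THE e. is_unit_of_algebra e) = e" by blast
  with assms show ?thesis unfolding spectrum_def Let_def by auto
qed

lemma spectrum_emb_iff:
  assumes z: "z \<noteq> 0"
  shows "z \<in> spectrum (emb a) \<longleftrightarrow> z \<in> spectrum a"
proof (cases "\<exists>e :: 'a. is_unit_of_algebra e")
  case True
  then obtain e :: 'a where e: "is_unit_of_algebra e" by blast
  then have u: "e * x = x" "x * e = x" for x by (auto simp: is_unit_of_algebra_def)
  have "invertible_elt (z *\<^sub>C 1 - emb a) \<longleftrightarrow> invertible_wrt (*) e (z *\<^sub>C e - a)"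
  proof
    assume "invertible_elt (z *\<^sub>C 1 - emb a)"
    then obtain w where w: "(z *\<^sub>C 1 - emb a) * w = 1" "w * (z *\<^sub>C 1 - emb a) = 1"
      by (auto simp: invertible_wrt_def)
    \<comment> \<open>The unital homomorphism onto the original algebra that sends the adjoined unit
      to \<open>e\<close>; it carries inverses to inverses.\<close>
    define p where "p x = vec x + scal x *\<^sub>C e" for x
    have p: "p (x * y) = p x * p y" for x y
      by (simp add: p_def ring_distribs u mult_scaleC scaleC_scaleC scaleC_add_right add_ac)
        (rule arg_cong[where f = "\<lambda>c. c *\<^sub>C e"], rule mult.commute)
    have "p 1 = e" "p (z *\<^sub>C 1 - emb a) = z *\<^sub>C e - a" by (simp_all add: p_def)
    with w p have "(z *\<^sub>C e - a) * p w = e" "p w * (z *\<^sub>C e - a) = e" by metis+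
    then show "invertible_wrt (*) e (z *\<^sub>C e - a)" by (auto simp: invertible_wrt_def)
  next
    assume "invertible_wrt (*) e (z *\<^sub>C e - a)"
    then obtain w where w: "(z *\<^sub>C e - a) * w = e" "w * (z *\<^sub>C e - a) = e"
      by (auto simp: invertible_wrt_def)
    \<comment> \<open>This is w + (1 - e) / z: the inverse on the corner of \<open>e\<close> plus
      the inverse on the complementary corner, where the element acts as \<open>z\<close>.\<close>
    define q where "q = Unitize (w - inverse z *\<^sub>C e) (inverse z)"
    have "vec ((z *\<^sub>C 1 - emb a) * q) = (z *\<^sub>C e - a) * w - e"
      "vec (q * (z *\<^sub>C 1 - emb a)) = w * (z *\<^sub>C e - a) - e"
      using z by (simp_all add: q_def ring_distribs left_diff_distrib right_diff_distrib u mult_scaleC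
          scaleC_diff_right scaleC_scaleC)
    then have "(z *\<^sub>C 1 - emb a) * q = 1" "q * (z *\<^sub>C 1 - emb a) = 1"
      using w z by (auto intro!: unitization.expand simp: q_def)
    then show "invertible_elt (z *\<^sub>C 1 - emb a)" by (auto simp: invertible_wrt_def)
  qed
  then show ?thesis by (simp add: spectrum_unital spectrum_with_unit[OF e])
qed (simp add: spectrum_nonunital)

lemma spectrum_emb: "spectrum (emb a) = insert 0 (spectrum a)"
proof (rule set_eqI)
  fix z show "z \<in> spectrum (emb a) \<longleftrightarrow> z \<in> insert 0 (spectrum a)"
    using spectrum_emb_iff[of z a] zero_in_spectrum_emb[of a] by (cases "z = 0") auto
qed

text \<open>In this case \<open>a\<close> is invertible in a unital algebra, and only the adjoined
  unit puts 0 into the spectrum of \<open>emb a\<close>. Since 0 is isolated there, continuity on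
  \<open>spectrum a\<close> extends to it whatever the value at 0.\<close>

lemma zero_isolated:
  assumes "0 \<notin> spectrum (a :: 'a::cstar_algebra)"
  obtains d where "d > 0" "\<And>z. z \<in> spectrum (emb a) \<Longrightarrow> z \<noteq> 0 \<Longrightarrow> cmod z \<ge> d"
proof -
  obtain e :: 'a where e: "is_unit_of_algebra e"
    using assms spectrum_nonunital zero_in_spectrum_emb[of a] by metis
  then have u: "e * x = x" "x * e = x" for x by (auto simp: is_unit_of_algebra_def)
  obtain w where w: "- a * w = e" "w * - a = e"
    using assms unfolding spectrum_with_unit[OF e] by (auto simp: invertible_wrt_def)
  define E where "E = emb e"
  \<comment> \<open>\<open>G\<close> is - a + (1 - e), with inverse \<open>H\<close> = w + (1 - e).
    Multiplying \<open>G + z e\<close> by e + z (1 - e) gives \<open>z - a\<close>, so a small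
    perturbation of \<open>G\<close> has to stay invertible.\<close>
  define G where "G = Unitize (- a - e) 1"
  define H where "H = Unitize (w - e) 1"
  have "vec (G * H) = - a * w - e" "vec (H * G) = w * - a - e"
    by (simp_all add: G_def H_def left_diff_distrib right_diff_distrib u)
  then have GH: "G * H = 1" "H * G = 1"
    unfolding w by (auto intro!: unitization.expand simp: G_def H_def)
  have "cmod z \<ge> 1 / (norm H * (norm E + 1) + 1)" if z: "z \<in> spectrum (emb a)" "z \<noteq> 0" for z
  proof (rule ccontr)
    assume "\<not> ?thesis"
    then have "cmod z * (norm H * (norm E + 1) + 1) < 1"
      by (simp add: not_le pos_less_divide_eq add_nonneg_pos)
    moreover have "cmod z * (norm E * norm H) \<le> cmod z * (norm H * (norm E + 1) + 1)"
      by (intro mult_left_mono) (auto simp: algebra_simps)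
    ultimately have "norm (z *\<^sub>C E) * norm H < 1" by (simp add: norm_scaleC mult.assoc)
    from invertible_elt_perturb[OF GH this] have 1: "invertible_elt (G + z *\<^sub>C E)" .
    have 2: "invertible_elt (Unitize (e - z *\<^sub>C e) z)"
      using z(2) by (intro invertible_eltI[of "Unitize (e - inverse z *\<^sub>C e) (inverse z)" _ "Unitize (e - inverse z *\<^sub>C e) (inverse z)"])
        (auto intro!: unitization.expand simp: u left_diff_distrib right_diff_distrib mult_scaleC
          scaleC_diff_right scaleC_scaleC)
    have "(G + z *\<^sub>C E) * Unitize (e - z *\<^sub>C e) z = z *\<^sub>C 1 - emb a"
      by (intro unitization.expand) (simp add: G_def E_def u left_diff_distrib right_diff_distrib ring_distribs
          mult_scaleC scaleC_diff_right scaleC_add_right scaleC_scaleC)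
    with invertible_elt_mult[OF 1 2] z(1) show False by (simp add: spectrum_unital)
  qed
  then show ?thesis
    using that[of "1 / (norm H * (norm E + 1) + 1)"] by (auto simp: add_nonneg_pos)
qed

lemma continuous_on_spectrum_emb:
  assumes "continuous_on (spectrum (a :: 'a::cstar_algebra)) f"
  shows "continuous_on (spectrum (emb a)) f"
proof (cases "0 \<in> spectrum a")
  case False
  then obtain d where d: "d > 0" "\<And>z. z \<in> spectrum (emb a) \<Longrightarrow> z \<noteq> 0 \<Longrightarrow> cmod z \<ge> d"
    using zero_isolated by blast
  have s: "spectrum a = spectrum (emb a) \<inter> - ball 0 d"
  proof (rule set_eqI)
    fix z
    have "z \<in> spectrum (emb a) \<longleftrightarrow> z = 0 \<or> z \<in> spectrum a" by (simp add: spectrum_emb)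
    then show "z \<in> spectrum a \<longleftrightarrow> z \<in> spectrum (emb a) \<inter> - ball 0 d"
      using d(1) d(2)[of z] False by (cases "z = 0") auto
  qed
  then have "closed (spectrum a)"
    by (simp only:) (intro closed_Int closed_Compl open_ball compact_imp_closed compact_spectrum)
  with assms show ?thesis unfolding spectrum_emb
    using continuous_on_closed_Un[of "{0}" "spectrum a" f] by simp
qed (use assms in \<open>simp add: spectrum_emb insert_absorb\<close>)

text \<open>The equations say that (1 + y) / \<mu> inverts \<mu> - k, but they are written without a
  unit. Maps defined only on a non-unital algebra can therefore transport them.\<close>

lemma quasi_inverse:
  assumes "\<mu> \<noteq> 0" and "\<mu> *\<^sub>C y = k + k * y" "\<mu> *\<^sub>C y = k + y * k"
  shows "\<mu> \<notin> spectrum (emb k)"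
proof -
  define q where "q = Unitize (inverse \<mu> *\<^sub>C y) (inverse \<mu>)"
  have "vec ((\<mu> *\<^sub>C 1 - emb k) * q) = inverse \<mu> *\<^sub>C (\<mu> *\<^sub>C y - (k + k * y))"
    "vec (q * (\<mu> *\<^sub>C 1 - emb k)) = inverse \<mu> *\<^sub>C (\<mu> *\<^sub>C y - (k + y * k))"
    using assms(1) by (simp_all add: q_def scaleC_diff_right scaleC_add_right mult_scaleC scaleC_scaleC)
  then have "(\<mu> *\<^sub>C 1 - emb k) * q = 1" "q * (\<mu> *\<^sub>C 1 - emb k) = 1"
    using assms by (auto intro!: unitization.expand simp: q_def)
  then show ?thesis by (auto simp: spectrum_unital invertible_wrt_def)
qed

text \<open>\<open>scal\<close> is a continuous character that vanishes on \<open>emb a\<close>, so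
  it evaluates a function of \<open>emb a\<close> at 0.\<close>

lemma scal_cfc:
  assumes a: "adj a = a" and f: "continuous_on (spectrum (emb a)) f"
  shows "scal (cfc f (emb a)) = f 0"
proof -
  have sa: "adj (emb a) = emb a" using a by (simp flip: Unitize_simps)
  obtain p where p: "poly_limit (spectrum (emb a)) p f"
    using cfc_approximation[OF sa f] by blast
  have "(\<lambda>n. scal (peval (p n) (emb a))) \<longlonglongrightarrow> scal (cfc f (emb a))"
    by (intro tendsto_scal cfc_limit sa p)
  moreover have "(\<lambda>n. scal (peval (p n) (emb a))) \<longlonglongrightarrow> f 0"
    using tendsto_uniform_limitI[OF p zero_in_spectrum_emb] by (simp add: scal_peval)
  ultimately show ?thesis by (rule LIMSEQ_unique)
qed

section \<open>Existence and uniqueness of the calculus for functions vanishing at 0\<close>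

context
  fixes a :: "'a::cstar_algebra"
  assumes sa: "adj a = a"
begin

lemma self_adjoint_emb: "adj (emb a) = emb a"
  using sa by (simp flip: Unitize_simps)

lemma emb_vec_cfc:
  assumes "f \<in> calculus_functions a"
  shows "emb (vec (cfc f (emb a))) = cfc f (emb a)"
  using scal_cfc[OF sa continuous_on_spectrum_emb] assms
  by (intro unitization.expand) (simp add: calculus_functions_def)

lemma functional_calculusD:
  assumes "functional_calculus a \<Phi>" and "f \<in> calculus_functions a"
  shows "\<Phi> (\<lambda>z. c * f z) = c *\<^sub>C \<Phi> f" "\<Phi> (\<lambda>z. cnj (f z)) = adj (\<Phi> f)" "\<Phi> (\<lambda>z. z) = a"
  using assms unfolding functional_calculus_def by blast+

lemma functional_calculusD2:
  assumes "functional_calculus a \<Phi>" and "f \<in> calculus_functions a" "g \<in> calculus_functions a"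
  shows "\<Phi> (\<lambda>z. f z + g z) = \<Phi> f + \<Phi> g" "\<Phi> (\<lambda>z. f z * g z) = \<Phi> f * \<Phi> g"
    "(\<And>z. z \<in> spectrum a \<Longrightarrow> f z = g z) \<Longrightarrow> \<Phi> f = \<Phi> g"
  using assms unfolding functional_calculus_def by blast+

lemma id_calculus: "(\<lambda>z. z) \<in> calculus_functions a"
  by (simp add: calculus_functions_def)

lemma functional_calculus_exists: "functional_calculus a (\<lambda>f. vec (cfc f (emb a)))"
proof -
  have c: "continuous_on (spectrum (emb a)) f" "f 0 = 0" if "f \<in> calculus_functions a" for f
    using that continuous_on_spectrum_emb by (auto simp: calculus_functions_def)
  have s0: "scal (cfc f (emb a)) = 0" if "f \<in> calculus_functions a" for f
    using scal_cfc[OF sa c(1)] c(2) that by simp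
  have cong: "vec (cfc f (emb a)) = vec (cfc g (emb a))"
    if "f \<in> calculus_functions a" "g \<in> calculus_functions a" "\<forall>z\<in>spectrum a. f z = g z" for f g
  proof -
    have "cfc f (emb a) = cfc g (emb a)" using that c(2)[OF that(1)] c(2)[OF that(2)]
      by (intro cfc_cong) (auto simp: spectrum_emb)
    then show ?thesis by simp
  qed
  show ?thesis
    unfolding functional_calculus_def
  proof (intro conjI ballI allI impI)
    fix f g assume fg: "f \<in> calculus_functions a" "g \<in> calculus_functions a"
    show "vec (cfc (\<lambda>z. f z + g z) (emb a)) = vec (cfc f (emb a)) + vec (cfc g (emb a))"
      by (simp add: cfc_add[OF self_adjoint_emb c(1)[OF fg(1)] c(1)[OF fg(2)]])
    show "vec (cfc (\<lambda>z. f z * g z) (emb a)) = vec (cfc f (emb a)) * vec (cfc g (emb a))"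
      by (simp add: cfc_mult[OF self_adjoint_emb c(1)[OF fg(1)] c(1)[OF fg(2)]] s0[OF fg(1)] s0[OF fg(2)])
  next
    fix k f assume f: "f \<in> calculus_functions a"
    show "vec (cfc (\<lambda>z. k * f z) (emb a)) = k *\<^sub>C vec (cfc f (emb a))"
      by (simp add: cfc_scale[OF self_adjoint_emb c(1)[OF f]])
  next
    fix f assume f: "f \<in> calculus_functions a"
    show "vec (cfc (\<lambda>z. cnj (f z)) (emb a)) = adj (vec (cfc f (emb a)))"
      by (simp add: cfc_cnj[OF self_adjoint_emb c(1)[OF f]])
  next
    fix f g assume "f \<in> calculus_functions a" "g \<in> calculus_functions a" "\<forall>z\<in>spectrum a. f z = g z"
    then show "vec (cfc f (emb a)) = vec (cfc g (emb a))" by (rule cong)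
  qed (simp add: cfc_id[OF self_adjoint_emb])
qed

text \<open>The definition of \<open>functional_calculus\<close> does not mention continuity; it is
  forced by algebra. A value of too large norm would produce a spectral value \<mu> of \<Phi> k
  outside the range of \<open>k\<close>, and then \<mu> - k can be divided by within the
  calculus.\<close>

lemma functional_calculus_contractive:
  assumes \<Phi>: "functional_calculus a \<Phi>" and f: "f \<in> calculus_functions a"
    and M: "\<And>z. z \<in> spectrum a \<Longrightarrow> cmod (f z) \<le> M" "M \<ge> 0"
  shows "norm (\<Phi> f) \<le> M"
proof (rule ccontr)
  assume "\<not> norm (\<Phi> f) \<le> M"
  then have gt: "M\<^sup>2 < (norm (\<Phi> f))\<^sup>2" using M(2) by (intro power_strict_mono) auto
  define k where "k z = cnj (f z) * f z" for z
  have cf: "(\<lambda>z. cnj (f z)) \<in> calculus_functions a"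
    using f by (auto simp: calculus_functions_def intro!: continuous_intros)
  then have k: "k \<in> calculus_functions a"
    using f by (auto simp: calculus_functions_def k_def[abs_def] intro!: continuous_intros)
  have "\<Phi> k = adj (\<Phi> f) * \<Phi> f"
    unfolding k_def[abs_def] functional_calculusD2(2)[OF \<Phi> cf f] functional_calculusD(2)[OF \<Phi> f] ..
  then have T: "norm (emb (\<Phi> k)) = (norm (\<Phi> f))\<^sup>2" "adj (emb (\<Phi> k)) = emb (\<Phi> k)"
    by (simp_all add: cstar_identity adj_mult adj_adj flip: Unitize_simps)
  moreover have "norm (emb (\<Phi> k)) > 0" using T(1) gt zero_le_power2[of M] by linarith
  then have "emb (\<Phi> k) \<noteq> 0" by (rule zero_less_norm_iff[THEN iffD1])
  ultimately obtain \<mu> where \<mu>: "\<mu> \<in> spectrum (emb (\<Phi> k))" "cmod \<mu> = (norm (\<Phi> f))\<^sup>2"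
    using spectral_radius_attained by metis
  have ne: "\<mu> \<noteq> k z" if "z \<in> spectrum a" for z
  proof -
    have "cmod (k z) \<le> M\<^sup>2"
      using M(1)[OF that] M(2) by (simp add: k_def norm_mult power2_eq_square mult_mono)
    with gt \<mu>(2) show ?thesis by auto
  qed
  have mu0: "\<mu> \<noteq> 0" using gt \<mu>(2) zero_le_power2[of M] by auto
  \<comment> \<open>The solution of \<mu> g = k + k g. It vanishes at 0 together with
    \<open>k\<close>, so \<Phi> applies to it and yields a quasi-inverse.\<close>
  define g where "g z = k z / (\<mu> - k z)" for z
  have g: "g \<in> calculus_functions a"
    using k ne by (auto simp: calculus_functions_def g_def[abs_def] intro!: continuous_intros)
  have prods: "(\<lambda>z. k z * g z) \<in> calculus_functions a" "(\<lambda>z. g z * k z) \<in> calculus_functions a"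
    "(\<lambda>z. \<mu> * g z) \<in> calculus_functions a"
    "(\<lambda>z. k z + k z * g z) \<in> calculus_functions a" "(\<lambda>z. k z + g z * k z) \<in> calculus_functions a"
    using k g by (auto simp: calculus_functions_def intro!: continuous_intros)
  have "\<mu> * g z = k z + k z * g z" if "z \<in> spectrum a" for z
    using ne[OF that] by (simp add: g_def field_simps)
  then have "\<Phi> (\<lambda>z. \<mu> * g z) = \<Phi> (\<lambda>z. k z + k z * g z)" "\<Phi> (\<lambda>z. \<mu> * g z) = \<Phi> (\<lambda>z. k z + g z * k z)"
    using functional_calculusD2(3)[OF \<Phi> prods(3) prods(4)] functional_calculusD2(3)[OF \<Phi> prods(3) prods(5)]
    by (simp_all add: mult.commute[of "g _" "k _"])
  then have y: "\<mu> *\<^sub>C \<Phi> g = \<Phi> k + \<Phi> k * \<Phi> g" "\<mu> *\<^sub>C \<Phi> g = \<Phi> k + \<Phi> g * \<Phi> k"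
    unfolding functional_calculusD(1)[OF \<Phi> g] functional_calculusD2(1)[OF \<Phi> k prods(1)]
      functional_calculusD2(1)[OF \<Phi> k prods(2)] functional_calculusD2(2)[OF \<Phi> k g]
      functional_calculusD2(2)[OF \<Phi> g k] .
  from quasi_inverse[OF mu0 y] \<mu>(1) show False by simp
qed

lemma functional_calculus_poly:
  assumes \<Phi>: "functional_calculus a \<Phi>"
  shows "emb (\<Phi> (\<lambda>z. z * poly q z)) = peval (pCons 0 q) (emb a)"
proof (induction q)
  case 0
  have "\<Phi> (\<lambda>z. 0 * z) = 0 *\<^sub>C \<Phi> (\<lambda>z. z)"
    by (rule functional_calculusD(1)[OF \<Phi> id_calculus])
  then show ?case by (simp add: zero_unitization_def)
next
  case (pCons c q)
  have cf: "(\<lambda>z. z) \<in> calculus_functions a" "(\<lambda>z. c * z) \<in> calculus_functions a"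
    "(\<lambda>z. z * poly q z) \<in> calculus_functions a" "(\<lambda>z. z * (z * poly q z)) \<in> calculus_functions a"
    by (auto simp: calculus_functions_def intro!: continuous_intros)
  note id = functional_calculusD(3)[OF \<Phi> id_calculus]
  have "(\<lambda>z. z * poly (pCons c q) z) = (\<lambda>z. c * z + z * (z * poly q z))"
    by (simp add: fun_eq_iff algebra_simps)
  then have "\<Phi> (\<lambda>z. z * poly (pCons c q) z) = \<Phi> (\<lambda>z. c * z + z * (z * poly q z))" by simp
  also have "\<dots> = \<Phi> (\<lambda>z. c * z) + \<Phi> (\<lambda>z. z * (z * poly q z))"
    by (rule functional_calculusD2(1)[OF \<Phi> cf(2) cf(4)])
  also have "\<Phi> (\<lambda>z. c * z) = c *\<^sub>C a"
    using functional_calculusD(1)[OF \<Phi> cf(1)] id by simp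
  also have "\<Phi> (\<lambda>z. z * (z * poly q z)) = a * \<Phi> (\<lambda>z. z * poly q z)"
    using functional_calculusD2(2)[OF \<Phi> cf(1) cf(3)] id by simp
  finally show ?case
    by (simp add: Unitize_simps pCons.IH distrib_left mult_scaleC_right)
qed

text \<open>On polynomials without constant term \<Phi> is determined algebraically; contractivity
  extends this to their uniform limits.\<close>

lemma functional_calculus_unique:
  assumes \<Phi>: "functional_calculus a \<Phi>" and f: "f \<in> calculus_functions a"
  shows "\<Phi> f = vec (cfc f (emb a))"
proof -
  have cf: "continuous_on (spectrum (emb a)) f" "f 0 = 0"
    using f continuous_on_spectrum_emb by (auto simp: calculus_functions_def)
  obtain p where p: "poly_limit (spectrum (emb a)) p f"
    using cfc_approximation[OF self_adjoint_emb cf(1)] by blast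
  \<comment> \<open>Removing the constant terms keeps the polynomials in the domain of \<Phi>. The
    limit is still \<open>f\<close>, because 0 is a spectral point of \<open>emb a\<close> and
    \<open>f 0 = 0\<close>; the error at most doubles.\<close>
  define r where "r n = p n - [:poly (p n) 0:]" for n
  have "\<exists>q. r n = pCons 0 q" for n
    by (metis poly_0_coeff_0 pCons_cases coeff_pCons_0 diff_self poly_diff r_def poly_pCons poly_0 mult_zero_left add.right_neutral)
  then obtain q where q: "\<And>n. r n = pCons 0 (q n)" by metis
  have "poly_limit (spectrum (emb a)) r f"
  proof (rule uniform_limitI)
    fix e :: real assume "e > 0"
    then have "e / 2 > 0" by simp
    from uniform_limitD[OF p this]
    show "\<forall>\<^sub>F n in sequentially. \<forall>z\<in>spectrum (emb a). dist (poly (r n) z) (f z) < e"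
    proof eventually_elim
      case (elim n)
      show ?case
      proof
        fix z assume z: "z \<in> spectrum (emb a)"
        have "cmod (poly (p n) z - f z) < e / 2" "cmod (poly (p n) 0) < e / 2"
          using elim z zero_in_spectrum_emb[of a] cf(2) by (force simp: dist_norm)+
        then have "cmod ((poly (p n) z - f z) - poly (p n) 0) < e"
          by (smt (verit) norm_triangle_ineq4 field_sum_of_halves)
        then show "dist (poly (r n) z) (f z) < e" by (simp add: dist_norm r_def algebra_simps)
      qed
    qed
  qed
  note r = this
  have rc: "(\<lambda>z. z * poly (q n) z) \<in> calculus_functions a" for n
    by (auto simp: calculus_functions_def intro!: continuous_intros)
  have "(\<lambda>n. \<Phi> (\<lambda>z. z * poly (q n) z) - \<Phi> f) \<longlonglongrightarrow> 0"
  proof (rule tendstoI)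
    fix e :: real assume e: "e > 0"
    then have "e / 2 > 0" by simp
    from uniform_limitD[OF r this]
    show "\<forall>\<^sub>F n in sequentially. dist (\<Phi> (\<lambda>z. z * poly (q n) z) - \<Phi> f) 0 < e"
    proof eventually_elim
      case (elim n)
      have mf: "(\<lambda>z. - 1 * f z) \<in> calculus_functions a"
        using f by (auto simp: calculus_functions_def intro!: continuous_intros)
      have d: "(\<lambda>z. z * poly (q n) z + - 1 * f z) \<in> calculus_functions a"
        using f by (auto simp: calculus_functions_def intro!: continuous_intros)
      have "\<Phi> (\<lambda>z. z * poly (q n) z + - 1 * f z) = \<Phi> (\<lambda>z. z * poly (q n) z) + (- 1) *\<^sub>C \<Phi> f"
        using functional_calculusD2(1)[OF \<Phi> rc mf] functional_calculusD(1)[OF \<Phi> f, of "- 1"] by simp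
      moreover have "norm (\<Phi> (\<lambda>z. z * poly (q n) z + - 1 * f z)) \<le> e / 2"
        using elim e by (intro functional_calculus_contractive[OF \<Phi> d])
          (force simp: dist_norm q spectrum_emb less_imp_le)+
      ultimately show ?case using e by (simp add: dist_norm)
    qed
  qed
  then have "(\<lambda>n. norm (emb (\<Phi> (\<lambda>z. z * poly (q n) z) - \<Phi> f))) \<longlonglongrightarrow> 0"
    by (simp add: tendsto_norm_zero)
  then have "(\<lambda>n. peval (r n) (emb a) - emb (\<Phi> f)) \<longlonglongrightarrow> 0"
    unfolding q functional_calculus_poly[OF \<Phi>, symmetric] Unitize_simps
      by (rule tendsto_norm_zero_cancel)
  moreover have "(\<lambda>n. peval (r n) (emb a) - emb (\<Phi> f)) \<longlonglongrightarrow> cfc f (emb a) - emb (\<Phi> f)"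
    by (intro tendsto_intros cfc_limit self_adjoint_emb r)
  ultimately have "cfc f (emb a) = emb (\<Phi> f)" using LIMSEQ_unique by fastforce
  then show ?thesis by simp
qed

lemma apply_calculus_eq:
  assumes "f \<in> calculus_functions a"
  shows "emb (apply_calculus f a) = cfc f (emb a)"
proof -
  have "apply_calculus f a = vec (cfc f (emb a))"
    unfolding apply_calculus_def
    using functional_calculus_exists functional_calculus_unique assms by blast
  then show ?thesis using emb_vec_cfc[OF assms] by simp
qed

end

section \<open>Scaling elements\<close>

text \<open>Jacobson's formula: if \<open>w\<close> inverts z - u v, then (1 + v w u) / z inverts z
  - v u.\<close>

lemma spectrum_mult_commute:
  fixes u v :: "'a::cstar_algebra_1"
  assumes "z \<noteq> 0" "z \<in> spectrum (v * u)" shows "z \<in> spectrum (u * v)"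
proof (rule ccontr)
  assume "z \<notin> spectrum (u * v)"
  then obtain w where w: "(z *\<^sub>C 1 - u * v) * w = 1" "w * (z *\<^sub>C 1 - u * v) = 1"
    by (auto simp: spectrum_unital invertible_wrt_def)
  define q where "q = inverse z *\<^sub>C (1 + v * w * u)"
  have e1: "u * (v * w) = z *\<^sub>C w - 1"
    using w(1) by (simp add: left_diff_distrib mult_scaleC_left mult.assoc algebra_simps)
  have e2: "w * (u * v) = z *\<^sub>C w - 1"
    using w(2) by (simp add: right_diff_distrib mult_scaleC_right algebra_simps)
  have "v * u * (v * w * u) = v * (u * (v * w)) * u" "v * w * u * (v * u) = v * (w * (u * v)) * u"
    by (simp_all add: mult.assoc)
  then have "v * u * (v * w * u) = z *\<^sub>C (v * w * u) - v * u" "v * w * u * (v * u)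
    = z *\<^sub>C (v * w * u) - v * u"
    unfolding e1 e2 by (simp_all add: left_diff_distrib right_diff_distrib mult_scaleC)
  then have "(z *\<^sub>C 1 - v * u) * q = 1" "q * (z *\<^sub>C 1 - v * u) = 1"
    using assms(1) by (simp_all add: q_def left_diff_distrib right_diff_distrib distrib_left distrib_right
        mult_scaleC scaleC_add_right scaleC_diff_right scaleC_scaleC)
  with assms(2) show False by (auto simp: spectrum_unital invertible_wrt_def)
qed

text \<open>- r^2 - T^2 factors with roots i r and - i r, neither of which lies in the real spectrum
  of \<open>T\<close>.\<close>

lemma negative_notin_spectrum_square:
  fixes T :: "'a::cstar_algebra_1"
  assumes "adj T = T" "r > 0"
  shows "invertible_elt (of_real (- r\<^sup>2) *\<^sub>C 1 - T * T)"
proof -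
  have i: "invertible_elt ((\<i> * of_real s) *\<^sub>C 1 - T)" if "s \<noteq> 0" for s
    using spectrum_self_adjoint_real[OF assms(1), of "\<i> * of_real s"] that
      by (auto simp: spectrum_unital)
  have "invertible_elt (- 1 *\<^sub>C (((\<i> * of_real r) *\<^sub>C 1 - T) * ((\<i> * of_real (- r)) *\<^sub>C 1 - T)))"
    using assms(2) by (intro invertible_elt_scaleC invertible_elt_mult i) auto
  moreover have i2: "\<i> * of_real r * (\<i> * of_real r) = - (complex_of_real r * of_real r)"
    by (simp add: complex_eq_iff)
  have "- 1 *\<^sub>C (((\<i> * of_real r) *\<^sub>C 1 - T) * ((\<i> * of_real (- r)) *\<^sub>C 1 - T))
      = of_real (- r\<^sup>2) *\<^sub>C 1 - T * T"
    by (simp add: left_diff_distrib right_diff_distrib mult_scaleC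
        scaleC_scaleC scaleC_diff_right power2_eq_square i2)
  ultimately show ?thesis by (simp only:)
qed

lemma continuous_on_split_01:
  fixes S :: "complex set"
  assumes "0 \<in> S" "1 \<in> S" "closed (S - {0, 1})" "continuous_on (S - {0, 1}) f"
  shows "continuous_on S f"
proof -
  have "S = {0} \<union> ({1} \<union> (S - {0, 1}))" using assms by auto
  then show ?thesis
    using assms(3,4) by (elim ssubst) (intro continuous_on_closed_Un closed_Un; simp)
qed

text \<open>The condition on 0 is what the unitization provides, see \<open>scaling_emb\<close>. It
  excludes the case in which \<open>h\<close> is invertible and makes both Gram elements have the
  same spectrum.\<close>

locale scaling =
  fixes X :: "'a::cstar_algebra_1"
  assumes scaling: "adj X * X * X = X"
    and not_normal: "adj X * X \<noteq> X * adj X"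
    and zero_in_spectrum: "0 \<in> spectrum (adj X * X)"
begin

abbreviation h where "h \<equiv> adj X * X"
abbreviation K where "K \<equiv> spectrum h"

lemma h_self_adjoint: "adj h = h"
  by (simp add: adj_mult adj_adj)

lemmas h_mult = cfc_mult[OF h_self_adjoint]
  and h_id = cfc_id[OF h_self_adjoint]
  and h_scale = cfc_scale[OF h_self_adjoint]
  and h_const = cfc_const[OF h_self_adjoint]
  and h_cnj = cfc_cnj[OF h_self_adjoint]
  and h_diff = cfc_diff[OF h_self_adjoint]
  and h_add = cfc_add[OF h_self_adjoint]
  and h_real_self_adjoint = cfc_real_self_adjoint[OF h_self_adjoint]

lemma h_X: "h * X = X" and adj_X_h: "adj X * h = adj X"
proof -
  show "h * X = X" by (rule scaling)
  have "adj (h * X) = adj X * h" by (simp only: adj_mult[of h X] h_self_adjoint)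
  then show "adj X * h = adj X" by (simp only: scaling)
qed

lemma X_nonzero: "X \<noteq> 0"
  using not_normal by auto

lemma one_in_spectrum: "1 \<in> K"
  using cfc_eigen(1)[OF h_self_adjoint continuous_on_const, of X 1] h_X X_nonzero by simp

lemma cfc_h_X:
  assumes "continuous_on K f" shows "cfc f h * X = f 1 *\<^sub>C X"
  using cfc_eigen(2)[OF h_self_adjoint assms, of X 1] h_X X_nonzero by simp

lemma adj_X_cfc_h:
  assumes "continuous_on K f" shows "adj X * cfc f h = f 1 *\<^sub>C adj X"
proof -
  have c: "continuous_on K (\<lambda>z. cnj (f z))" using assms by (intro continuous_intros)
  have "adj (cfc f h) * X = cnj (f 1) *\<^sub>C X"
    using cfc_h_X[OF c] by (simp add: h_cnj[OF assms])
  from arg_cong[OF this, of adj] show ?thesis by (simp add: adj_mult adj_adj adj_scaleC)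
qed

text \<open>Let \<open>c\<close> be the negative part of \<open>h\<close> and \<open>y = X c\<close>. Since \<open>c X = 0\<close>, one has \<open>y\<^sup>2 = 0\<close>, so the
  orthogonal elements \<open>y\<^sup>* y = h c\<^sup>2\<close> and \<open>y y\<^sup>*\<close> sum up to \<open>(y + y\<^sup>*)\<^sup>2\<close>, whose spectrum is
  nonnegative.\<close>

lemma spectrum_h_nonneg:
  assumes z: "z \<in> K" shows "Im z = 0" "Re z \<ge> 0"
proof -
  show im: "Im z = 0" by (rule spectrum_self_adjoint_real[OF h_self_adjoint z])
  show "Re z \<ge> 0"
  proof (rule ccontr)
    assume "\<not> Re z \<ge> 0"
    define n :: "complex \<Rightarrow> complex" where "n z = of_real (max 0 (- Re z))" for z
    have n: "continuous_on K n" unfolding n_def[abs_def] by (intro continuous_intros)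
    define c where "c = cfc n h"
    have sc: "adj c = c" unfolding c_def by (rule h_real_self_adjoint[OF n]) (simp add: n_def)
    have cX: "c * X = 0" using cfc_h_X[OF n] by (simp add: c_def n_def)
    define y where "y = X * c"
    have yy: "y * y = 0" by (metis y_def cX mult.assoc mult_zero_left mult_zero_right)
    have yy': "adj y * adj y = 0" using arg_cong[OF yy, of adj] by (simp add: adj_mult)
    define P Q T where "P = adj y * y" and "Q = y * adj y" and "T = y + adj y"
    have PQ: "P * Q = 0" "Q * P = 0"
      by (metis P_def Q_def mult.assoc yy yy' mult_zero_left mult_zero_right)+
    have T: "T * T = P + Q" by (simp add: T_def P_def Q_def ring_distribs yy yy')
    have Tsa: "adj T = T" by (simp add: T_def adj_add adj_adj)
    have id: "continuous_on K (\<lambda>z. z)" by (intro continuous_intros)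
    have Pc: "P = cfc (\<lambda>z. n z * (z * n z)) h"
      by (simp add: P_def y_def adj_mult sc h_mult n id continuous_on_mult
          h_id mult.assoc c_def[symmetric])
    define r where "r = - Re z"
    have r: "r > 0" using \<open>\<not> Re z \<ge> 0\<close> by (simp add: r_def)
    have zr: "z = - of_real r" using im by (simp add: r_def complex_eq_iff)
    have nz: "n z = of_real r" using r by (simp add: n_def r_def)
    \<comment> \<open>At z = - r the function defining \<open>P\<close> has the value r (- r) r = -
      r^3; \<open>s\<close> brings this into the form - s^2.\<close>
    define s where "s = sqrt (r ^ 3)"
    have s: "s > 0" "s\<^sup>2 = r ^ 3" using r by (simp_all add: s_def)
    have "n z * (z * n z) = of_real (- s\<^sup>2)"
      unfolding nz s(2) by (simp add: zr power3_eq_cube)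
    then have inP: "of_real (- s\<^sup>2) \<in> spectrum P"
      using cfc_in_spectrum[OF h_self_adjoint _ z, of "\<lambda>z. n z * (z * n z)"] n
      by (simp add: Pc continuous_intros)
    define l where "l = complex_of_real (- s\<^sup>2)"
    have "invertible_elt (l *\<^sub>C (l *\<^sub>C 1 - T * T))"
      unfolding l_def using s(1) by (intro invertible_elt_scaleC negative_notin_spectrum_square Tsa) auto
    \<comment> \<open>Since \<open>P\<close> and \<open>Q\<close> annihilate each other, the product
      of l - P and l - Q has no mixed term and depends only on P + Q = T^2.\<close>
    moreover have "(l *\<^sub>C 1 - P) * (l *\<^sub>C 1 - Q) = l *\<^sub>C (l *\<^sub>C 1 - T * T)"
        "(l *\<^sub>C 1 - Q) * (l *\<^sub>C 1 - P) = l *\<^sub>C (l *\<^sub>C 1 - T * T)"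
      by (simp_all add: T left_diff_distrib right_diff_distrib mult_scaleC PQ
          scaleC_diff_right scaleC_add_right scaleC_scaleC)
    ultimately have "invertible_elt (l *\<^sub>C 1 - P)"
      using invertible_elt_commuting_factor[of "l *\<^sub>C 1 - P" "l *\<^sub>C 1 - Q"] by simp
    with inP show False by (simp add: spectrum_unital l_def)
  qed
qed

lemma spectrum_h_real: "z \<in> K \<Longrightarrow> z = of_real (cmod z)"
  using spectrum_h_nonneg[of z] by (simp add: complex_eq_iff cmod_def)

text \<open>Away from 0 this is Jacobson's formula. If \<open>X * adj X\<close> were invertible,
  \<open>X\<close> would have a right inverse, and cancelling it in \<open>h X = X\<close> would
  give \<open>h = 1\<close>, although 0 is a spectral point of \<open>h\<close>.\<close>

lemma spectrum_range: "spectrum (X * adj X) = K"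
proof -
  have "0 \<in> spectrum (X * adj X)"
  proof (rule ccontr)
    assume "0 \<notin> spectrum (X * adj X)"
    then obtain w where "- (X * adj X) * w = 1" by (auto simp: spectrum_unital invertible_wrt_def)
    then have "X * (adj X * (- w)) = 1" by (simp add: mult.assoc)
    then have "h * (X * (adj X * (- w))) = h" by simp
    then have "h = 1" using \<open>X * (adj X * (- w)) = 1\<close> h_X by (simp flip: mult.assoc)
    then have "invertible_elt (0 *\<^sub>C 1 - h)" by (intro invertible_eltI[of "- 1" _ "- 1"]) auto
    with zero_in_spectrum show False by (simp add: spectrum_unital)
  qed
  then show ?thesis
    using zero_in_spectrum spectrum_mult_commute[of _ X "adj X"] spectrum_mult_commute[of _ "adj X" X]
    by (intro set_eqI) metis
qed

lemma range_self_adjoint: "adj (X * adj X) = X * adj X"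
  by (simp add: adj_mult adj_adj)

lemma X_peval_adj_X: "X * peval q h * adj X = peval (pCons 0 q) (X * adj X)"
proof -
  have 1: "peval q (X * adj X) * X = X * peval q h"
    by (induction q) (simp_all add: distrib_left distrib_right mult_scaleC mult.assoc)
  show ?thesis by (simp add: peval_commute 1 flip: mult.assoc)
qed

text \<open>\<open>X\<close> intertwines \<open>h\<close> with \<open>X * adj X\<close>. This
  identifies \<open>X * cfc inverse h * adj X\<close> with a spectral projection of
  \<open>X * adj X\<close>.\<close>

lemma X_cfc_adj_X:
  assumes f: "continuous_on K f"
  shows "X * cfc f h * adj X = cfc (\<lambda>z. z * f z) (X * adj X)"
proof -
  obtain p where p: "poly_limit K p f"
    using cfc_approximation[OF h_self_adjoint f] by blast
  have "uniform_limit K (\<lambda>n z. z * poly (p n) z) (\<lambda>z. z * f z) sequentially"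
    using bounded_image_spectrum[OF h_self_adjoint f] compact_spectrum[of h]
    by (intro uniform_lim_mult p uniform_limit_const) (auto simp: compact_imp_bounded)
  then have "(\<lambda>n. peval (pCons 0 (p n)) (X * adj X)) \<longlonglongrightarrow> cfc (\<lambda>z. z * f z) (X * adj X)"
    by (intro cfc_limit range_self_adjoint) (simp add: spectrum_range poly_pCons[abs_def])
  moreover have "(\<lambda>n. peval (pCons 0 (p n)) (X * adj X)) \<longlonglongrightarrow> X * cfc f h * adj X"
    unfolding X_peval_adj_X[symmetric] by (intro tendsto_mult tendsto_const cfc_limit h_self_adjoint p)
  ultimately show ?thesis using LIMSEQ_unique by blast
qed

text \<open>\<open>csqrt\<close> jumps across the negative axis, but \<open>K\<close> lies in the
  nonnegative half-line.\<close>

lemma continuous_on_csqrt_K: "continuous_on K csqrt"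
proof -
  have "csqrt z = of_real (sqrt (cmod z))" if "z \<in> K" for z
    using spectrum_h_real[OF that] by (metis csqrt_of_real_nonneg Im_complex_of_real Re_complex_of_real norm_ge_zero)
  moreover have "continuous_on K (\<lambda>z. of_real (sqrt (cmod z)) :: complex)"
    by (intro continuous_intros)
  ultimately show ?thesis by (simp cong: continuous_on_cong)
qed

lemma continuous_on_isolated:
  assumes "compact (K - {0, 1})"
  shows "continuous_on K (indicator {1} :: complex \<Rightarrow> complex)" "continuous_on K (inverse :: complex \<Rightarrow> complex)"
proof -
  note split = continuous_on_split_01[OF zero_in_spectrum one_in_spectrum compact_imp_closed[OF assms]]
  show "continuous_on K (indicator {1} :: complex \<Rightarrow> complex)"
    using continuous_on_cong[of "K - {0,1}" "K - {0,1}" "indicator {1}" "\<lambda>z. 0 :: complex"]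
    by (intro split) auto
  show "continuous_on K (inverse :: complex \<Rightarrow> complex)"
    by (intro split continuous_intros) auto
qed

text \<open>Here \<open>X h\<^sup>-\<^sup>1 X\<^sup>*\<close> is the range projection of \<open>X\<close>; \<^const>\<open>inverse\<close> vanishes at \<open>0\<close>.\<close>

definition shift_free :: bool where
  "shift_free \<longleftrightarrow> compact (K - {0, 1}) \<and> cfc (indicator {1}) h = X * cfc inverse h * adj X"

end

section \<open>Normal forms and their matrix entries\<close>

text \<open>\<open>adj X ^ n * X ^ n\<close> equals \<open>h\<close> for every n > 0, so all
  positive powers of \<open>X\<close> have the absolute value of \<open>X\<close>. On the spectrum
  of \<open>h\<close>, \<open>weight n\<close> is the corresponding function of \<open>h\<close>,
  and \<open>gram n\<close> is its square.\<close>

definition weight :: "nat \<Rightarrow> complex \<Rightarrow> real" where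
  "weight n z = (if n = 0 then 1 else sqrt (cmod z))"

lemma weight_nonneg [simp]: "weight n z \<ge> 0"
  by (simp add: weight_def)

lemma continuous_on_weight [continuous_intros]: "continuous_on S (\<lambda>z. weight n z)"
  by (cases "n = 0") (auto simp: weight_def[abs_def] intro!: continuous_intros)

definition gram :: "nat \<Rightarrow> complex \<Rightarrow> complex" where
  "gram n z = (if n = 0 then 1 else z)"

lemma continuous_on_gram: "continuous_on S (gram n)"
  by (cases "n = 0") (auto simp: gram_def[abs_def] intro!: continuous_intros)

text \<open>In the weighted shift with weights \<open>(sqrt t, 1, 1, \<dots>)\<close>, the \<open>(i, l)\<close> matrix entry of
  \<open>\<Sum>n m. X\<^sup>n (f n m)(h) X\<^sup>*\<^sup>m\<close> is \<open>weight i t * weight l t * f i l t + diag_sum f i l\<close>.\<close>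

fun diag_sum :: "(nat \<Rightarrow> nat \<Rightarrow> complex \<Rightarrow> complex) \<Rightarrow> nat \<Rightarrow> nat \<Rightarrow> complex" where
  "diag_sum f 0 l = 0"
| "diag_sum f (Suc i) 0 = 0"
| "diag_sum f (Suc i) (Suc l) = diag_sum f i l + f i l 1"

lemma diag_sum_0_right [simp]: "diag_sum f i 0 = 0"
  by (cases i) auto

lemma sum_sum_delta:
  fixes P :: "nat \<Rightarrow> nat \<Rightarrow> 'b::comm_monoid_add"
  assumes "i > N \<or> l > N \<Longrightarrow> P i l = 0"
  shows "(\<Sum>n\<le>N. \<Sum>m\<le>N. if n = i \<and> m = l then P n m else 0) = P i l"
proof (cases "i \<le> N \<and> l \<le> N")
  case True
  have "(\<Sum>m\<le>N. if n = i \<and> m = l then P n m else 0) = (if n = i then P i l else 0)" for n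
    using True by (cases "n = i") (auto simp: sum.delta)
  then show ?thesis using True by (simp add: sum.delta)
next
  case False
  then have "(\<Sum>n\<le>N. \<Sum>m\<le>N. if n = i \<and> m = l then P n m else 0) = 0"
    by (intro sum.neutral ballI) auto
  with False assms show ?thesis by (auto simp: not_le)
qed

text \<open>The recursion runs along the diagonal through (i, l); the condition
  \<open>i + m = l + n\<close> describes this diagonal without subtraction, in the shape in which
  the terms arise when a normal form is compressed.\<close>

lemma diag_sum_eq_sum:
  assumes "\<And>n m. n > N \<or> m > N \<Longrightarrow> f n m 1 = 0"
  shows "diag_sum f i l = (\<Sum>n\<le>N. \<Sum>m\<le>N. if n < i \<and> m < l \<and> i + m = l + n then f n m 1 else 0)"
  using assms
proof (induction f i l rule: diag_sum.induct)
  case (3 f i l)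
  have "(if n < Suc i \<and> m < Suc l \<and> Suc i + m = Suc l + n then f n m 1 else 0)
    = (if n < i \<and> m < l \<and> i + m = l + n then f n m 1 else 0) + (if n = i \<and> m
      = l then f n m 1 else 0)" for n m
    by auto
  then show ?case
    using 3 sum_sum_delta[where P = "\<lambda>n m. f n m 1" and N = N and i = i and l = l]
      by (simp only: sum.distrib diag_sum.simps)
qed auto

section \<open>Normal forms, norms of monomials and compressions\<close>

context scaling
begin

text \<open>\<open>f 0 0 0 = 0\<close> keeps the adjoined unit out. It also controls the coefficient
  at indices (0, 0) and z = 0, the only place where the weights do not vanish at 0.\<close>

definition coefficients :: "nat \<Rightarrow> (nat \<Rightarrow> nat \<Rightarrow> complex \<Rightarrow> complex) \<Rightarrow> bool" where
  "coefficients N f \<longleftrightarrow> (\<forall>n m. continuous_on K (f n m)) \<and> f 0 0 0 = 0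
     \<and> (\<forall>n m. n > N \<or> m > N \<longrightarrow> f n m = (\<lambda>_. 0))"

definition normal_form :: "nat \<Rightarrow> (nat \<Rightarrow> nat \<Rightarrow> complex \<Rightarrow> complex) \<Rightarrow> 'a" where
  "normal_form N f = (\<Sum>n\<le>N. \<Sum>m\<le>N. X ^ n * cfc (f n m) h * adj X ^ m)"

lemma adj_power_X [simp]: "adj (X ^ n) = adj X ^ n" "adj (adj X ^ n) = X ^ n"
  by (simp_all add: adj_power adj_adj)

lemma adj_X_power_X_power: "adj X ^ n * X ^ n = (if n = 0 then 1 else h)"
proof (induction n)
  case (Suc n)
  have "adj X ^ Suc n * X ^ Suc n = adj X * (adj X ^ n * X ^ n) * X"
    unfolding power_Suc[of "adj X"] power_Suc2[of X] by (simp only: mult.assoc)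
  moreover have "adj X * h * X = h" by (simp only: adj_X_h)
  ultimately show ?case by (simp add: Suc)
qed simp

lemma h_X_power: "k > 0 \<Longrightarrow> h * X ^ k = X ^ k"
  by (cases k) (auto simp: h_X simp flip: mult.assoc)

lemma adj_X_power_h: "k > 0 \<Longrightarrow> adj X ^ k * h = adj X ^ k"
  using arg_cong[OF h_X_power, of k adj] by (simp add: adj_mult adj_adj)

lemma adj_X_power_X_power_less:
  assumes "n < i" shows "adj X ^ i * X ^ n = adj X ^ (i - n)"
proof -
  have "adj X ^ (i - n) * adj X ^ n = adj X ^ i" using assms by (simp flip: power_add)
  then have "adj X ^ i * X ^ n = adj X ^ (i - n) * (adj X ^ n * X ^ n)"
    by (simp only: mult.assoc[symmetric])
  also have "\<dots> = adj X ^ (i - n)"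
    using assms adj_X_power_h[of "i - n"] unfolding adj_X_power_X_power by (cases "n = 0") simp_all
  finally show ?thesis .
qed

lemma adj_X_power_X_power_greater:
  assumes "i < n" shows "adj X ^ i * X ^ n = X ^ (n - i)"
  using arg_cong[OF adj_X_power_X_power_less[OF assms], of adj] by (simp add: adj_mult)

lemma cfc_h_X_power:
  assumes "continuous_on K f" "k > 0" shows "cfc f h * X ^ k = f 1 *\<^sub>C X ^ k"
  using assms by (cases k) (auto simp: cfc_h_X mult_scaleC_left simp flip: mult.assoc)

lemma adj_X_power_cfc_h:
  assumes "continuous_on K f" "k > 0" shows "adj X ^ k * cfc f h = f 1 *\<^sub>C adj X ^ k"
  using assms by (cases k)
    (auto simp: power_Suc2 adj_X_cfc_h mult_scaleC_right mult.assoc simp del: power_Suc)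

lemma adj_X_power_X_power_gram: "adj X ^ n * X ^ n = cfc (gram n) h"
proof -
  have "gram 0 = (\<lambda>z. 1)" "n \<noteq> 0 \<Longrightarrow> gram n = (\<lambda>z. z)" by (auto simp: gram_def)
  then show ?thesis
    using h_const[of 1] h_id
    by (cases "n = 0") (simp_all add: adj_X_power_X_power)
qed

lemma norm_X_power_cfc_le:
  assumes f: "continuous_on K f" and M: "\<And>z. z \<in> K \<Longrightarrow> weight n z * cmod (f z) \<le> M" "0 \<le> M"
  shows "norm (X ^ n * cfc f h) \<le> M"
proof (cases "n = 0")
  case True
  then show ?thesis using norm_cfc_le[OF h_self_adjoint f] M by (simp add: weight_def)
next
  case False
  have id: "continuous_on K (\<lambda>z. z)" and fc: "continuous_on K (\<lambda>z. cnj (f z))"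
    using f by (auto intro!: continuous_intros)
  have "adj (X ^ n * cfc f h) * (X ^ n * cfc f h) = adj (cfc f h) * (h * cfc f h)"
    using adj_X_power_X_power[of n] False by (simp add: adj_mult mult.assoc) (simp flip: mult.assoc)
  also have "\<dots> = cfc (\<lambda>z. cnj (f z) * (z * f z)) h"
    using f id fc by (simp add: h_mult h_cnj
        h_id continuous_on_mult)
  finally have "(norm (X ^ n * cfc f h))\<^sup>2 = norm (cfc (\<lambda>z. cnj (f z) * (z * f z)) h)"
    by (metis cstar_identity)
  also have "\<dots> \<le> M\<^sup>2"
  proof (rule norm_cfc_le[OF h_self_adjoint])
    fix z assume z: "z \<in> K"
    have "cmod (cnj (f z) * (z * f z)) = (weight n z * cmod (f z))\<^sup>2"
      using False by (simp add: norm_mult weight_def power_mult_distrib power2_eq_square)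
    then show "cmod (cnj (f z) * (z * f z)) \<le> M\<^sup>2"
      using M(1)[OF z] by (simp add: power_mono)
  qed (use f id fc in \<open>intro continuous_intros\<close>)
  finally show ?thesis using M(2) by (simp add: power2_le_iff_abs_le)
qed

text \<open>\<open>X ^ n * cfc f h\<close> has the absolute value \<open>cfc k h\<close>, so it can
  be replaced by \<open>cfc k h\<close> without changing the norm. Taking adjoints leaves the
  one-sided estimate \<open>norm_X_power_cfc_le\<close>.\<close>

lemma norm_monomial_le:
  assumes f: "continuous_on K f"
    and M: "\<And>z. z \<in> K \<Longrightarrow> weight n z * weight m z * cmod (f z) \<le> M" "0 \<le> M"
  shows "norm (X ^ n * cfc f h * adj X ^ m) \<le> M"
proof -
  define k where "k z = complex_of_real (weight n z * cmod (f z))" for z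
  have k: "continuous_on K k" unfolding k_def[abs_def] by (intro continuous_intros f)
  have sk: "adj (cfc k h) = cfc k h" by (rule h_real_self_adjoint[OF k]) (simp add: k_def)
  have fc: "continuous_on K (\<lambda>z. cnj (f z))" using f by (intro continuous_intros)
  have "adj (X ^ n * cfc f h * adj X ^ m) * (X ^ n * cfc f h * adj X ^ m)
      = X ^ m * (adj (cfc f h) * ((adj X ^ n * X ^ n) * cfc f h)) * adj X ^ m"
    by (simp add: adj_mult mult.assoc)
  also have "adj (cfc f h) * ((adj X ^ n * X ^ n) * cfc f h)
    = cfc (\<lambda>z. cnj (f z) * (gram n z * f z)) h"
    unfolding adj_X_power_X_power_gram using f fc continuous_on_gram
    by (simp add: h_mult h_cnj continuous_on_mult)
  also have "\<dots> = cfc (\<lambda>z. k z * k z) h"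
  proof (rule cfc_cong)
    fix z assume "z \<in> K"
    then have zz: "z = of_real (cmod z)" by (rule spectrum_h_real)
    have "(weight n z)\<^sup>2 = (if n = 0 then 1 else cmod z)" by (simp add: weight_def)
    then have "gram n z = of_real ((weight n z)\<^sup>2)"
      using zz by (simp only: gram_def) simp
    then show "cnj (f z) * (gram n z * f z) = k z * k z"
      using complex_norm_square[of "f z"] by (simp add: k_def power2_eq_square algebra_simps)
  qed
  also have "\<dots> = cfc k h * cfc k h" by (simp add: h_mult[OF k k])
  also have "X ^ m * (cfc k h * cfc k h) * adj X ^ m = (X ^ m * cfc k h) * adj (X ^ m * cfc k h)"
    by (simp add: adj_mult sk mult.assoc)
  finally have "(norm (X ^ n * cfc f h * adj X ^ m))\<^sup>2 = (norm (X ^ m * cfc k h))\<^sup>2"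
    by (metis cstar_identity cstar_identity')
  then have "norm (X ^ n * cfc f h * adj X ^ m) = norm (X ^ m * cfc k h)" by simp
  also have "\<dots> \<le> M"
    using M by (intro norm_X_power_cfc_le[OF k]) (auto simp: k_def norm_mult abs_mult ac_simps)
  finally show ?thesis .
qed

lemma norm_normal_form_le:
  assumes "\<And>n m. continuous_on K (f n m)"
    and "\<And>n m z. z \<in> K \<Longrightarrow> weight n z * weight m z * cmod (f n m z) \<le> M" "0 \<le> M"
  shows "norm (normal_form N f) \<le> (real N + 1)\<^sup>2 * M"
proof -
  have "norm (normal_form N f) \<le> (\<Sum>n\<le>N. \<Sum>m\<le>N. M)"
    unfolding normal_form_def by (intro sum_norm_le norm_monomial_le assms)
  then show ?thesis by (simp add: power2_eq_square algebra_simps)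
qed

text \<open>The inner products \<open>adj X ^ i * X ^ n\<close> and \<open>adj X ^ m * X ^ l\<close>
  collapse to a single power or a Gram element, and a surplus power facing \<open>d\<close> gives 0.
  What survives is the monomial at (i, l) itself and those above it on the same diagonal; there the
  surplus powers reduce the function to its value at 1.\<close>

lemma compress_monomial:
  assumes d: "d * X = 0" "adj X * d = 0" and f: "continuous_on K f"
  shows "d * adj X ^ i * (X ^ n * cfc f h * adj X ^ m) * (X ^ l * d) =
    (if n = i \<and> m = l then d * cfc (\<lambda>z. gram i z * f z * gram l z) h * d else 0)
    + (if n < i \<and> m < l \<and> i + m = l + n then f 1 else 0) *\<^sub>C (d * h * d)"
proof -
  have dX: "d * X ^ k = 0" if "k > 0" for k using that d by (cases k) (auto simp flip: mult.assoc)
  have Xd: "adj X ^ k * d = 0" if "k > 0" for k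
    using that d by (cases k) (auto simp: power_Suc2 mult.assoc simp del: power_Suc)
  define L where "L = d * (adj X ^ i * X ^ n)"
  define R where "R = (adj X ^ m * X ^ l) * d"
  have LR: "d * adj X ^ i * (X ^ n * cfc f h * adj X ^ m) * (X ^ l * d) = L * cfc f h * R"
    by (simp add: L_def R_def mult.assoc)
  consider "n > i" | "m > l" | "n = i" "m = l" | "n = i" "m < l" | "n < i" "m = l" | "n < i" "m < l"
    by linarith
  then have "L * cfc f h * R = (if n = i \<and> m
    = l then d * cfc (\<lambda>z. gram i z * f z * gram l z) h * d else 0)
    + (if n < i \<and> m < l \<and> i + m = l + n then f 1 else 0) *\<^sub>C (d * h * d)"
  proof cases
    case 1
    then have "L = 0" by (simp add: L_def adj_X_power_X_power_greater dX)
    with 1 show ?thesis by simp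
  next
    case 2
    then have "R = 0" by (simp add: R_def adj_X_power_X_power_less Xd)
    with 2 show ?thesis by simp
  next
    case 3
    then have "L * cfc f h * R = d * (cfc (gram i) h * cfc f h * cfc (gram l) h) * d"
      by (simp add: L_def R_def adj_X_power_X_power_gram mult.assoc)
    also have "cfc (gram i) h * cfc f h * cfc (gram l) h = cfc (\<lambda>z. gram i z * f z * gram l z) h"
      using continuous_on_gram f by (simp add: h_mult continuous_on_mult)
    finally show ?thesis using 3 by simp
  next
    case 4
    then have "L * cfc f h * R = d * (cfc (gram i) h * (cfc f h * X ^ (l - m))) * d"
      by (simp add: L_def R_def adj_X_power_X_power_gram adj_X_power_X_power_greater mult.assoc)
    also have "\<dots> = 0"
      using 4 by (simp add: cfc_h_X_power[OF f] cfc_h_X_power[OF continuous_on_gram] mult_scaleC dX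
          flip: mult.assoc)
    finally show ?thesis using 4 by simp
  next
    case 5
    then have "L * cfc f h * R = d * ((adj X ^ (i - n) * cfc f h) * cfc (gram l) h) * d"
      by (simp add: L_def R_def adj_X_power_X_power_gram adj_X_power_X_power_less mult.assoc)
    also have "\<dots> = 0"
      using 5 by (simp add: adj_X_power_cfc_h[OF f] adj_X_power_cfc_h[OF continuous_on_gram] mult_scaleC Xd mult.assoc)
    finally show ?thesis using 5 by simp
  next
    case 6
    then have "L * cfc f h * R = d * ((adj X ^ (i - n) * cfc f h) * X ^ (l - m)) * d"
      by (simp add: L_def R_def adj_X_power_X_power_less adj_X_power_X_power_greater mult.assoc)
    also have "\<dots> = f 1 *\<^sub>C (d * (adj X ^ (i - n) * X ^ (l - m)) * d)"
      using 6 by (simp add: adj_X_power_cfc_h[OF f] mult_scaleC)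
    finally have e: "L * cfc f h * R = f 1 *\<^sub>C (d * (adj X ^ (i - n) * X ^ (l - m)) * d)" .
    consider "i - n = l - m" | "i - n < l - m" | "l - m < i - n" by linarith
    then show ?thesis
    proof cases
      case 1
      then have "i + m = l + n" using 6 by linarith
      with 1 6 e show ?thesis by (simp add: adj_X_power_X_power)
    next
      case 2
      then have "i + m \<noteq> l + n" using 6 by linarith
      with 2 6 e show ?thesis by (simp add: adj_X_power_X_power_greater dX)
    next
      case 3
      then have "i + m \<noteq> l + n" using 6 by linarith
      with 3 6 e show ?thesis by (simp add: adj_X_power_X_power_less Xd mult.assoc)
    qed
  qed
  then show ?thesis unfolding LR .
qed

lemma compress_normal_form:
  assumes d: "d * X = 0" "adj X * d = 0" and f: "coefficients N f"
  shows "d * adj X ^ i * normal_form N f * (X ^ l * d) =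
    d * cfc (\<lambda>z. gram i z * f i l z * gram l z) h * d
    + diag_sum f i l *\<^sub>C (d * h * d)"
proof -
  have fc: "continuous_on K (f n m)" for n m using f by (simp add: coefficients_def)
  define P where "P n m = d * cfc (\<lambda>z. gram i z * f n m z * gram l z) h * d" for n m
  have "d * adj X ^ i * normal_form N f * (X ^ l * d) = (\<Sum>n\<le>N. \<Sum>m\<le>N.
      d * adj X ^ i * (X ^ n * cfc (f n m) h * adj X ^ m) * (X ^ l * d))"
    by (simp add: normal_form_def sum_distrib_left sum_distrib_right)
  also have "\<dots> = (\<Sum>n\<le>N. \<Sum>m\<le>N. (if n = i \<and> m = l then P n m else 0)
      + (if n < i \<and> m < l \<and> i + m = l + n then f n m 1 else 0) *\<^sub>C (d * h * d))"
    by (simp only: compress_monomial[OF d fc] P_def)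
  also have "\<dots> = (\<Sum>n\<le>N. \<Sum>m\<le>N. if n = i \<and> m = l then P n m else 0) + diag_sum f i l *\<^sub>C (d * h * d)"
    using f by (subst diag_sum_eq_sum[where N = N])
      (auto simp: sum.distrib scaleC_sum_left coefficients_def)
  also have "(\<Sum>n\<le>N. \<Sum>m\<le>N. if n = i \<and> m = l then P n m else 0) = P i l"
  proof (rule sum_sum_delta)
    assume "i > N \<or> l > N"
    then have "f i l = (\<lambda>_. 0)" using f by (auto simp: coefficients_def)
    then show "P i l = 0" using h_const[of 0] by (simp add: P_def)
  qed
  finally show ?thesis by (simp add: P_def)
qed

lemma norm_compress_le:
  assumes "adj d = d"
  shows "norm (d * adj X ^ i * a * (X ^ l * d)) \<le> norm (X ^ i * d) * norm (X ^ l * d) * norm a"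
proof -
  have "norm (d * adj X ^ i) = norm (X ^ i * d)"
    using norm_adj[of "X ^ i * d"] assms by (simp add: adj_mult)
  then show ?thesis
    using norm_mult_ineq[of "d * adj X ^ i * a" "X ^ l * d"]
      mult_right_mono[OF norm_mult_ineq[of "d * adj X ^ i" a], of "norm (X ^ l * d)"]
    by (simp add: ac_simps)
qed

end

lemma weight_1 [simp]: "weight n 1 = 1"
  by (simp add: weight_def)

section \<open>Recovering entries and coefficients from the norm\<close>

context scaling
begin

text \<open>A hat function of \<open>h\<close> centred at \<open>z0\<close> and vanishing at 1
  annihilates \<open>X\<close>. At \<open>z0\<close> the compressed normal form takes the value of
  the entry times the product of the two weights; the compressing factors cost sqrt 2 times one
  weight each, whence the 2.\<close>

lemma entry_le:
  assumes f: "coefficients N f" and z0: "z0 \<in> K" "z0 \<noteq> 0" "z0 \<noteq> 1"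
  shows "cmod (of_real (weight i z0 * weight l z0) * f i l z0 + diag_sum f i l)
    \<le> 2 * norm (normal_form N f)"
proof -
  have fc: "continuous_on K (f i l)" using f by (simp add: coefficients_def)
  \<comment> \<open>The bound by \<open>cmod (1 - z0)\<close> makes the hat vanish at 1; the bound
    by \<open>cmod z0\<close> keeps its support where the weight is at most sqrt 2 times the weight
    at \<open>z0\<close>.\<close>
  define \<delta> where "\<delta> = min (cmod z0) (cmod (1 - z0))"
  have \<delta>: "\<delta> > 0" "\<delta> \<le> cmod z0" "\<delta> \<le> cmod (1 - z0)" using z0 by (auto simp: \<delta>_def)
  define r where "r z = max 0 (1 - cmod (z - z0) / \<delta>)" for z
  define u where "u z = complex_of_real (r z)" for z
  have u: "continuous_on K u"
    unfolding u_def[abs_def] r_def using \<delta>(1) by (intro continuous_intros) auto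
  have r01: "0 \<le> r z" "r z \<le> 1" for z using \<delta>(1) by (auto simp: r_def)
  have r1: "r 1 = 0" using \<delta> by (simp add: r_def pos_le_divide_eq)
  have near: "cmod z \<le> 2 * cmod z0" if "r z \<noteq> 0" for z
  proof -
    have "r z > 0" using that r01(1)[of z] by linarith
    then have "cmod (z - z0) / \<delta> < 1" by (simp add: r_def less_max_iff_disj)
    then have "cmod (z - z0) < \<delta>" using \<delta>(1) by (simp add: pos_divide_less_eq)
    then show ?thesis using \<delta>(2) norm_triangle_sub[of z z0] by linarith
  qed
  define d where "d = cfc u h"
  have sd: "adj d = d" unfolding d_def by (rule h_real_self_adjoint[OF u]) (simp add: u_def)
  have dX: "d * X = 0" using cfc_h_X[OF u] r1 by (simp add: d_def u_def)
  have Xd: "adj X * d = 0" using adj_X_cfc_h[OF u] r1 by (simp add: d_def u_def)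
  have Xd_le: "norm (X ^ j * d) \<le> sqrt 2 * weight j z0" for j
    unfolding d_def
  proof (rule norm_X_power_cfc_le[OF u])
    fix z assume "z \<in> K"
    show "weight j z * cmod (u z) \<le> sqrt 2 * weight j z0"
    proof (cases "r z = 0")
      case False
      have "weight j z \<le> sqrt 2 * weight j z0"
        using near[OF False] by (auto simp: weight_def simp flip: real_sqrt_mult)
      then have "weight j z * r z \<le> sqrt 2 * weight j z0 * 1"
        using r01[of z] by (intro mult_mono) auto
      then show ?thesis using r01[of z] by (simp add: u_def)
    qed (simp add: u_def)
  qed simp
  define g where "g z = u z * (gram i z * f i l z * gram l z) * u z + diag_sum f i l * (u z * z * u z)" for z
  have g: "continuous_on K g"
    unfolding g_def[abs_def] using u continuous_on_gram fc by (intro continuous_intros)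
  have cs: "continuous_on K (\<lambda>z. u z * (gram i z * f i l z * gram l z))" "continuous_on K (\<lambda>z. u z * z)"
    "continuous_on K (\<lambda>z. gram i z * f i l z * gram l z)"
    "continuous_on K (\<lambda>z. u z * (gram i z * f i l z * gram l z) * u z)" "continuous_on K (\<lambda>z. u z * z * u z)"
    "continuous_on K (\<lambda>z. diag_sum f i l * (u z * z * u z))"
    using u continuous_on_gram fc by (auto intro!: continuous_intros)
  have "d * adj X ^ i * normal_form N f * (X ^ l * d) = cfc g h"
    unfolding compress_normal_form[OF dX Xd f] g_def[abs_def]
    unfolding h_add[OF cs(4) cs(6)]
      h_scale[OF cs(5)] h_mult[OF cs(1) u]
      h_mult[OF u cs(3)] h_mult[OF cs(2) u]
      h_mult[OF u continuous_on_id] h_id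
    unfolding d_def ..
  then have "cmod (g z0) \<le> norm (X ^ i * d) * norm (X ^ l * d) * norm (normal_form N f)"
    using norm_cfc_ge[OF h_self_adjoint g z0(1)] norm_compress_le[OF sd] by (metis order_trans)
  also have "\<dots> \<le> (sqrt 2 * weight i z0) * (sqrt 2 * weight l z0) * norm (normal_form N f)"
    by (intro mult_mono mult_right_mono Xd_le) auto
  also have "\<dots> = weight i z0 * weight l z0 * (2 * norm (normal_form N f))" by simp
  finally have le: "cmod (g z0) \<le> weight i z0 * weight l z0 * (2 * norm (normal_form N f))" .
  define W where "W = weight i z0 * weight l z0"
  have W: "W > 0" using z0(2) by (simp add: W_def weight_def)
  have zz: "z0 = of_real (cmod z0)" by (rule spectrum_h_real[OF z0(1)])
  have q2: "gram j z0 = of_real (weight j z0 * weight j z0)" for j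
    using zz by (simp add: gram_def weight_def del: of_real_mult)
  \<comment> \<open>For positive indices both weights are the root of \<open>z0\<close>, so
    \<open>W = z0\<close>; if an index is 0, the diagonal sum vanishes.\<close>
  have D: "diag_sum f i l * z0 = diag_sum f i l * of_real W"
  proof (cases "i = 0 \<or> l = 0")
    case False
    then have "W = cmod z0" by (simp add: W_def weight_def)
    with zz show ?thesis by simp
  qed auto
  have "r z0 = 1" by (simp add: r_def)
  then have "g z0 = gram i z0 * f i l z0 * gram l z0 + diag_sum f i l * z0"
    by (simp add: g_def u_def)
  also have "\<dots> = of_real W * (of_real W * f i l z0 + diag_sum f i l)"
    unfolding D q2 by (simp add: W_def algebra_simps)
  finally have "cmod (g z0) = W * cmod (of_real W * f i l z0 + diag_sum f i l)"
    using W by (simp add: norm_mult)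
  with le W show ?thesis by (simp flip: W_def)
qed

text \<open>As \<open>inverse 0 = 0\<close>, the function \<open>1 - inverse z * z\<close> lives at
  0 only, where the weight of \<open>X\<close> is 0.\<close>

lemma one_minus_support:
  assumes "compact (K - {0, 1})"
  shows "X * cfc inverse h * h = X"
proof -
  note ci = continuous_on_isolated[OF assms]
  have cs: "continuous_on K (\<lambda>z. inverse z * z)" "continuous_on K (\<lambda>z. 1 - inverse z * z)"
    using ci by (auto intro!: continuous_intros)
  have "norm (X ^ 1 * cfc (\<lambda>z. 1 - inverse z * z) h) \<le> 0"
  proof (rule norm_X_power_cfc_le[OF cs(2)])
    show "weight 1 z * cmod (1 - inverse z * z) \<le> 0" for z
      by (cases "z = 0") (auto simp: weight_def)
  qed simp
  then have "X * cfc (\<lambda>z. 1 - inverse z * z) h = 0" by simp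
  moreover have "cfc (\<lambda>z. 1 - inverse z * z) h = 1 - cfc inverse h * h"
    using h_diff[OF _ cs(1), of "\<lambda>z. 1"] h_mult[OF ci(2), of "\<lambda>z. z"]
    by (simp add: h_const h_id)
  ultimately show ?thesis by (simp add: right_diff_distrib mult.assoc)
qed

text \<open>The defect of the equation in \<^const>\<open>shift_free\<close> is a projection that acts like the zeroth basis
  vector of a unilateral shift.\<close>

lemma next_diag_sum_le:
  assumes K: "compact (K - {0, 1})" and ne: "cfc (indicator {1}) h \<noteq> X * cfc inverse h * adj X"
    and f: "coefficients N f"
  shows "cmod (diag_sum f (Suc i) (Suc l)) \<le> norm (normal_form N f)"
proof -
  note ci = continuous_on_isolated[OF K]
  have fc: "continuous_on K (f i l)" using f by (simp add: coefficients_def)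
  define p where "p = cfc (indicator {1}) h"
  define v where "v = cfc inverse h"
  define e where "e = p - X * v * adj X"
  have sp: "adj p = p" unfolding p_def
    by (rule h_real_self_adjoint[OF ci(1)]) (simp add: indicator_def)
  have sv: "adj v = v" unfolding v_def
    by (rule h_real_self_adjoint[OF ci(2)]) (metis complex_cnj_inverse cnj_spectrum[OF h_self_adjoint])
  have e0: "e \<noteq> 0" using ne by (simp add: e_def p_def v_def)
  have se: "adj e = e" by (simp add: e_def adj_diff adj_mult adj_adj sp sv mult.assoc)
  have "X * v * adj X * X = X" using one_minus_support[OF K] by (simp add: v_def mult.assoc)
  then have eX: "e * X = 0" using cfc_h_X[OF ci(1)] by (simp add: e_def p_def left_diff_distrib)
  have Xe: "adj X * e = 0" using arg_cong[OF eX, of adj] by (simp add: adj_mult se)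
  have "h * p = cfc (\<lambda>z. z * indicator {1} z) h"
    using h_mult[OF _ ci(1), of "\<lambda>z. z"] by (simp add: p_def h_id)
  also have "\<dots> = p" unfolding p_def by (rule cfc_cong) (simp add: indicator_def)
  finally have hp: "h * p = p" .
  have he: "h * e = e" using hp h_X by (simp add: e_def right_diff_distrib flip: mult.assoc)
  have ce: "cfc g h * e = g 1 *\<^sub>C e" if "continuous_on K g" for g
    using cfc_eigen(2)[OF h_self_adjoint that, of e 1] he e0 by simp
  have "p * e = e" using ce[OF ci(1)] by (simp add: p_def)
  then have "adj (p * e) = adj e" by simp
  then have "e * p = e" by (simp add: adj_mult sp se)
  moreover have "e * (X * v * adj X) = 0" using eX by (simp flip: mult.assoc)
  ultimately have ee: "e * e = e" by (metis e_def right_diff_distrib diff_zero)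
  have "(norm e)\<^sup>2 = norm e" using cstar_identity[of e] by (simp add: se ee)
  then have n1: "norm e = 1" using e0 by (simp add: power2_eq_square)
  have Xe_le: "norm (X ^ j * e) = 1" for j
  proof -
    have "adj (X ^ j * e) * (X ^ j * e) = e * ((adj X ^ j * X ^ j) * e)"
      by (simp add: adj_mult se mult.assoc)
    also have "\<dots> = e" by (simp add: adj_X_power_X_power he ee del: mult.assoc)
    finally have "(norm (X ^ j * e))\<^sup>2 = 1" using cstar_identity[of "X ^ j * e"] n1 by simp
    then show ?thesis by (simp add: power2_eq_1_iff) (smt (verit) norm_ge_zero)
  qed
  have cs: "continuous_on K (\<lambda>z. gram i z * f i l z * gram l z)" using continuous_on_gram fc
    by (intro continuous_intros)
  have t1: "e * cfc (\<lambda>z. gram i z * f i l z * gram l z) h * e = f i l 1 *\<^sub>C e"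
    by (simp only: mult.assoc[of e] ce[OF cs] mult_scaleC_right ee) (simp add: gram_def)
  have t2: "e * h * e = e" by (simp only: mult.assoc[of e] he ee)
  \<comment> \<open>Since \<open>h e = e\<close>, everything is evaluated at 1, where the weights
    are 1: the entry is \<open>f i l 1 + diag_sum f i l\<close>, the diagonal sum one step
    further.\<close>
  have "e * adj X ^ i * normal_form N f * (X ^ l * e) = diag_sum f (Suc i) (Suc l) *\<^sub>C e"
    unfolding compress_normal_form[OF eX Xe f] t1 t2
    by (simp add: scaleC_add_left add.commute)
  then have "norm (diag_sum f (Suc i) (Suc l) *\<^sub>C e) \<le> norm (normal_form N f)"
    using norm_compress_le[OF se, of i "normal_form N f" l] by (simp add: Xe_le)
  then show ?thesis by (simp add: norm_scaleC n1)
qed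

lemma entry_le_closure:
  assumes f: "coefficients N f" and z: "z \<in> closure (K - {0, 1})"
  shows "cmod (of_real (weight i z * weight l z) * f i l z + diag_sum f i l)
    \<le> 2 * norm (normal_form N f)"
proof -
  have "closure (K - {0, 1}) \<subseteq> K"
    by (intro closure_minimal) (auto intro: compact_imp_closed compact_spectrum)
  moreover have "continuous_on K (f i l)" using f by (simp add: coefficients_def)
  ultimately have "continuous_on (closure (K - {0, 1}))
      (\<lambda>z. of_real (weight i z * weight l z) * f i l z + diag_sum f i l)"
    by (intro continuous_intros) (auto intro: continuous_on_subset)
  from continuous_on_closure_norm_le[OF this _ z] show ?thesis using entry_le[OF f] by auto
qed

lemma limit_point:
  assumes "\<not> compact (K - {0, 1})" shows "0 \<in> closure (K - {0, 1}) \<or> 1 \<in> closure (K - {0, 1})"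
proof -
  have "closure (K - {0, 1}) \<subseteq> K"
    by (intro closure_minimal) (auto intro: compact_imp_closed compact_spectrum)
  moreover have "bounded (K - {0, 1})" by (rule bounded_subset[OF compact_imp_bounded[OF compact_spectrum]]) auto
  then have "\<not> closed (K - {0, 1})" using assms by (simp add: compact_eq_bounded_closed)
  then have "closure (K - {0, 1}) \<noteq> K - {0, 1}" by (metis closed_closure)
  ultimately show ?thesis using closure_subset[of "K - {0, 1}"] by blast
qed

text \<open>At 0 the weights of positive indices vanish, so the limiting entry at (i, l) is the
  diagonal sum itself. At 1 the weights are 1, so the entry with both indices lowered by one has
  this value. With neither limit available, the projection defect provides the bound.\<close>

lemma diag_sum_le:
  assumes "\<not> shift_free" and f: "coefficients N f"
  shows "cmod (diag_sum f i l) \<le> 2 * norm (normal_form N f)"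
proof (cases "i = 0 \<or> l = 0")
  case False
  then obtain i' l' where il: "i = Suc i'" "l = Suc l'" by (metis not0_implies_Suc)
  show ?thesis
  proof (cases "compact (K - {0, 1})")
    case True
    then have "cfc (indicator {1}) h \<noteq> X * cfc inverse h * adj X"
      using assms(1) by (simp add: shift_free_def)
    from next_diag_sum_le[OF True this f, of i' l']
    have "cmod (diag_sum f i l) \<le> norm (normal_form N f)" unfolding il .
    also have "\<dots> \<le> 2 * norm (normal_form N f)" by simp
    finally show ?thesis .
  next
    case False
    then consider "0 \<in> closure (K - {0, 1})" | "1 \<in> closure (K - {0, 1})" using limit_point by blast
    then show ?thesis
    proof cases
      case 1
      then show ?thesis using entry_le_closure[OF f 1, of i l] il by (simp add: weight_def)
    next
      case 2
      then show ?thesis using entry_le_closure[OF f 2, of i' l'] il by (simp add: add.commute)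
    qed
  qed
qed auto

text \<open>At 1 the coefficient is the difference of two consecutive diagonal sums, and elsewhere,
  away from 0, its weighted value is an entry minus a diagonal sum. Either way two bounds with
  factor 2 add up to 4.\<close>

lemma coefficient_le:
  assumes "\<not> shift_free" and f: "coefficients N f" and z: "z \<in> K"
  shows "weight i z * weight l z * cmod (f i l z) \<le> 4 * norm (normal_form N f)"
proof -
  note D = diag_sum_le[OF assms(1) f]
  consider "z = 0" | "z = 1" | "z \<noteq> 0" "z \<noteq> 1" by blast
  then show ?thesis
  proof cases
    case 1
    then show ?thesis using f by (auto simp: weight_def coefficients_def)
  next
    case 2
    have "cmod (f i l 1) \<le> cmod (diag_sum f (Suc i) (Suc l)) + cmod (diag_sum f i l)"
      using norm_triangle_ineq4[of "diag_sum f (Suc i) (Suc l)" "diag_sum f i l"] by simp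
    then have "cmod (f i l 1) \<le> 4 * norm (normal_form N f)"
      using D[of "Suc i" "Suc l"] D[of i l] by linarith
    then show ?thesis using 2 by simp
  next
    case 3
    have "cmod (of_real (weight i z * weight l z) * f i l z)
        \<le> cmod (of_real (weight i z * weight l z) * f i l z + diag_sum f i l) + cmod (diag_sum f i l)"
      by (metis add_diff_cancel_right' norm_triangle_ineq4)
    then show ?thesis
      using entry_le[OF f z 3, of i l] D[of i l] by (simp add: norm_mult abs_mult)
  qed
qed

text \<open>If the spectrum were contained in {0, 1}, then \<open>X h = X\<close> and the shift-free
  equation would read \<open>h = X * adj X\<close>, against non-normality. The point is needed to
  read off diagonal sums outside the index square.\<close>

lemma shift_free_spectrum:
  assumes "shift_free" obtains z where "z \<in> K" "z \<noteq> 0" "z \<noteq> 1"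
proof (rule ccontr)
  assume "\<not> thesis"
  with that have K: "z = 0 \<or> z = 1" if "z \<in> K" for z using \<open>z \<in> K\<close> by blast
  have c: "continuous_on K (\<lambda>z. 1 - z)" by (intro continuous_intros)
  have "cfc (indicator {1}) h = cfc (\<lambda>z. z) h" "cfc inverse h = cfc (\<lambda>z. z) h"
    by (auto intro!: cfc_cong simp: indicator_def dest!: K)
  then have e: "h = X * h * adj X"
    using assms by (simp add: shift_free_def h_id)
  have "norm (X ^ 1 * cfc (\<lambda>z. 1 - z) h) \<le> 0"
    by (intro norm_X_power_cfc_le[OF c]) (auto simp: weight_def dest!: K)
  moreover have "cfc (\<lambda>z. 1 - z) h = 1 - h"
    using h_diff[of "\<lambda>z. 1" "\<lambda>z. z"]
    by (simp add: h_const h_id)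
  ultimately have "X * h = X" by (simp add: right_diff_distrib)
  with e have "h = X * adj X" by simp
  with not_normal show False by simp
qed

text \<open>The \<open>inverse\<close> term is what arrives from further up the diagonal, the
  indicator term what is passed on. At 1 the three terms cancel; at other nonzero spectral points
  the weighted value is exactly the matrix entry of \<open>f\<close>.\<close>

definition shifted_coefficients :: "(nat \<Rightarrow> nat \<Rightarrow> complex \<Rightarrow> complex) \<Rightarrow> nat \<Rightarrow> nat \<Rightarrow> complex \<Rightarrow> complex" where
  "shifted_coefficients f n m z =
    f n m z + diag_sum f n m * inverse z - diag_sum f (Suc n) (Suc m) * indicator {1} z"

text \<open>In the shift-free case \<open>X\<^sup>n 1\<^sub>1(h) X\<^sup>*\<^sup>m = X\<^sup>n\<^sup>+\<^sup>1 h\<^sup>-\<^sup>1 X\<^sup>*\<^sup>m\<^sup>+\<^sup>1\<close>, so the values at \<open>1\<close> can be moved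
  along the diagonals until only those at the boundary remain.\<close>

lemma normal_form_shift_free:
  assumes sf: "shift_free" and f: "coefficients N f"
  shows "normal_form N f = normal_form N (shifted_coefficients f)
    + (\<Sum>n\<le>Suc N. \<Sum>m\<le>Suc N. if n \<le> N \<and> m \<le> N then 0
        else diag_sum f n m *\<^sub>C (X ^ n * cfc inverse h * adj X ^ m))"
proof -
  have K: "compact (K - {0, 1})" using sf by (simp add: shift_free_def)
  note ci = continuous_on_isolated[OF K]
  have fc: "continuous_on K (f n m)" for n m using f by (simp add: coefficients_def)
  define M where "M n m = X ^ n * cfc inverse h * adj X ^ m" for n m
  define T where "T n m = diag_sum f n m *\<^sub>C M n m" for n m
  have shift: "X ^ n * cfc (indicator {1}) h * adj X ^ m = M (Suc n) (Suc m)" for n m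
    using sf by (simp add: shift_free_def M_def mult.assoc power_commutes)
      (simp add: power_commutes flip: mult.assoc)
  have "X ^ n * cfc (shifted_coefficients f n m) h * adj X ^ m
      = X ^ n * cfc (f n m) h * adj X ^ m + T n m - T (Suc n) (Suc m)" for n m
  proof -
    have "cfc (shifted_coefficients f n m) h = cfc (f n m) h + diag_sum f n m *\<^sub>C cfc inverse h
        - diag_sum f (Suc n) (Suc m) *\<^sub>C cfc (indicator {1}) h"
      unfolding shifted_coefficients_def[abs_def] using fc ci
      by (simp add: h_add h_diff h_scale
          continuous_intros del: diag_sum.simps)
    then show ?thesis
      by (simp add: distrib_left distrib_right left_diff_distrib right_diff_distrib mult_scaleC shift T_def del: diag_sum.simps) (simp add: M_def)
  qed
  then have e1: "normal_form N (shifted_coefficients f)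
      = normal_form N f + (\<Sum>n\<le>N. \<Sum>m\<le>N. T n m) - (\<Sum>n\<le>N. \<Sum>m\<le>N. T (Suc n) (Suc m))"
    by (simp add: normal_form_def sum.distrib sum_subtractf)
  \<comment> \<open>\<open>T\<close> is 0 as soon as an index is 0, so the shifted sum can start
    from 0; the difference of the two squares is the border with an index
    \<open>N + 1\<close>.\<close>
  have e2: "(\<Sum>n\<le>N. \<Sum>m\<le>N. T (Suc n) (Suc m)) = (\<Sum>n\<le>Suc N. \<Sum>m\<le>Suc N. T n m)"
    by (simp add: T_def sum.atMost_Suc_shift del: sum.atMost_Suc diag_sum.simps(3) power_Suc)
  have e3: "(\<Sum>n\<le>Suc N. \<Sum>m\<le>Suc N. T n m) - (\<Sum>n\<le>N. \<Sum>m\<le>N. T n m)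
      = (\<Sum>n\<le>Suc N. \<Sum>m\<le>Suc N. if n \<le> N \<and> m \<le> N then 0 else T n m)"
  proof -
    have "(\<Sum>n\<le>N. \<Sum>m\<le>N. T n m) = (\<Sum>n\<le>Suc N. \<Sum>m\<le>Suc N. if n \<le> N \<and> m \<le> N then T n m else 0)"
      by simp
    moreover have "T n m - (if n \<le> N \<and> m \<le> N then T n m else 0) = (if n \<le> N \<and> m
      \<le> N then 0 else T n m)" for n m
      by simp
    ultimately show ?thesis by (simp only: sum_subtractf[symmetric])
  qed
  have "b = w + s3" if "w = b + s0 - s1" "s1 = s2" "s2 - s0 = s3" for b w s0 s1 s2 s3 :: 'a
    using that by auto
  from this[OF e1 e2 e3] show ?thesis unfolding T_def M_def .
qed

end

text \<open>The upper bound for \<open>Y\<close> uses only suprema over the spectrum that are bounded by the norm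
  of the same normal form in \<open>X\<close>.\<close>

lemma normal_form_comparison:
  assumes "scaling X" "scaling Y" and K: "spectrum (adj X * X) = spectrum (adj Y * Y)"
    and type: "scaling.shift_free X \<longleftrightarrow> scaling.shift_free Y"
    and f: "scaling.coefficients X N f"
  shows "norm (scaling.normal_form Y N f) \<le> 4 * (real N + 2)\<^sup>2 * norm (scaling.normal_form X N f)"
proof -
  interpret X: scaling X by fact
  interpret Y: scaling Y by fact
  define a where "a = norm (X.normal_form N f)"
  have a: "a \<ge> 0" by (simp add: a_def)
  have fc: "continuous_on Y.K (f n m)" for n m
    using f by (simp add: X.coefficients_def K)
  have fY: "Y.coefficients N f" using f by (simp add: X.coefficients_def Y.coefficients_def K)
  have mono: "(real N + 1)\<^sup>2 \<le> (real N + 2)\<^sup>2" by (intro power_mono) auto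
  show ?thesis
  proof (cases "X.shift_free")
    case False
    have "norm (Y.normal_form N f) \<le> (real N + 1)\<^sup>2 * (4 * a)"
      using X.coefficient_le[OF False f] a unfolding a_def K
      by (intro Y.norm_normal_form_le fc) auto
    also have "\<dots> \<le> (real N + 2)\<^sup>2 * (4 * a)" using a mono by (intro mult_right_mono) auto
    finally show ?thesis by (simp add: a_def ac_simps)
  next
    case True
    then have Ys: "Y.shift_free" using type by simp
    then have cK: "compact (Y.K - {0, 1})" by (simp add: Y.shift_free_def)
    note ci = Y.continuous_on_isolated[OF cK]
    obtain z0 where z0: "z0 \<in> X.K" "z0 \<noteq> 0" "z0 \<noteq> 1" using X.shift_free_spectrum[OF True] .
    \<comment> \<open>Outside the index square the coefficient is zero, so the entry at
      \<open>z0\<close> is the bare diagonal sum.\<close>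
    have boundary: "cmod (diag_sum f n m) \<le> 2 * a" if "\<not> (n \<le> N \<and> m \<le> N)" for n m
    proof -
      have "f n m = (\<lambda>_. 0)" using f that by (auto simp: X.coefficients_def not_le)
      then show ?thesis using X.entry_le[OF f z0, of n m] by (simp add: a_def)
    qed
    have ci': "continuous_on Y.K (Y.shifted_coefficients f n m)" for n m
      unfolding Y.shifted_coefficients_def[abs_def]
      by (intro continuous_on_add continuous_on_diff continuous_on_mult continuous_on_const fc ci)
    have w: "weight n z * weight m z * cmod (Y.shifted_coefficients f n m z)
      \<le> 2 * a" if z: "z \<in> Y.K" for n m z
    proof -
      consider "z = 0" | "z = 1" | "z \<noteq> 0" "z \<noteq> 1" by blast
      then show ?thesis
      proof cases
        case 1
        then show ?thesis using f a by (auto simp: weight_def X.coefficients_def Y.shifted_coefficients_def)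
      next
        case 2
        then show ?thesis using a by (simp add: Y.shifted_coefficients_def)
      next
        case 3
        have zz: "z = of_real (cmod z)" by (rule Y.spectrum_h_real[OF z])
        have D: "of_real (weight n z * weight m z) * (diag_sum f n m * inverse z) = diag_sum f n m"
        proof (cases "n = 0 \<or> m = 0")
          case False
          then have "of_real (weight n z * weight m z) = z" using zz by (simp add: weight_def)
          then show ?thesis using 3 by simp
        qed auto
        have "weight n z * weight m z * cmod (Y.shifted_coefficients f n m z)
            = cmod (of_real (weight n z * weight m z) * (f n m z + diag_sum f n m * inverse z))"
          using 3 by (simp add: norm_mult abs_mult Y.shifted_coefficients_def)
        also have "\<dots> = cmod (of_real (weight n z * weight m z) * f n m z + diag_sum f n m)"
          by (simp only: distrib_left D)
        also have "\<dots> \<le> 2 * a" unfolding a_def using X.entry_le[OF f _ 3] z K by simp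
        finally show ?thesis .
      qed
    qed
    \<comment> \<open>A border term with nonzero diagonal sum has positive indices, so its two
      weights multiply to \<open>cmod z\<close> and compensate for \<open>inverse z\<close>.\<close>
    have M: "norm (if n \<le> N \<and> m \<le> N then 0 else diag_sum f n m *\<^sub>C (Y ^ n * cfc inverse Y.h * adj Y ^ m)) \<le> 2 * a" for n m
    proof (cases "n \<le> N \<and> m \<le> N \<or> n = 0 \<or> m = 0")
      case False
      have "norm (Y ^ n * cfc inverse Y.h * adj Y ^ m) \<le> 1"
      proof (rule Y.norm_monomial_le[OF ci(2)])
        show "weight n z * weight m z * cmod (inverse z) \<le> 1" for z
          using False by (cases "z = 0") (auto simp: weight_def norm_inverse)
      qed simp
      then have "cmod (diag_sum f n m) * norm (Y ^ n * cfc inverse Y.h * adj Y ^ m) \<le> 2 * a * 1"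
        using boundary[of n m] False a by (intro mult_mono) auto
      with False a show ?thesis by (simp add: norm_scaleC)
    qed (use a in auto)
    have "norm (Y.normal_form N f) \<le> norm (Y.normal_form N (Y.shifted_coefficients f))
        + norm (\<Sum>n\<le>Suc N. \<Sum>m\<le>Suc N. if n \<le> N \<and> m \<le> N then 0
        else diag_sum f n m *\<^sub>C (Y ^ n * cfc inverse Y.h * adj Y ^ m))"
      unfolding Y.normal_form_shift_free[OF Ys fY] by (rule norm_triangle_ineq)
    also have "\<dots> \<le> (real N + 1)\<^sup>2 * (2 * a) + (\<Sum>n\<le>Suc N. \<Sum>m\<le>Suc N. 2 * a)"
      using a by (intro add_mono Y.norm_normal_form_le sum_norm_le M ci' w) auto
    also have "\<dots> = (real N + 1)\<^sup>2 * (2 * a) + (real N + 2)\<^sup>2 * (2 * a)"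
      by (simp add: power2_eq_square algebra_simps)
    also have "\<dots> \<le> (real N + 2)\<^sup>2 * (2 * a) + (real N + 2)\<^sup>2 * (2 * a)"
      using a mono by (intro add_right_mono mult_right_mono) auto
    finally show ?thesis by (simp add: a_def ac_simps)
  qed
qed

section \<open>Formal *-polynomials\<close>

text \<open>Formal terms, because an element generated by \<open>X\<close> has no counterpart for
  \<open>Y\<close> until the norms are known to agree. A unit is left out, as the generated algebras
  need not have one.\<close>

datatype star_term = Gen | Add star_term star_term | Mul star_term star_term
  | Scale complex star_term | Adj star_term

primrec star_eval :: "'a::cstar_algebra \<Rightarrow> star_term \<Rightarrow> 'a" where
  "star_eval X Gen = X"
| "star_eval X (Add s t) = star_eval X s + star_eval X t"
| "star_eval X (Mul s t) = star_eval X s * star_eval X t"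
| "star_eval X (Scale c t) = c *\<^sub>C star_eval X t"
| "star_eval X (Adj t) = adj (star_eval X t)"

primrec star_degree :: "star_term \<Rightarrow> nat" where
  "star_degree Gen = 1"
| "star_degree (Add s t) = max (star_degree s) (star_degree t)"
| "star_degree (Mul s t) = star_degree s + star_degree t"
| "star_degree (Scale c t) = star_degree t"
| "star_degree (Adj t) = star_degree t"

lemma star_eval_emb: "star_eval (emb X) t = emb (star_eval X t)"
  by (induction t) (simp_all add: Unitize_simps)

context scaling
begin

text \<open>The two inner powers collapse to at most one, and a surplus power absorbs the adjacent
  function, leaving its value at 1. Hence products of monomials are monomials again.\<close>

lemma monomial_mult:
  assumes f: "continuous_on K f" and g: "continuous_on K g"
  shows "m = k \<Longrightarrow> (X ^ n * cfc f h * adj X ^ m) * (X ^ k * cfc g h * adj X ^ l)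
      = X ^ n * cfc (\<lambda>z. f z * (gram m z * g z)) h * adj X ^ l"
    and "m > k \<Longrightarrow> (X ^ n * cfc f h * adj X ^ m) * (X ^ k * cfc g h * adj X ^ l)
      = X ^ n * cfc (\<lambda>z. g 1 * f z) h * adj X ^ (m - k + l)"
    and "m < k \<Longrightarrow> (X ^ n * cfc f h * adj X ^ m) * (X ^ k * cfc g h * adj X ^ l)
      = X ^ (n + (k - m)) * cfc (\<lambda>z. f 1 * g z) h * adj X ^ l"
proof -
  have e: "(X ^ n * cfc f h * adj X ^ m) * (X ^ k * cfc g h * adj X ^ l)
      = X ^ n * (cfc f h * ((adj X ^ m * X ^ k) * cfc g h)) * adj X ^ l"
    by (simp add: mult.assoc)
  have "cfc f h * (cfc (gram m) h * cfc g h) = cfc (\<lambda>z. f z * (gram m z * g z)) h"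
    using f g continuous_on_gram by (simp add: h_mult continuous_on_mult)
  then show "m = k \<Longrightarrow> (X ^ n * cfc f h * adj X ^ m) * (X ^ k * cfc g h * adj X ^ l)
      = X ^ n * cfc (\<lambda>z. f z * (gram m z * g z)) h * adj X ^ l"
    unfolding e using adj_X_power_X_power_gram[of m] by simp
  show "(X ^ n * cfc f h * adj X ^ m) * (X ^ k * cfc g h * adj X ^ l)
      = X ^ n * cfc (\<lambda>z. g 1 * f z) h * adj X ^ (m - k + l)" if "m > k"
    unfolding e power_add using that
    by (simp add: adj_X_power_X_power_less adj_X_power_cfc_h[OF g] h_scale[OF f]
        mult_scaleC mult.assoc)
  show "(X ^ n * cfc f h * adj X ^ m) * (X ^ k * cfc g h * adj X ^ l)
      = X ^ (n + (k - m)) * cfc (\<lambda>z. f 1 * g z) h * adj X ^ l" if "m < k"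
  proof -
    have "cfc f h * (X ^ (k - m) * cfc g h) = f 1 *\<^sub>C X ^ (k - m) * cfc g h"
      using cfc_h_X_power[OF f, of "k - m"] that by (simp flip: mult.assoc)
    then show ?thesis
      unfolding e power_add using that
      by (simp add: adj_X_power_X_power_greater h_scale[OF g]
          mult_scaleC power_add mult.assoc)
  qed
qed

lemma cfc_zero_h [simp]: "cfc (\<lambda>_. 0) h = 0"
  using h_const[of 0] by simp

lemma normal_form_mono:
  assumes "coefficients N f" "N \<le> N'" shows "coefficients N' f" "normal_form N' f = normal_form N f"
proof -
  show "coefficients N' f" using assms by (auto simp: coefficients_def)
  have z: "cfc (f n m) h = 0" if "n > N \<or> m > N" for n m
  proof -
    have "f n m = (\<lambda>_. 0)" using assms(1) that by (auto simp: coefficients_def)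
    then show ?thesis by simp
  qed
  have "(\<Sum>m\<le>N'. X ^ n * cfc (f n m) h * adj X ^ m)
    = (\<Sum>m\<le>N. X ^ n * cfc (f n m) h * adj X ^ m)" for n
    using assms(2) by (intro sum.mono_neutral_right) (auto simp: z)
  moreover have "(\<Sum>n\<le>N'. \<Sum>m\<le>N. X ^ n * cfc (f n m) h * adj X ^ m)
      = (\<Sum>n\<le>N. \<Sum>m\<le>N. X ^ n * cfc (f n m) h * adj X ^ m)"
    using assms(2) by (intro sum.mono_neutral_right) (auto simp: z)
  ultimately show "normal_form N' f = normal_form N f" by (simp add: normal_form_def)
qed

lemma normal_form_add:
  assumes "coefficients N f" "coefficients N g"
  shows "coefficients N (\<lambda>n m z. f n m z + g n m z)"
    "normal_form N (\<lambda>n m z. f n m z + g n m z) = normal_form N f + normal_form N g"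
proof -
  show "coefficients N (\<lambda>n m z. f n m z + g n m z)"
    using assms by (auto simp: coefficients_def intro!: continuous_intros)
  show "normal_form N (\<lambda>n m z. f n m z + g n m z) = normal_form N f + normal_form N g"
    using assms by (simp add: normal_form_def coefficients_def h_add
        distrib_left distrib_right sum.distrib)
qed

lemma normal_form_scale:
  assumes "coefficients N f"
  shows "coefficients N (\<lambda>n m z. c * f n m z)"
    "normal_form N (\<lambda>n m z. c * f n m z) = c *\<^sub>C normal_form N f"
proof -
  show "coefficients N (\<lambda>n m z. c * f n m z)"
    using assms by (auto simp: coefficients_def intro!: continuous_intros)
  show "normal_form N (\<lambda>n m z. c * f n m z) = c *\<^sub>C normal_form N f"
    using assms by (simp add: normal_form_def coefficients_def h_scale
        mult_scaleC scaleC_sum_right)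
qed

lemma normal_form_adj:
  assumes "coefficients N f"
  shows "coefficients N (\<lambda>n m z. cnj (f m n z))"
    "normal_form N (\<lambda>n m z. cnj (f m n z)) = adj (normal_form N f)"
proof -
  show "coefficients N (\<lambda>n m z. cnj (f m n z))"
    using assms by (auto simp: coefficients_def intro!: continuous_intros)
  show "normal_form N (\<lambda>n m z. cnj (f m n z)) = adj (normal_form N f)"
    using assms unfolding normal_form_def adj_sum
    by (subst sum.swap) (simp add: coefficients_def h_cnj adj_mult mult.assoc)
qed

lemma normal_form_monomial:
  assumes "continuous_on K g" "n \<le> N" "m \<le> N" "n = 0 \<Longrightarrow> m = 0 \<Longrightarrow> g 0 = 0"
  shows "coefficients N (\<lambda>i j z. if i = n \<and> j = m then g z else 0)"
    "normal_form N (\<lambda>i j z. if i = n \<and> j = m then g z else 0) = X ^ n * cfc g h * adj X ^ m"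
proof -
  have "continuous_on K (\<lambda>z. if P then g z else 0)" for P
    using assms(1) by (cases P) simp_all
  then show "coefficients N (\<lambda>i j z. if i = n \<and> j = m then g z else 0)"
    using assms by (auto simp: coefficients_def)
  have "X ^ i * cfc (\<lambda>z. if i = n \<and> j = m then g z else 0) h * adj X ^ j
      = (if i = n \<and> j = m then X ^ i * cfc g h * adj X ^ j else 0)" for i j
    by auto
  then show "normal_form N (\<lambda>i j z. if i = n \<and> j = m then g z else 0) = X ^ n * cfc g h * adj X ^ m"
    unfolding normal_form_def
    using sum_sum_delta[where i = n and l = m and N = N and P
      = "\<lambda>i j. X ^ i * cfc g h * adj X ^ j"] assms
    by simp
qed

end

section \<open>Simultaneous normal forms for two scaling elements\<close>

locale scaling_pair = X: scaling X + Y: scaling Y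
  for X :: "'a::cstar_algebra_1" and Y :: "'b::cstar_algebra_1" +
  assumes same_spectrum: "spectrum (adj X * X) = spectrum (adj Y * Y)"
begin

text \<open>One coefficient family must serve both elements; as such families need not be unique,
  the relation carries a witness through the operations instead of computing it from an
  element.\<close>

definition has_normal_form :: "nat \<Rightarrow> 'a \<Rightarrow> 'b \<Rightarrow> bool" where
  "has_normal_form N a b \<longleftrightarrow> (\<exists>f. X.coefficients N f \<and> a = X.normal_form N f \<and> b = Y.normal_form N f)"

lemma coefficients_eq: "X.coefficients = Y.coefficients"
  by (simp add: fun_eq_iff X.coefficients_def Y.coefficients_def same_spectrum)

lemma has_normal_formI:
  "X.coefficients N f \<Longrightarrow> a = X.normal_form N f \<Longrightarrow> b = Y.normal_form N f \<Longrightarrow> has_normal_form N a b"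
  unfolding has_normal_form_def by blast

lemma has_normal_formE:
  assumes "has_normal_form N a b"
  obtains f where "X.coefficients N f" "Y.coefficients N f" "a = X.normal_form N f" "b
    = Y.normal_form N f"
  using assms unfolding has_normal_form_def coefficients_eq by blast

lemma has_normal_form_mono:
  assumes "has_normal_form N a b" "N \<le> N'" shows "has_normal_form N' a b"
proof -
  from assms(1) obtain f where f: "X.coefficients N f" "Y.coefficients N f"
    "a = X.normal_form N f" "b = Y.normal_form N f" by (rule has_normal_formE)
  show ?thesis
    using X.normal_form_mono[OF f(1) assms(2)] Y.normal_form_mono[OF f(2) assms(2)] f
    by (intro has_normal_formI) auto
qed

lemma has_normal_form_add:
  assumes "has_normal_form N a b" "has_normal_form N a' b'"
  shows "has_normal_form N (a + a') (b + b')"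
proof -
  from assms(1) obtain f where f: "X.coefficients N f" "Y.coefficients N f"
    "a = X.normal_form N f" "b = Y.normal_form N f" by (rule has_normal_formE)
  from assms(2) obtain g where g: "X.coefficients N g" "Y.coefficients N g"
    "a' = X.normal_form N g" "b' = Y.normal_form N g" by (rule has_normal_formE)
  show ?thesis
    by (rule has_normal_formI[OF X.normal_form_add(1)[OF f(1) g(1)]])
       (simp_all add: f g X.normal_form_add(2)[OF f(1) g(1)] Y.normal_form_add(2)[OF f(2) g(2)])
qed

lemma has_normal_form_scale:
  assumes "has_normal_form N a b" shows "has_normal_form N (c *\<^sub>C a) (c *\<^sub>C b)"
proof -
  from assms(1) obtain f where f: "X.coefficients N f" "Y.coefficients N f"
    "a = X.normal_form N f" "b = Y.normal_form N f" by (rule has_normal_formE)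
  show ?thesis
    by (rule has_normal_formI[OF X.normal_form_scale(1)[OF f(1)]])
       (simp_all add: f X.normal_form_scale(2)[OF f(1)] Y.normal_form_scale(2)[OF f(2)])
qed

lemma has_normal_form_adj:
  assumes "has_normal_form N a b" shows "has_normal_form N (adj a) (adj b)"
proof -
  from assms(1) obtain f where f: "X.coefficients N f" "Y.coefficients N f"
    "a = X.normal_form N f" "b = Y.normal_form N f" by (rule has_normal_formE)
  show ?thesis
    by (rule has_normal_formI[OF X.normal_form_adj(1)[OF f(1)]])
       (simp_all add: f X.normal_form_adj(2)[OF f(1)] Y.normal_form_adj(2)[OF f(2)])
qed

lemma has_normal_form_monomial:
  assumes "continuous_on X.K g" "n \<le> N" "m \<le> N" "n = 0 \<Longrightarrow> m = 0 \<Longrightarrow> g 0 = 0"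
  shows "has_normal_form N (X ^ n * cfc g X.h * adj X ^ m) (Y ^ n * cfc g Y.h * adj Y ^ m)"
proof -
  have Y: "continuous_on Y.K g" using assms(1) same_spectrum by simp
  show ?thesis
    by (rule has_normal_formI[OF X.normal_form_monomial(1)[OF assms]])
       (use X.normal_form_monomial(2)[OF assms] Y.normal_form_monomial(2)[OF Y assms(2-4)] in simp_all)
qed

lemma has_normal_form_sum:
  assumes "\<And>i. i \<in> I \<Longrightarrow> has_normal_form N (a i) (b i)"
  shows "has_normal_form N (sum a I) (sum b I)"
  using assms
proof (induction I rule: infinite_finite_induct)
  case empty
  have "has_normal_form N (0 *\<^sub>C (X ^ 0 * cfc (\<lambda>z. 0) X.h * adj X ^ 0)) (0 *\<^sub>C (Y ^ 0 * cfc (\<lambda>z. 0) Y.h * adj Y ^ 0))"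
    by (intro has_normal_form_scale has_normal_form_monomial) auto
  then show ?case by simp
next
  case (infinite A)
  have "has_normal_form N (0 *\<^sub>C (X ^ 0 * cfc (\<lambda>z. 0) X.h * adj X ^ 0)) (0 *\<^sub>C (Y ^ 0 * cfc (\<lambda>z. 0) Y.h * adj Y ^ 0))"
    by (intro has_normal_form_scale has_normal_form_monomial) auto
  then show ?case using infinite by simp
next
  case (insert i I)
  then show ?case by (simp add: has_normal_form_add)
qed

lemma has_normal_form_monomial_mult:
  assumes f: "continuous_on X.K f" and g: "continuous_on X.K g"
    and n: "n \<le> N" "m \<le> N" and k: "k \<le> M" "l \<le> M"
    and 0: "n = 0 \<Longrightarrow> m = 0 \<Longrightarrow> f 0 = 0" "k = 0 \<Longrightarrow> l = 0 \<Longrightarrow> g 0 = 0"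
  shows "has_normal_form (N + M)
    ((X ^ n * cfc f X.h * adj X ^ m) * (X ^ k * cfc g X.h * adj X ^ l))
    ((Y ^ n * cfc f Y.h * adj Y ^ m) * (Y ^ k * cfc g Y.h * adj Y ^ l))"
proof -
  have fY: "continuous_on Y.K f" "continuous_on Y.K g" using f g same_spectrum by simp_all
  consider "m = k" | "m > k" | "m < k" by linarith
  then show ?thesis
  proof cases
    case 1
    have "continuous_on X.K (\<lambda>z. f z * (gram m z * g z))"
      using f g by (intro continuous_on_mult continuous_on_gram)
    then show ?thesis
      unfolding X.monomial_mult(1)[OF f g 1] Y.monomial_mult(1)[OF fY 1]
      using n k 0 1 by (intro has_normal_form_monomial) (auto simp: gram_def)
  next
    case 2
    have "continuous_on X.K (\<lambda>z. g 1 * f z)" using f by (intro continuous_intros)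
    then show ?thesis
      unfolding X.monomial_mult(2)[OF f g 2] Y.monomial_mult(2)[OF fY 2]
      using n k 0 2 by (intro has_normal_form_monomial) auto
  next
    case 3
    have "continuous_on X.K (\<lambda>z. f 1 * g z)" using g by (intro continuous_intros)
    then show ?thesis
      unfolding X.monomial_mult(3)[OF f g 3] Y.monomial_mult(3)[OF fY 3]
      using n k 0 3 by (intro has_normal_form_monomial) auto
  qed
qed

lemma has_normal_form_mult:
  assumes "has_normal_form N a b" "has_normal_form M a' b'"
  shows "has_normal_form (N + M) (a * a') (b * b')"
proof -
  obtain f g where f: "X.coefficients N f" "a = X.normal_form N f" "b = Y.normal_form N f"
    and g: "X.coefficients M g" "a' = X.normal_form M g" "b' = Y.normal_form M g"
    using assms unfolding has_normal_form_def by blast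
  have c: "continuous_on X.K (f n m)" "continuous_on X.K (g n m)" "f 0 0 0 = 0" "g 0 0 0 = 0"
    for n m
    using f(1) g(1) by (simp_all add: X.coefficients_def)
  have "has_normal_form (N + M)
    (\<Sum>n\<le>N. \<Sum>k\<le>M. \<Sum>m\<le>N. \<Sum>l\<le>M. (X ^ n * cfc (f n m) X.h * adj X ^ m) * (X ^ k * cfc (g k l) X.h * adj X ^ l))
    (\<Sum>n\<le>N. \<Sum>k\<le>M. \<Sum>m\<le>N. \<Sum>l\<le>M. (Y ^ n * cfc (f n m) Y.h * adj Y ^ m) * (Y ^ k * cfc (g k l) Y.h * adj Y ^ l))"
    by (intro has_normal_form_sum has_normal_form_monomial_mult c) (auto simp: c)
  then show ?thesis by (simp add: f g X.normal_form_def Y.normal_form_def sum_product)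
qed

lemma star_eval_normal_form: "has_normal_form (star_degree t) (star_eval X t) (star_eval Y t)"
proof (induction t)
  case Gen
  show ?case
    using has_normal_form_monomial[of "\<lambda>z. 1" 1 1 0]
    by (simp add: X.h_const Y.h_const)
next
  case (Add s t)
  then show ?case by (auto intro!: has_normal_form_add elim: has_normal_form_mono)
qed (simp_all add: has_normal_form_mult has_normal_form_scale has_normal_form_adj)

lemma norm_star_eval_comparison:
  assumes "X.shift_free \<longleftrightarrow> Y.shift_free"
  shows "norm (star_eval Y t) \<le> 4 * (real (star_degree t) + 2)\<^sup>2 * norm (star_eval X t)"
proof -
  obtain f where "X.coefficients (star_degree t) f" "star_eval X t
    = X.normal_form (star_degree t) f"
    "star_eval Y t = Y.normal_form (star_degree t) f"
    using star_eval_normal_form unfolding has_normal_form_def by blast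
  then show ?thesis
    using normal_form_comparison[OF X.scaling_axioms Y.scaling_axioms same_spectrum assms] by simp
qed

end

section \<open>Removal of the quadratic factor\<close>

primrec star_square :: "star_term \<Rightarrow> nat \<Rightarrow> star_term" where
  "star_square t 0 = Mul (Adj t) t"
| "star_square t (Suc k) = Mul (star_square t k) (star_square t k)"

lemma star_degree_square: "star_degree (star_square t k) = 2 ^ Suc k * star_degree t"
  by (induction k) auto

lemma norm_star_square: "norm (star_eval X (star_square t k)) = norm (star_eval X t) ^ 2 ^ Suc k"
proof (induction k)
  case 0
  show ?case by (simp add: cstar_identity)
next
  case (Suc k)
  have "adj (star_eval X (star_square t k)) = star_eval X (star_square t k)"
    by (induction k) (simp_all add: adj_mult adj_adj)
  then have "norm (star_eval X (star_square t (Suc k))) = (norm (star_eval X (star_square t k)))\<^sup>2"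
    using cstar_identity[of "star_eval X (star_square t k)"] by simp
  then show ?case by (simp add: Suc mult.commute flip: power_mult)
qed

lemma le_if_powers_le_quadratic:
  fixes x y d :: real
  assumes "0 \<le> x" "0 \<le> y" and le: "\<And>k. y ^ 2 ^ Suc k
    \<le> 4 * (real (2 ^ Suc k) * d + 2)\<^sup>2 * x ^ 2 ^ Suc k"
  shows "y \<le> x"
proof (rule ccontr)
  assume "\<not> y \<le> x"
  then have y: "y > 0" "x < y" using assms(1) by auto
  \<comment> \<open>The root distributes the decay over the two linear factors: (M d + 2)^2 (x /
    y)^M is the square of d M s^M + 2 s^M, which tends to 0.\<close>
  define s where "s = sqrt (x / y)"
  have s: "0 \<le> s" "s < 1" "s\<^sup>2 = x / y" using y assms(1) by (auto simp: s_def)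
  have l1: "(\<lambda>n. real n * s ^ n) \<longlonglongrightarrow> 0" using powser_times_n_limit_0[of s] s by simp
  have l2: "(\<lambda>n. s ^ n) \<longlonglongrightarrow> 0" using s by (intro LIMSEQ_power_zero) simp
  have "(\<lambda>n. 4 * (d * (real n * s ^ n) + 2 * s ^ n)\<^sup>2) \<longlonglongrightarrow> 4 * (d * 0 + 2 * 0)\<^sup>2"
    by (intro tendsto_intros l1 l2)
  then have "\<forall>\<^sub>F n in sequentially. 4 * (d * (real n * s ^ n) + 2 * s ^ n)\<^sup>2 < 1"
    by (rule order_tendstoD) simp
  then obtain N where N: "\<And>n. n \<ge> N \<Longrightarrow> 4 * (d * (real n * s ^ n) + 2 * s ^ n)\<^sup>2 < 1"
    by (auto simp: eventually_sequentially)
  define M :: nat where "M = 2 ^ Suc N"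
  have "N \<le> M" unfolding M_def using less_exp[of "Suc N"] by linarith
  then have "4 * (d * (real M * s ^ M) + 2 * s ^ M)\<^sup>2 < 1" by (rule N)
  moreover have "4 * (d * (real M * s ^ M) + 2 * s ^ M)\<^sup>2 = 4 * (real M * d + 2)\<^sup>2 * (s\<^sup>2) ^ M"
    by (simp add: power2_eq_square power_mult_distrib algebra_simps)
  ultimately have "4 * (real M * d + 2)\<^sup>2 * (x / y) ^ M < 1" by (simp add: s(3))
  then have "4 * (real M * d + 2)\<^sup>2 * x ^ M < y ^ M"
    using y(1) by (simp add: power_divide pos_divide_less_eq)
  with le[of N] show False by (simp add: M_def)
qed

text \<open>The constants in \<open>norm_star_eval_comparison\<close> grow only quadratically in the degree, so
  they disappear upon passing to \<open>(t\<^sup>* t) ^ 2 ^ k\<close>.\<close>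

lemma (in scaling_pair) norm_star_eval_le:
  assumes "X.shift_free \<longleftrightarrow> Y.shift_free"
  shows "norm (star_eval Y t) \<le> norm (star_eval X t)"
proof (rule le_if_powers_le_quadratic[where d = "real (star_degree t)"])
  fix k
  show "norm (star_eval Y t) ^ 2 ^ Suc k
      \<le> 4 * (real (2 ^ Suc k) * real (star_degree t) + 2)\<^sup>2 * norm (star_eval X t) ^ 2 ^ Suc k"
    using norm_star_eval_comparison[OF assms, of "star_square t k"]
    by (simp only: norm_star_square star_degree_square of_nat_mult)
qed auto

section \<open>Absolute values and non-proper scaling elements\<close>

lemma scaling_emb:
  assumes "scaling_element X" shows "scaling (emb X)"
proof
  show "adj (emb X) * emb X * emb X = emb X"
    using assms by (simp add: scaling_element_def flip: Unitize_simps)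
  show "adj (emb X) * emb X \<noteq> emb X * adj (emb X)"
    using assms by (simp add: scaling_element_def flip: Unitize_simps)
  show "0 \<in> spectrum (adj (emb X) * emb X)"
    using zero_in_spectrum_emb[of "adj X * X"] by (simp flip: Unitize_simps)
qed

lemma csqrt_eq_of_real_sqrt: "z = of_real (cmod z) \<Longrightarrow> csqrt z = of_real (sqrt (cmod z))"
  by (metis csqrt_of_real_nonneg Im_complex_of_real Re_complex_of_real norm_ge_zero)

context
  fixes X :: "'a::cstar_algebra"
  assumes X: "scaling_element X"
begin

interpretation x: scaling "emb X" by (rule scaling_emb[OF X])

lemma emb_gram: "emb (adj X * X) = x.h" "emb (X * adj X) = emb X * adj (emb X)"
  by (simp_all add: Unitize_simps)

lemma csqrt_calculus: "csqrt \<in> calculus_functions (adj X * X)" "csqrt \<in> calculus_functions (X * adj X)"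
proof -
  have "spectrum (adj X * X) \<subseteq> x.K" "spectrum (X * adj X) \<subseteq> x.K"
    using spectrum_emb[of "adj X * X"] spectrum_emb[of "X * adj X"] x.spectrum_range
    by (auto simp: emb_gram)
  then show "csqrt \<in> calculus_functions (adj X * X)" "csqrt \<in> calculus_functions (X * adj X)"
    using continuous_on_subset[OF x.continuous_on_csqrt_K] by (simp_all add: calculus_functions_def)
qed

lemma emb_absolute_value:
  "emb (absolute_value X) = cfc csqrt x.h"
  "emb (absolute_value (adj X)) = cfc csqrt (emb X * adj (emb X))"
  using apply_calculus_eq[OF _ csqrt_calculus(1)] apply_calculus_eq[OF _ csqrt_calculus(2)]
  by (simp_all add: absolute_value_def adj_mult adj_adj emb_gram)

lemma csqrt_real: "z \<in> x.K \<Longrightarrow> cnj (csqrt z) = csqrt z"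
  using csqrt_eq_of_real_sqrt[OF x.spectrum_h_real] by simp

lemma spectrum_emb_absolute_value:
  "spectrum (emb (absolute_value X)) = csqrt ` x.K"
  "spectrum (emb (absolute_value (adj X))) = csqrt ` x.K"
  unfolding emb_absolute_value
  using spectrum_cfc[OF x.h_self_adjoint x.continuous_on_csqrt_K]
    spectrum_cfc[OF x.range_self_adjoint] x.continuous_on_csqrt_K
      by (simp_all add: x.spectrum_range)

lemma absolute_value_self_adjoint:
  "adj (absolute_value X) = absolute_value X" "adj (absolute_value (adj X))
    = absolute_value (adj X)"
proof -
  have "adj (emb (absolute_value X)) = emb (absolute_value X)"
    "adj (emb (absolute_value (adj X))) = emb (absolute_value (adj X))"
    unfolding emb_absolute_value using x.continuous_on_csqrt_K csqrt_real
    by (auto intro!: cfc_real_self_adjoint x.h_self_adjoint x.range_self_adjoint simp: x.spectrum_range)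
  then show "adj (absolute_value X) = absolute_value X" "adj (absolute_value (adj X))
    = absolute_value (adj X)"
    by (simp_all flip: Unitize_simps)
qed

text \<open>Otherwise \<open>X * adj X\<close> is invertible in a unital algebra, and cancelling a
  right inverse of \<open>X\<close> gives first \<open>adj X * X = e\<close>, then
  \<open>X * adj X = e\<close>, against non-normality. The absolute value of \<open>X\<close> itself
  behaves differently: for a non-unitary isometry it is the unit.\<close>

lemma zero_in_spectrum_absolute_value: "0 \<in> spectrum (absolute_value (adj X))"
proof (rule ccontr)
  define a where "a = absolute_value (adj X)"
  assume "0 \<notin> spectrum (absolute_value (adj X))"
  then have 0: "0 \<notin> spectrum a" by (simp add: a_def)
  obtain e :: 'a where e: "is_unit_of_algebra e"
    using 0 spectrum_nonunital zero_in_spectrum_emb[of a] by metis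
  then have u: "e * x = x" "x * e = x" for x by (auto simp: is_unit_of_algebra_def)
  obtain w where w: "- a * w = e"
    using 0 unfolding spectrum_with_unit[OF e] by (auto simp: invertible_wrt_def)
  have "emb (a * a) = cfc (\<lambda>z. csqrt z * csqrt z) (emb X * adj (emb X))"
    using x.continuous_on_csqrt_K
    by (simp add: Unitize_simps a_def emb_absolute_value cfc_mult[OF x.range_self_adjoint] x.spectrum_range)
  also have "\<dots> = emb (X * adj X)"
    using cfc_id[OF x.range_self_adjoint] by (simp add: emb_gram flip: power2_eq_square)
  finally have aa: "a * a = X * adj X" by simp
  have "X * adj X * (w * w) = a * (a * w) * w" by (simp add: aa[symmetric] mult.assoc)
  also have "a * w = - e" using w by (simp add: minus_equation_iff)
  finally have 1: "X * adj X * (w * w) = e" using w by (simp add: u)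
  have hX: "adj X * X * X = X" using X by (simp add: scaling_element_def)
  have "adj X * X = adj X * X * (X * adj X * (w * w))" by (simp only: 1 u)
  also have "\<dots> = (adj X * X * X) * (adj X * (w * w))" by (simp only: mult.assoc)
  also have "\<dots> = e" unfolding hX using 1 by (simp only: mult.assoc)
  finally have h: "adj X * X = e" .
  have "X * adj X = X * adj X * (X * adj X * (w * w))" by (simp only: 1 u)
  also have "\<dots> = X * (adj X * X) * (adj X * (w * w))" by (simp only: mult.assoc)
  also have "\<dots> = e" unfolding h u using 1 by (simp only: mult.assoc)
  finally show False using X h by (simp add: scaling_element_def)
qed

lemma spectrum_absolute_value: "spectrum (absolute_value (adj X)) = csqrt ` x.K"
  using spectrum_emb_absolute_value(2) zero_in_spectrum_absolute_value
  by (simp add: spectrum_emb insert_absorb)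

text \<open>Squaring is a bijection from the spectrum of the absolute value to that of
  \<open>h\<close> and fixes 0 and 1. Under composition with \<open>csqrt\<close> the two indicator
  functions become the spectral projection of \<open>h\<close> at 1 and the range projection of
  \<open>X\<close>.\<close>

lemma nonproper_iff_shift_free: "nonproper X \<longleftrightarrow> x.shift_free"
proof -
  define S where "S = csqrt ` x.K"
  have S: "spectrum (absolute_value (adj X)) = S" by (simp add: S_def spectrum_absolute_value)
  have c01: "csqrt z = 0 \<longleftrightarrow> z = 0" "csqrt z = 1 \<longleftrightarrow> z = 1" for z
    by (auto simp: csqrt_eq_1) (metis power2_csqrt one_power2)?
  have S': "S - {0, 1} = csqrt ` (x.K - {0, 1})" "x.K - {0, 1} = (\<lambda>w. w\<^sup>2) ` (S - {0, 1})"
  proof -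
    show 1: "S - {0, 1} = csqrt ` (x.K - {0, 1})" using c01 by (auto simp: S_def)
    show "x.K - {0, 1} = (\<lambda>w. w\<^sup>2) ` (S - {0, 1})" unfolding 1 image_image by simp
  qed
  have cpt: "compact (S - {0, 1}) \<longleftrightarrow> compact (x.K - {0, 1})"
  proof
    assume "compact (S - {0, 1})"
    then show "compact (x.K - {0, 1})"
      unfolding S'(2) by (intro compact_continuous_image continuous_intros)
  next
    assume "compact (x.K - {0, 1})"
    then show "compact (S - {0, 1})"
      unfolding S'(1) by (intro compact_continuous_image continuous_on_subset[OF x.continuous_on_csqrt_K]) auto
  qed
  have "apply_calculus (indicator {1}) (absolute_value X)
      = apply_calculus (indicator (S - {0})) (absolute_value (adj X)) \<longleftrightarrow>
      cfc (indicator {1}) x.h = emb X * cfc inverse x.h * adj (emb X)" if c: "compact (x.K - {0, 1})"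
  proof -
    have cl: "closed (S - {0, 1})" using c cpt compact_imp_closed by blast
    have "0 \<in> S" "1 \<in> S" using x.zero_in_spectrum x.one_in_spectrum c01 by (force simp: S_def)+
    note split = continuous_on_split_01[OF this cl]
    have i1: "continuous_on S (indicator {1} :: complex \<Rightarrow> complex)"
      using continuous_on_cong[of "S - {0,1}" "S - {0,1}" "indicator {1}" "\<lambda>z. 0 :: complex"]
      by (intro split) auto
    have i2: "continuous_on S (indicator (S - {0}) :: complex \<Rightarrow> complex)"
      using continuous_on_cong[of "S - {0,1}" "S - {0,1}" "indicator (S - {0})" "\<lambda>z. 1 :: complex"]
      by (intro split) auto
    have "spectrum (absolute_value X) \<subseteq> S"
      using spectrum_emb_absolute_value(1) by (auto simp: S_def spectrum_emb)
    then have f1: "(indicator {1} :: complex \<Rightarrow> complex) \<in> calculus_functions (absolute_value X)"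
      using continuous_on_subset[OF i1] by (simp add: calculus_functions_def)
    have f2: "(indicator (S - {0}) :: complex \<Rightarrow> complex) \<in> calculus_functions (absolute_value (adj X))"
      using i2 by (simp add: calculus_functions_def S)
    have "emb (apply_calculus (indicator {1}) (absolute_value X))
      = cfc (\<lambda>z. indicator {1} (csqrt z)) x.h"
      unfolding apply_calculus_eq[OF absolute_value_self_adjoint(1) f1] emb_absolute_value
      using x.continuous_on_csqrt_K csqrt_real i1 by (intro cfc_compose x.h_self_adjoint)
        (auto simp: S_def)
    also have "\<dots> = cfc (indicator {1}) x.h"
      by (rule cfc_cong) (simp add: indicator_def c01)
    finally have e1: "emb (apply_calculus (indicator {1}) (absolute_value X))
      = cfc (indicator {1}) x.h" .
    have "emb (apply_calculus (indicator (S - {0})) (absolute_value (adj X)))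
        = cfc (\<lambda>z. indicator (S - {0}) (csqrt z)) (emb X * adj (emb X))"
      unfolding apply_calculus_eq[OF absolute_value_self_adjoint(2) f2] emb_absolute_value
      using x.continuous_on_csqrt_K csqrt_real i2
      by (intro cfc_compose x.range_self_adjoint) (auto simp: S_def x.spectrum_range)
    \<comment> \<open>With \<open>inverse 0 = 0\<close> this is the indicator of the nonzero points,
      written with a factor \<open>z\<close> as \<open>X_cfc_adj_X\<close> requires.\<close>
    also have "\<dots> = cfc (\<lambda>z. z * inverse z) (emb X * adj (emb X))"
      by (rule cfc_cong) (auto simp: indicator_def S_def x.spectrum_range)
    also have "\<dots> = emb X * cfc inverse x.h * adj (emb X)"
      by (rule x.X_cfc_adj_X[symmetric, OF x.continuous_on_isolated(2)[OF c]])
    finally have e2: "emb (apply_calculus (indicator (S - {0})) (absolute_value (adj X)))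
        = emb X * cfc inverse x.h * adj (emb X)" .
    show ?thesis unfolding e1[symmetric] e2[symmetric] by simp
  qed
  then show ?thesis
    unfolding nonproper_def x.shift_free_def S cpt using X by blast
qed

end

lemma spectrum_absolute_value_eq_iff:
  assumes X: "scaling_element (X :: 'a::cstar_algebra)"
    and Y: "scaling_element (Y :: 'b::cstar_algebra)"
  shows "spectrum (absolute_value (adj X)) = spectrum (absolute_value (adj Y)) \<longleftrightarrow>
    spectrum (adj (emb X) * emb X) = spectrum (adj (emb Y) * emb Y)"
proof -
  have "A = (\<lambda>w. w\<^sup>2) ` csqrt ` A" for A by (simp add: image_image)
  then show ?thesis unfolding spectrum_absolute_value[OF X] spectrum_absolute_value[OF Y] by metis
qed

section \<open>Norms of *-polynomials as a complete invariant\<close>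

definition same_norms :: "'a::cstar_algebra \<Rightarrow> 'b::cstar_algebra \<Rightarrow> bool" where
  "same_norms X Y \<longleftrightarrow> (\<forall>t. norm (star_eval X t) = norm (star_eval Y t))"

lemma same_norms_emb: "same_norms (emb X) (emb Y) \<longleftrightarrow> same_norms X Y"
  by (simp add: same_norms_def star_eval_emb)

lemma same_norms_sym: "same_norms X Y \<Longrightarrow> same_norms Y X"
  by (simp add: same_norms_def)

lemma same_normsI:
  assumes "scaling X" "scaling Y" "spectrum (adj X * X) = spectrum (adj Y * Y)"
    and "scaling.shift_free X \<longleftrightarrow> scaling.shift_free Y"
  shows "same_norms X Y"
  unfolding same_norms_def
proof
  fix t
  interpret XY: scaling_pair X Y by (intro scaling_pair.intro scaling_pair_axioms.intro assms)
  interpret YX: scaling_pair Y X by (intro scaling_pair.intro scaling_pair_axioms.intro assms assms(3)[symmetric])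
  show "norm (star_eval X t) = norm (star_eval Y t)"
    using XY.norm_star_eval_le[OF assms(4), of t] YX.norm_star_eval_le[OF assms(4)[symmetric], of t]
      by simp
qed

text \<open>The constant coefficient is 0 because terms have no unit; the point is that one term
  serves for both elements.\<close>

lemma poly_term:
  fixes X :: "'a::cstar_algebra_1" and Y :: "'b::cstar_algebra_1"
  shows "\<exists>t. star_eval X t = peval (pCons 0 q) (star_eval X s) \<and> star_eval Y t
    = peval (pCons 0 q) (star_eval Y s)"
proof (induction q)
  case 0
  show ?case by (intro exI[of _ "Scale 0 Gen"]) simp
next
  case (pCons c q)
  then obtain t where "star_eval X t = peval (pCons 0 q) (star_eval X s)"
    "star_eval Y t = peval (pCons 0 q) (star_eval Y s)" by blast
  then show ?case
    by (intro exI[of _ "Add (Scale c s) (Mul s t)"]) (simp add: distrib_left mult_scaleC_right)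
qed

text \<open>A bump at a point of the first spectrum that misses the second gives 0 for
  \<open>Y\<close> but not for \<open>X\<close>. It is approximated by polynomials on both spectra
  at once, and the extra factor \<open>z\<close> makes them expressible by terms.\<close>

lemma same_norms_spectrum:
  assumes "scaling X" "scaling Y" "same_norms X Y"
  shows "spectrum (adj X * X) \<subseteq> spectrum (adj Y * Y)"
proof
  interpret X: scaling X by fact
  interpret Y: scaling Y by fact
  fix z assume z: "z \<in> X.K"
  show "z \<in> Y.K"
  proof (rule ccontr)
    assume nz: "z \<notin> Y.K"
    then have z0: "z \<noteq> 0" using Y.zero_in_spectrum by auto
    define \<delta> where "\<delta> = infdist z Y.K"
    have "Y.K \<noteq> {}" using Y.zero_in_spectrum by auto
    then have \<delta>: "\<delta> > 0"
      unfolding \<delta>_def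
      by (intro infdist_pos_not_in_closed compact_imp_closed compact_spectrum nz)
    define g where "g w = complex_of_real (max 0 (1 - cmod (w - z) / \<delta>))" for w
    have g: "continuous_on A g" for A unfolding g_def[abs_def] using \<delta>
      by (intro continuous_intros) auto
    have g0: "g w = 0" if "w \<in> Y.K" for w
      using infdist_le[OF that, of z] \<delta>
        by (simp add: g_def \<delta>_def dist_norm norm_minus_commute pos_le_divide_eq)
    obtain p where p: "poly_limit (X.K \<union> Y.K) p g"
      using polynomial_approximation[OF _ _ g, of "X.K \<union> Y.K"] compact_spectrum
        X.spectrum_h_nonneg Y.spectrum_h_nonneg by (metis UnE compact_Un)
    have le: "cmod (z * poly (p n) z) \<le> norm (peval (p n) Y.h) * norm Y.h" for n
    proof -
      obtain t where "star_eval X t = peval (pCons 0 (p n)) X.h" "star_eval Y t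
        = peval (pCons 0 (p n)) Y.h"
        using poly_term[of X "p n" "Mul (Adj Gen) Gen" Y] by auto
      then have "norm (peval (pCons 0 (p n)) X.h) = norm (peval (pCons 0 (p n)) Y.h)"
        using assms(3) unfolding same_norms_def by metis
      also have "\<dots> \<le> norm (peval (p n) Y.h) * norm Y.h"
        using norm_mult_ineq[of Y.h "peval (p n) Y.h"] by (simp add: mult.commute)
      finally show ?thesis using norm_peval_ge[OF z, of "pCons 0 (p n)"] by simp
    qed
    have "(\<lambda>n. peval (p n) Y.h) \<longlonglongrightarrow> cfc g Y.h"
      using uniform_limit_on_subset[OF p, of Y.K] by (intro cfc_limit Y.h_self_adjoint) auto
    moreover have "cfc g Y.h = 0"
      using cfc_cong[of Y.h g "\<lambda>_. 0"] g0 by simp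
    ultimately have "(\<lambda>n. norm (peval (p n) Y.h) * norm Y.h) \<longlonglongrightarrow> 0"
      by (intro tendsto_mult_left_zero tendsto_norm_zero) simp
    moreover have "(\<lambda>n. cmod (z * poly (p n) z)) \<longlonglongrightarrow> cmod (z * g z)"
      using z by (intro tendsto_intros tendsto_uniform_limitI[OF p]) auto
    ultimately have "cmod (z * g z) \<le> 0" using LIMSEQ_le le by blast
    with z0 show False by (simp add: g_def)
  qed
qed

text \<open>The difference of the two sides of the shift-free equation is a limit of *-polynomials
  that are the same for \<open>X\<close> and \<open>Y\<close>, so its norm is the same for
  both.\<close>

lemma same_norms_shift_free:
  assumes "scaling X" "scaling Y" "same_norms X Y" and K: "spectrum (adj X * X)
    = spectrum (adj Y * Y)"
    and sf: "scaling.shift_free X"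
  shows "scaling.shift_free Y"
proof -
  interpret X: scaling X by fact
  interpret Y: scaling Y by fact
  have c: "compact (X.K - {0, 1})" "compact (Y.K - {0, 1})" using sf K
    by (simp_all add: X.shift_free_def)
  obtain p where p: "poly_limit X.K p (indicator {1})"
    using cfc_approximation[OF X.h_self_adjoint X.continuous_on_isolated(1)[OF c(1)]] by blast
  obtain q where q: "poly_limit X.K q inverse"
    using cfc_approximation[OF X.h_self_adjoint X.continuous_on_isolated(2)[OF c(1)]] by blast
  \<comment> \<open>The factor \<open>z\<close> removes the constant term and does not change the
    limit, since the indicator lives at z = 1.\<close>
  have p': "uniform_limit X.K (\<lambda>n. poly (pCons 0 (p n))) (indicator {1}) sequentially"
  proof -
    have "uniform_limit X.K (\<lambda>n z. z * poly (p n) z) (\<lambda>z. z * indicator {1} z) sequentially"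
      using bounded_image_spectrum[OF X.h_self_adjoint X.continuous_on_isolated(1)[OF c(1)]] compact_spectrum[of X.h]
      by (intro uniform_lim_mult p uniform_limit_const) (auto simp: compact_imp_bounded)
    moreover have "(\<lambda>z. z * indicator {1} z) = (indicator {1} :: complex \<Rightarrow> complex)"
      by (auto simp: indicator_def fun_eq_iff)
    ultimately show ?thesis by (simp add: poly_pCons[abs_def])
  qed
  have eq: "norm (peval (pCons 0 (p n)) X.h - X * peval (q n) X.h * adj X)
      = norm (peval (pCons 0 (p n)) Y.h - Y * peval (q n) Y.h * adj Y)" for n
  proof -
    obtain s where s: "star_eval X s = peval (pCons 0 (p n)) X.h" "star_eval Y s
      = peval (pCons 0 (p n)) Y.h"
      using poly_term[of X "p n" "Mul (Adj Gen) Gen" Y] by auto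
    obtain t where t: "star_eval X t = peval (pCons 0 (q n)) (X * adj X)" "star_eval Y t
      = peval (pCons 0 (q n)) (Y * adj Y)"
      using poly_term[of X "q n" "Mul Gen (Adj Gen)" Y] by auto
    have "norm (star_eval X (Add s (Scale (- 1) t))) = norm (star_eval Y (Add s (Scale (- 1) t)))"
      using assms(3) unfolding same_norms_def by blast
    then show ?thesis by (simp only: star_eval.simps s t X.X_peval_adj_X Y.X_peval_adj_X scaleC_minus_left scaleC_1 diff_conv_add_uminus)
  qed
  have lim: "(\<lambda>n. norm (peval (pCons 0 (p n)) X.h - X * peval (q n) X.h * adj X))
      \<longlonglongrightarrow> norm (cfc (indicator {1}) X.h - X * cfc inverse X.h * adj X)"
    by (intro tendsto_intros cfc_limit X.h_self_adjoint p' q)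
  have "(\<lambda>n. norm (peval (pCons 0 (p n)) Y.h - Y * peval (q n) Y.h * adj Y))
      \<longlonglongrightarrow> norm (cfc (indicator {1}) Y.h - Y * cfc inverse Y.h * adj Y)"
    using p' q unfolding K by (intro tendsto_intros cfc_limit Y.h_self_adjoint)
  with lim have "norm (cfc (indicator {1}) Y.h - Y * cfc inverse Y.h * adj Y)
      = norm (cfc (indicator {1}) X.h - X * cfc inverse X.h * adj X)"
    unfolding eq by (rule LIMSEQ_unique[rotated])
  then show ?thesis using sf c by (simp add: X.shift_free_def Y.shift_free_def)
qed

lemma same_norms_iff:
  assumes X: "scaling_element X" and Y: "scaling_element Y"
  shows "same_norms X Y \<longleftrightarrow> spectrum (absolute_value (adj X)) = spectrum (absolute_value (adj Y))
    \<and> (nonproper X \<longleftrightarrow> nonproper Y)"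
  unfolding spectrum_absolute_value_eq_iff[OF X Y] nonproper_iff_shift_free[OF X] nonproper_iff_shift_free[OF Y]
    same_norms_emb[of X Y, symmetric]
  using same_norms_spectrum[OF scaling_emb[OF X] scaling_emb[OF Y]]
    same_norms_spectrum[OF scaling_emb[OF Y] scaling_emb[OF X]]
    same_norms_shift_free[OF scaling_emb[OF X] scaling_emb[OF Y]]
    same_norms_shift_free[OF scaling_emb[OF Y] scaling_emb[OF X]]
    same_normsI[OF scaling_emb[OF X] scaling_emb[OF Y]] same_norms_sym
  by (smt (verit, ccfv_threshold) subset_antisym)

section \<open>Isomorphisms of the generated algebras\<close>

lemma star_eval_in_subalgebra:
  assumes "star_subalgebra S" "X \<in> S" shows "star_eval X t \<in> S"
  using assms by (induction t) (auto simp: star_subalgebra_def)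

lemma closure_range_star_eval:
  "x \<in> closure (range (star_eval X)) \<longleftrightarrow> (\<exists>t. (\<lambda>n. star_eval X (t n)) \<longlonglongrightarrow> x)"
proof
  assume "x \<in> closure (range (star_eval X))"
  then obtain f where f: "\<And>n. f n \<in> range (star_eval X)" "f \<longlonglongrightarrow> x" by (auto simp: closure_sequential)
  have "\<exists>t. f n = star_eval X t" for n using f(1)[of n] by (rule rangeE) (rule exI)
  then have "f n = star_eval X (SOME t. f n = star_eval X t)" for n by (rule someI_ex)
  with f(2) have "(\<lambda>n. star_eval X (SOME t. f n = star_eval X t)) \<longlonglongrightarrow> x" by (simp only:)
  then show "\<exists>t. (\<lambda>n. star_eval X (t n)) \<longlonglongrightarrow> x"
    by (rule exI[where x = "\<lambda>n. SOME t. f n = star_eval X t"])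
next
  assume "\<exists>t. (\<lambda>n. star_eval X (t n)) \<longlonglongrightarrow> x"
  then obtain t where "(\<lambda>n. star_eval X (t n)) \<longlonglongrightarrow> x" by blast
  then show "x \<in> closure (range (star_eval X))"
    unfolding closure_sequential by (intro exI[of _ "\<lambda>n. star_eval X (t n)"]) simp
qed

lemma cstar_generated_iff: "x \<in> cstar_generated X \<longleftrightarrow> (\<exists>t. (\<lambda>n. star_eval X (t n)) \<longlonglongrightarrow> x)"
proof -
  let ?C = "closure (range (star_eval X))"
  have "star_subalgebra ?C"
    unfolding star_subalgebra_def
  proof (intro conjI ballI allI)
    show "0 \<in> ?C"
      unfolding closure_range_star_eval by (rule exI[of _ "\<lambda>n. Scale 0 Gen"]) simp
    fix x assume "x \<in> ?C"
    then obtain s where s: "(\<lambda>n. star_eval X (s n)) \<longlonglongrightarrow> x" unfolding closure_range_star_eval by blast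
    show "c *\<^sub>C x \<in> ?C" for c
      unfolding closure_range_star_eval using tendsto_scaleC[OF tendsto_const s, of c]
      by (intro exI[of _ "\<lambda>n. Scale c (s n)"]) simp
    show "adj x \<in> ?C"
      unfolding closure_range_star_eval using tendsto_adj[OF s]
      by (intro exI[of _ "\<lambda>n. Adj (s n)"]) simp
    fix y assume "y \<in> ?C"
    then obtain t where t: "(\<lambda>n. star_eval X (t n)) \<longlonglongrightarrow> y" unfolding closure_range_star_eval by blast
    show "x + y \<in> ?C"
      unfolding closure_range_star_eval using tendsto_add[OF s t]
      by (intro exI[of _ "\<lambda>n. Add (s n) (t n)"]) simp
    show "x * y \<in> ?C"
      unfolding closure_range_star_eval using tendsto_mult[OF s t]
      by (intro exI[of _ "\<lambda>n. Mul (s n) (t n)"]) simp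
  qed
  then have "cstar_generated X = ?C"
    unfolding cstar_generated_def
  proof (intro hull_unique)
    have "star_eval X Gen \<in> ?C" using closure_subset[of "range (star_eval X)"] by blast
    then show "{X} \<subseteq> ?C" by simp
    fix S assume S: "{X} \<subseteq> S" "star_subalgebra S \<and> closed S"
    then show "?C \<subseteq> S"
      by (intro closure_minimal) (auto intro: star_eval_in_subalgebra)
  qed simp
  then show ?thesis by (simp add: closure_range_star_eval)
qed

lemma star_subalgebra_cstar_generated:
  "star_subalgebra (cstar_generated X)" "closed (cstar_generated X)" "X \<in> cstar_generated X"
proof -
  have "star_subalgebra (cstar_generated X) \<and> closed (cstar_generated X)"
    unfolding cstar_generated_def
  proof (rule hull_in)
    fix T :: "'a set set" assume T: "\<forall>S\<in>T. star_subalgebra S \<and> closed S"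
    then show "star_subalgebra (\<Inter>T) \<and> closed (\<Inter>T)"
      by (auto simp: star_subalgebra_def closed_Inter)
  qed
  then show "star_subalgebra (cstar_generated X)" "closed (cstar_generated X)" by auto
  show "X \<in> cstar_generated X" unfolding cstar_generated_def using hull_inc by fastforce
qed

text \<open>The graph of the isomorphism to be constructed: pairs of limits along the same terms.
  Its symmetry yields injectivity and surjectivity from well-definedness and totality with the
  elements exchanged.\<close>

definition star_limit :: "'a::cstar_algebra \<Rightarrow> 'b::cstar_algebra \<Rightarrow> 'a \<Rightarrow> 'b \<Rightarrow> bool" where
  "star_limit X Y x y \<longleftrightarrow> (\<exists>t. (\<lambda>n. star_eval X (t n)) \<longlonglongrightarrow> x \<and> (\<lambda>n. star_eval Y (t n)) \<longlonglongrightarrow> y)"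

lemma star_limit_sym: "star_limit X Y x y \<longleftrightarrow> star_limit Y X y x"
  by (auto simp: star_limit_def)

lemma same_norms_diff:
  assumes "same_norms X Y"
  shows "norm (star_eval X s - star_eval X t) = norm (star_eval Y s - star_eval Y t)"
proof -
  have "norm (star_eval X (Add s (Scale (- 1) t))) = norm (star_eval Y (Add s (Scale (- 1) t)))"
    using assms by (simp only: same_norms_def)
  then show ?thesis by simp
qed

lemma star_limit_unique:
  assumes "same_norms X Y" "star_limit X Y x y" "star_limit X Y x y'" shows "y = y'"
proof -
  obtain s t where s: "(\<lambda>n. star_eval X (s n)) \<longlonglongrightarrow> x" "(\<lambda>n. star_eval Y (s n)) \<longlonglongrightarrow> y"
    and t: "(\<lambda>n. star_eval X (t n)) \<longlonglongrightarrow> x" "(\<lambda>n. star_eval Y (t n)) \<longlonglongrightarrow> y'"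
    using assms unfolding star_limit_def by blast
  have "(\<lambda>n. norm (star_eval X (s n) - star_eval X (t n))) \<longlonglongrightarrow> norm (x - x)"
    by (intro tendsto_intros s t)
  moreover have "(\<lambda>n. norm (star_eval X (s n) - star_eval X (t n))) \<longlonglongrightarrow> norm (y - y')"
    unfolding same_norms_diff[OF assms(1)] by (intro tendsto_intros s t)
  ultimately have "norm (x - x) = norm (y - y')" by (rule LIMSEQ_unique)
  then show ?thesis by simp
qed

lemma star_limit_exists:
  assumes "same_norms X Y" "x \<in> cstar_generated X" shows "\<exists>y\<in>cstar_generated Y. star_limit X Y x y"
proof -
  obtain t where t: "(\<lambda>n. star_eval X (t n)) \<longlonglongrightarrow> x" using assms(2) by (auto simp: cstar_generated_iff)
  then have "Cauchy (\<lambda>n. star_eval X (t n))" by (rule LIMSEQ_imp_Cauchy)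
  then have "Cauchy (\<lambda>n. star_eval Y (t n))"
    by (simp add: Cauchy_iff same_norms_diff[OF assms(1)])
  then obtain y where y: "(\<lambda>n. star_eval Y (t n)) \<longlonglongrightarrow> y"
    by (auto simp: Cauchy_convergent_iff convergent_def)
  have "star_limit X Y x y" unfolding star_limit_def by (intro exI[of _ t] conjI t y)
  moreover have "y \<in> cstar_generated Y" unfolding cstar_generated_iff by (rule exI[of _ t]) (rule y)
  ultimately show ?thesis by blast
qed

lemma same_norms_imp_isomorphism:
  assumes N: "same_norms X Y"
  shows "\<exists>\<phi>. star_isomorphism (cstar_generated X) (cstar_generated Y) \<phi> \<and> \<phi> X = Y"
proof -
  define \<phi> where "\<phi> x = (SOME y. star_limit X Y x y)" for x
  have lim: "star_limit X Y x (\<phi> x)" if "x \<in> cstar_generated X" for x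
    using star_limit_exists[OF N that] unfolding \<phi>_def by (metis someI_ex)
  have eq: "\<phi> x = y" if "star_limit X Y x y" for x y
    using star_limit_unique[OF N that] that unfolding \<phi>_def by (metis someI_ex)
  have inj: "x = x'" if "star_limit X Y x y" "star_limit X Y x' y" for x x' y
    using star_limit_unique[OF same_norms_sym[OF N]] that star_limit_sym by metis
  have "bij_betw \<phi> (cstar_generated X) (cstar_generated Y)"
    unfolding bij_betw_def
  proof
    show "inj_on \<phi> (cstar_generated X)" by (metis inj_onI lim inj)
    show "\<phi> ` cstar_generated X = cstar_generated Y"
    proof (intro equalityI subsetI)
      fix y assume "y \<in> \<phi> ` cstar_generated X"
      then show "y \<in> cstar_generated Y" using star_limit_exists[OF N] eq by (metis imageE)
    next
      fix y assume "y \<in> cstar_generated Y"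
      then obtain x where "x \<in> cstar_generated X" "star_limit X Y x y"
        using star_limit_exists[OF same_norms_sym[OF N]] star_limit_sym by metis
      then show "y \<in> \<phi> ` cstar_generated X" using eq by (metis imageI)
    qed
  qed
  moreover have "\<phi> (x + y) = \<phi> x + \<phi> y \<and> \<phi> (x * y) = \<phi> x * \<phi> y"
    if xy: "x \<in> cstar_generated X" "y \<in> cstar_generated X" for x y
  proof -
    obtain s t where s: "(\<lambda>n. star_eval X (s n)) \<longlonglongrightarrow> x" "(\<lambda>n. star_eval Y (s n)) \<longlonglongrightarrow> \<phi> x"
      and t: "(\<lambda>n. star_eval X (t n)) \<longlonglongrightarrow> y" "(\<lambda>n. star_eval Y (t n)) \<longlonglongrightarrow> \<phi> y"
      using lim[OF xy(1)] lim[OF xy(2)] unfolding star_limit_def by blast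
    have "star_limit X Y (x + y) (\<phi> x + \<phi> y)"
      unfolding star_limit_def using tendsto_add[OF s(1) t(1)] tendsto_add[OF s(2) t(2)]
      by (intro exI[of _ "\<lambda>n. Add (s n) (t n)"]) simp
    moreover have "star_limit X Y (x * y) (\<phi> x * \<phi> y)"
      unfolding star_limit_def using tendsto_mult[OF s(1) t(1)] tendsto_mult[OF s(2) t(2)]
      by (intro exI[of _ "\<lambda>n. Mul (s n) (t n)"]) simp
    ultimately show ?thesis using eq by blast
  qed
  moreover have "\<phi> (c *\<^sub>C x) = c *\<^sub>C \<phi> x" "\<phi> (adj x) = adj (\<phi> x)" if x: "x \<in> cstar_generated X"
    for c x
  proof -
    obtain s where s: "(\<lambda>n. star_eval X (s n)) \<longlonglongrightarrow> x" "(\<lambda>n. star_eval Y (s n)) \<longlonglongrightarrow> \<phi> x"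
      using lim[OF x] unfolding star_limit_def by blast
    have "star_limit X Y (c *\<^sub>C x) (c *\<^sub>C \<phi> x)"
      unfolding star_limit_def
      using tendsto_scaleC[OF tendsto_const s(1), of c] tendsto_scaleC[OF tendsto_const s(2), of c]
      by (intro exI[of _ "\<lambda>n. Scale c (s n)"]) simp
    then show "\<phi> (c *\<^sub>C x) = c *\<^sub>C \<phi> x" by (rule eq)
    have "star_limit X Y (adj x) (adj (\<phi> x))"
      unfolding star_limit_def using tendsto_adj[OF s(1)] tendsto_adj[OF s(2)]
      by (intro exI[of _ "\<lambda>n. Adj (s n)"]) simp
    then show "\<phi> (adj x) = adj (\<phi> x)" by (rule eq)
  qed
  ultimately have "star_isomorphism (cstar_generated X) (cstar_generated Y) \<phi>"
    unfolding star_isomorphism_def by blast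
  moreover have "star_limit X Y X Y"
    unfolding star_limit_def by (intro exI[of _ "\<lambda>n. Gen"]) simp
  then have "\<phi> X = Y" by (rule eq)
  ultimately show ?thesis by blast
qed

text \<open>The Neumann series of y / \<mu> without its zeroth term: all its partial sums lie in
  \<open>S\<close>, which need not contain a unit.\<close>

lemma quasi_inverse_in_subalgebra:
  assumes S: "star_subalgebra S" "closed S" and y: "y \<in> S" "norm y < cmod \<mu>"
  obtains w where "w \<in> S" "\<mu> *\<^sub>C w = y + y * w" "\<mu> *\<^sub>C w = y + w * y"
proof -
  have mu0: "\<mu> \<noteq> 0" using y(2) norm_ge_zero[of y] by auto
  define v where "v = inverse \<mu> *\<^sub>C y"
  have vS: "v \<in> S" using S y by (simp add: v_def star_subalgebra_def)
  have "norm (emb v) < 1"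
    using y(2) mu0 by (simp add: v_def norm_scaleC norm_inverse flip: divide_inverse_commute)
  note ni = neumann_inverse[OF this] and sm = complete_algebra_summable_geometric[OF this]
  have pw: "\<exists>x\<in>S. emb v ^ Suc n = emb x" for n
  proof (induction n)
    case 0
    show ?case using vS by (intro bexI[of _ v]) auto
  next
    case (Suc n)
    then obtain x where "x \<in> S" "emb v ^ Suc n = emb x" by blast
    then show ?case using vS S by (intro bexI[of _ "v * x"])
      (auto simp: Unitize_simps star_subalgebra_def)
  qed
  then obtain x where x: "\<And>n. x n \<in> S" "\<And>n. emb v ^ Suc n = emb (x n)" by metis
  have ps: "(\<Sum>n<N. x n) \<in> S" for N
    using S x by (induction N) (auto simp: star_subalgebra_def add.commute)
  have emb_sum: "emb (\<Sum>n<N. x n) = (\<Sum>n<N. emb (x n))" for N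
    by (induction N) (simp_all add: Unitize_simps)
  define s where "s = (\<Sum>n. emb v ^ n)"
  have "(\<lambda>n. emb v ^ Suc n) sums (s - 1)"
    using summable_sums[OF sm] unfolding s_def by (subst sums_Suc_iff) simp
  then have lim: "(\<lambda>N. emb (\<Sum>n<N. x n)) \<longlonglongrightarrow> s - 1"
    unfolding sums_def x(2) emb_sum .
  have "(\<lambda>N. scal (emb (\<Sum>n<N. x n))) \<longlonglongrightarrow> scal (s - 1)" by (intro tendsto_scal lim)
  then have s0: "scal (s - 1) = 0" by (simp add: LIMSEQ_const_iff)
  define w where "w = vec (s - 1)"
  have w: "emb w = s - 1" using s0 unfolding w_def by (intro unitization.expand) simp
  have "(\<lambda>N. norm (emb ((\<Sum>n<N. x n) - w))) \<longlonglongrightarrow> 0"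
    unfolding Unitize_simps w by (rule tendsto_norm_zero[OF LIM_zero[OF lim]])
  then have "(\<lambda>N. norm ((\<Sum>n<N. x n) - w)) \<longlonglongrightarrow> 0" by (simp only: norm_Unitize_0)
  then have "(\<lambda>N. (\<Sum>n<N. x n)) \<longlonglongrightarrow> w"
    by (rule LIM_zero_cancel[OF tendsto_norm_zero_cancel])
  then have wS: "w \<in> S" using ps by (rule closed_sequentially[OF S(2), rotated])
  have "emb w = emb v + emb v * emb w" "emb w = emb v + emb w * emb v"
    using ni unfolding w s_def[symmetric] by (simp_all add: algebra_simps)
  then have "w = v + v * w" "w = v + w * v" by (simp_all flip: Unitize_simps)
  then have "\<mu> *\<^sub>C w = \<mu> *\<^sub>C (v + v * w)" "\<mu> *\<^sub>C w = \<mu> *\<^sub>C (v + w * v)" by simp_all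
  then have "\<mu> *\<^sub>C w = y + y * w" "\<mu> *\<^sub>C w = y + w * y"
    using mu0 by (simp_all add: v_def scaleC_add_right scaleC_scaleC mult_scaleC)
  with wS show ?thesis by (rule that)
qed

text \<open>If the norm increased, the image of \<open>adj x * x\<close> would have a spectral value
  \<mu> of modulus larger than the norm of \<open>adj x * x\<close>. But at such \<mu> that element
  has a quasi-inverse inside \<open>S\<close>, which \<phi> carries to one for the image.\<close>

lemma star_isomorphism_contractive:
  assumes S: "star_subalgebra S" "closed S" and \<phi>: "star_isomorphism S T \<phi>" and x: "x \<in> S"
  shows "norm (\<phi> x) \<le> norm x"
proof (rule ccontr)
  assume "\<not> norm (\<phi> x) \<le> norm x"
  then have gt: "(norm x)\<^sup>2 < (norm (\<phi> x))\<^sup>2" by (intro power_strict_mono) auto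
  define y where "y = adj x * x"
  have axS: "adj x \<in> S" using S x by (simp add: star_subalgebra_def)
  then have yS: "y \<in> S" using S x by (simp add: y_def star_subalgebra_def)
  have \<phi>y: "\<phi> y = adj (\<phi> x) * \<phi> x" using \<phi> x axS by (simp add: star_isomorphism_def y_def)
  have T: "norm (emb (\<phi> y)) = (norm (\<phi> x))\<^sup>2" "adj (emb (\<phi> y)) = emb (\<phi> y)"
    by (simp_all add: \<phi>y cstar_identity adj_mult adj_adj flip: Unitize_simps)
  have "norm (emb (\<phi> y)) > 0" using T(1) gt zero_le_power2[of "norm x"] by linarith
  then have "emb (\<phi> y) \<noteq> 0" by (rule zero_less_norm_iff[THEN iffD1])
  with T obtain \<mu> where \<mu>: "\<mu> \<in> spectrum (emb (\<phi> y))" "cmod \<mu> = (norm (\<phi> x))\<^sup>2"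
    using spectral_radius_attained by metis
  have mu0: "\<mu> \<noteq> 0" using \<mu>(2) gt zero_le_power2[of "norm x"] by auto
  have "norm y < cmod \<mu>" using gt \<mu>(2) by (simp add: y_def cstar_identity)
  from quasi_inverse_in_subalgebra[OF S yS this] obtain w where
    w: "w \<in> S" "\<mu> *\<^sub>C w = y + y * w" "\<mu> *\<^sub>C w = y + w * y" .
  have yw: "y * w \<in> S" "w * y \<in> S" using S w yS by (simp_all add: star_subalgebra_def)
  have "\<phi> (\<mu> *\<^sub>C w) = \<mu> *\<^sub>C \<phi> w" "\<phi> (y + y * w) = \<phi> y + \<phi> y * \<phi> w" "\<phi> (y + w * y) = \<phi> y + \<phi> w * \<phi> y"
    using \<phi> w(1) yS yw by (simp_all add: star_isomorphism_def)
  then have "\<mu> *\<^sub>C \<phi> w = \<phi> y + \<phi> y * \<phi> w" "\<mu> *\<^sub>C \<phi> w = \<phi> y + \<phi> w * \<phi> y" using w by metis+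
  with quasi_inverse[OF mu0] \<mu>(1) show False by blast
qed

lemma star_isomorphism_inv:
  assumes S: "star_subalgebra S" and \<phi>: "star_isomorphism S T \<phi>"
  shows "star_isomorphism T S (inv_into S \<phi>)"
proof -
  define \<psi> where "\<psi> = inv_into S \<phi>"
  have b: "bij_betw \<phi> S T" using \<phi> by (simp add: star_isomorphism_def)
  have \<psi>: "\<psi> y \<in> S" "\<phi> (\<psi> y) = y" if "y \<in> T" for y
    using b that by (auto simp: \<psi>_def bij_betw_def inv_into_into f_inv_into_f)
  have \<psi>\<phi>: "\<psi> (\<phi> x) = x" if "x \<in> S" for x
    using b that by (simp add: \<psi>_def bij_betw_def inv_into_f_f)
  have "\<psi> (x + y) = \<psi> x + \<psi> y \<and> \<psi> (x * y) = \<psi> x * \<psi> y" if "x \<in> T" "y \<in> T" for x y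
  proof -
    have m: "\<psi> x + \<psi> y \<in> S" "\<psi> x * \<psi> y \<in> S" using S \<psi> that by (simp_all add: star_subalgebra_def)
    have "\<phi> (\<psi> x + \<psi> y) = x + y" "\<phi> (\<psi> x * \<psi> y) = x * y"
      using \<phi> \<psi> that by (simp_all add: star_isomorphism_def)
    then show ?thesis using \<psi>\<phi>[OF m(1)] \<psi>\<phi>[OF m(2)] by simp
  qed
  moreover have "\<psi> (c *\<^sub>C x) = c *\<^sub>C \<psi> x" "\<psi> (adj x) = adj (\<psi> x)" if "x \<in> T" for c x
  proof -
    have m: "c *\<^sub>C \<psi> x \<in> S" "adj (\<psi> x) \<in> S" using S \<psi> that by (simp_all add: star_subalgebra_def)
    have "\<phi> (c *\<^sub>C \<psi> x) = c *\<^sub>C x" "\<phi> (adj (\<psi> x)) = adj x"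
      using \<phi> \<psi> that by (simp_all add: star_isomorphism_def)
    then show "\<psi> (c *\<^sub>C x) = c *\<^sub>C \<psi> x" "\<psi> (adj x) = adj (\<psi> x)"
      using \<psi>\<phi>[OF m(1)] \<psi>\<phi>[OF m(2)] by simp_all
  qed
  moreover have "bij_betw \<psi> T S" unfolding \<psi>_def by (rule bij_betw_inv_into[OF b])
  ultimately show ?thesis unfolding star_isomorphism_def \<psi>_def[symmetric] by blast
qed

lemma isomorphism_imp_same_norms:
  assumes \<phi>: "star_isomorphism (cstar_generated X) (cstar_generated Y) \<phi>" and XY: "\<phi> X = Y"
  shows "same_norms X Y"
  unfolding same_norms_def
proof
  fix t
  note X = star_subalgebra_cstar_generated[of X] and Y = star_subalgebra_cstar_generated[of Y]
  have m: "star_eval X t \<in> cstar_generated X" for t by (rule star_eval_in_subalgebra[OF X(1,3)])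
  have e: "\<phi> (star_eval X t) = star_eval Y t" for t
    using \<phi> m by (induction t) (simp_all add: XY star_isomorphism_def)
  define \<psi> where "\<psi> = inv_into (cstar_generated X) \<phi>"
  have \<psi>: "star_isomorphism (cstar_generated Y) (cstar_generated X) \<psi>"
    unfolding \<psi>_def by (rule star_isomorphism_inv[OF X(1) \<phi>])
  have "\<psi> (star_eval Y t) = star_eval X t"
    using \<phi> m e unfolding \<psi>_def star_isomorphism_def bij_betw_def by (metis inv_into_f_f)
  then show "norm (star_eval X t) = norm (star_eval Y t)"
    using star_isomorphism_contractive[OF X(1,2) \<phi> m, of t]
      star_isomorphism_contractive[OF Y(1,2) \<psi> star_eval_in_subalgebra[OF Y(1,3)], of t] e by simp
qed

theorem theoremC:
  fixes X :: "'a::cstar_algebra" and Y :: "'b::cstar_algebra"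
  assumes "scaling_element X" and "scaling_element Y"
  shows "(\<exists>\<phi> :: 'a \<Rightarrow> 'b.
            star_isomorphism (cstar_generated X) (cstar_generated Y) \<phi> \<and> \<phi> X = Y)
    \<longleftrightarrow> spectrum (absolute_value (adj X)) = spectrum (absolute_value (adj Y))
        \<and> ((proper X \<and> proper Y) \<or> (nonproper X \<and> nonproper Y))"
proof -
  have "(\<exists>\<phi> :: 'a \<Rightarrow> 'b. star_isomorphism (cstar_generated X) (cstar_generated Y) \<phi> \<and> \<phi> X = Y)
      \<longleftrightarrow> same_norms X Y"
    using same_norms_imp_isomorphism isomorphism_imp_same_norms by blast
  then show ?thesis
    unfolding same_norms_iff[OF assms] using assms by (auto simp: proper_def)
qed

end
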